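(* Let $b,\sigma:\mathbb{R}\to\mathbb{R}$ and $K\in L^2_{\mathrm{loc}}(\mathbb{R}_+)$. Suppose there are constants $C,C^*>0$, exponents $\chi_b,\chi_\sigma\in(0,1]$ and $\gamma,\gamma_*>0$ such that $$|b(y)-b(x)|\le C|y-x|^{\chi_b},\quad |\sigma(y)-\sigma(x)|\le C|y-x|^{\chi_\sigma}\quad (x,y\in\mathbb{R}),\qquad C^*t^{2\gamma_*}\le\int_0^tK(s)^2\,\mathrm{d}s\le Ct^{2\gamma}\quad (t\in(0,1]).$$ For each $n\ge1$ let $X^{x_n}$ be a continuous weak solution, defined on some filtered probability space carrying a Brownian motion $B$ (both may depend on $n$), of $$X_t=x_n+\int_0^tK(t-s)\,b(X_s)\,\mathrm{d}s+\int_0^tK(t-s)\,\sigma(X_s)\,\mathrm{d}B_s,\qquad t\in\mathbb{R}_+,$$ with initial condition $x_n\in\mathbb{R}$. Suppose that $x_n\to\overline{x}$ and $\sigma(\overline{x})\neq0$. Put $\lambda(n)=\big(\int_0^{1/n}K(r)^2\,\mathrm{d}r\big)^{-1}$. Fix $N\in\mathbb{N}$ and consider time points $0<t_1<\dots<t_N$ such that the following conditions are satisfied: (i) the constants $\gamma_*\ge\gamma$ satisfy $\gamma_*<\min\{\gamma+\tfrac12,\ \gamma(1+\chi_\sigma)\}$; (ii) there exists $\overline{K}\in L^2_{\mathrm{loc}}(\mathbb{R}_+)$ such that for all $0\le s<t\le1$ $$\lim_{n\to\infty}\lambda(n)\int_0^{s/n}K((t-s)/n+r)K(r)\,\mathrm{d}r=\int_0^s\overline{K}(t-s+r)\overline{K}(r)\,\mathrm{d}r.$$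 Then, as $n\to\infty$, $$\Big(\sqrt{\lambda(n)}\,\big(X^{x_n}_{t_j/n}-x_n\big)\Big)_{j=1,\dots,N}\ \xrightarrow{\ d\ }\ \big(Y^{\sigma,\infty}_{t_j}\big)_{j=1,\dots,N},$$ where the Gaussian limit process is given by $Y^{\sigma,\infty}_t=\sigma(\overline{x})\int_0^t\overline{K}(t-s)\,\mathrm{d}B_s$, with $B$ a Brownian motion.
   Context: $\mathbb{R}_+=[0,\infty)$. $\xrightarrow{d}$ denotes convergence in distribution. A continuous weak solution is a process with continuous sample paths, adapted on some filtered probability space carrying a real-valued Brownian motion, satisfying the integral equation.
   Formalization: Condition (ii) is required for all 0≤s≤t≤max(1,t_N) instead of 0≤s<t≤1; without the diagonal s=t (K(r)=sin(1/r) on (0,1], limit kernel 0) or beyond time 1 (K=1, limit kernel changed after 1) the claim is false. *)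

theory Defs
  imports "HOL-Probability.Probability"
begin

text \<open>
  Elements of \<open>L\<^sup>2\<^sub>l\<^sub>o\<^sub>c\<close> on the half line are represented by Borel functions
  (every class has such a representative). Values of \<open>K\<close> at negative arguments are irrelevant
  throughout.
\<close>

definition L2_loc :: "(real \<Rightarrow> real) \<Rightarrow> bool" where
  "L2_loc K \<longleftrightarrow> set_borel_measurable lborel {0..} K \<and>
     (\<forall>T\<ge>0. set_integrable lborel {0..T} (\<lambda>s. (K s)\<^sup>2))"

definition filtered_prob_space :: "'a measure \<Rightarrow> (real \<Rightarrow> 'a measure) \<Rightarrow> bool" where
  "filtered_prob_space M F \<longleftrightarrow> prob_space M \<and> (\<forall>t\<ge>0. subalgebra M (F t)) \<and>
     (\<forall>s t. 0 \<le> s \<longrightarrow> s \<le> t \<longrightarrow> sets (F s) \<subseteq> sets (F t))"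

definition adapted :: "(real \<Rightarrow> 'a measure) \<Rightarrow> (real \<Rightarrow> 'a \<Rightarrow> real) \<Rightarrow> bool" where
  "adapted F X \<longleftrightarrow> (\<forall>t\<ge>0. X t \<in> borel_measurable (F t))"

definition continuous_paths :: "'a measure \<Rightarrow> (real \<Rightarrow> 'a \<Rightarrow> real) \<Rightarrow> bool" where
  "continuous_paths M X \<longleftrightarrow> (\<forall>\<omega>\<in>space M. continuous_on {0..} (\<lambda>t. X t \<omega>))"

text \<open>Standard Brownian motion relative to a filtration; the usual conditions are not required.\<close>

definition brownian_motion ::
  "'a measure \<Rightarrow> (real \<Rightarrow> 'a measure) \<Rightarrow> (real \<Rightarrow> 'a \<Rightarrow> real) \<Rightarrow> bool" where
  "brownian_motion M F B \<longleftrightarrow> filtered_prob_space M F \<and> adapted F B \<and> continuous_paths M B \<and>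
     (AE \<omega> in M. B 0 \<omega> = 0) \<and>
     (\<forall>s t. 0 \<le> s \<longrightarrow> s < t \<longrightarrow>
        prob_space.indep_set M (sets (F s))
          (sets (vimage_algebra (space M) (\<lambda>\<omega>. B t \<omega> - B s \<omega>) borel)) \<and>
        distributed M lborel (\<lambda>\<omega>. B t \<omega> - B s \<omega>) (normal_density 0 (sqrt (t - s))))"

definition converges_in_probability ::
  "'a measure \<Rightarrow> (nat \<Rightarrow> 'a \<Rightarrow> real) \<Rightarrow> ('a \<Rightarrow> real) \<Rightarrow> bool" where
  "converges_in_probability M Z W \<longleftrightarrow>
     (\<forall>\<epsilon>>0. (\<lambda>n. measure M {\<omega>\<in>space M. \<epsilon> \<le> \<bar>Z n \<omega> - W \<omega>\<bar>}) \<longlonglongrightarrow> 0)"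

text \<open>
  \<open>elementary_integrand M F T m u \<xi>\<close>: the data of the elementary process
  \<open>\<Sum>i<m. \<xi>\<^sub>i 1\<^bsub>(u\<^sub>i, u\<^sub>i\<^sub>+\<^sub>1]\<^esub>\<close> on \<open>[0, T]\<close>, with
  bounded \<open>F\<^bsub>u\<^sub>i\<^esub>\<close>-measurable coefficients \<open>\<xi>\<^sub>i\<close>.
\<close>

definition elementary_integrand ::
  "'a measure \<Rightarrow> (real \<Rightarrow> 'a measure) \<Rightarrow> real \<Rightarrow> nat \<Rightarrow> (nat \<Rightarrow> real) \<Rightarrow> (nat \<Rightarrow> 'a \<Rightarrow> real) \<Rightarrow> bool" where
  "elementary_integrand M F T m u \<xi> \<longleftrightarrow>
     0 \<le> u 0 \<and> (\<forall>i<m. u i \<le> u (Suc i)) \<and> u m \<le> T \<and>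
     (\<forall>i<m. \<xi> i \<in> borel_measurable (F (u i)) \<and> bounded (\<xi> i ` space M))"

definition elementary_process ::
  "nat \<Rightarrow> (nat \<Rightarrow> real) \<Rightarrow> (nat \<Rightarrow> 'a \<Rightarrow> real) \<Rightarrow> real \<Rightarrow> 'a \<Rightarrow> real" where
  "elementary_process m u \<xi> s \<omega> = (\<Sum>i<m. \<xi> i \<omega> * indicator {u i<..u (Suc i)} s)"

definition elementary_integral ::
  "(real \<Rightarrow> 'a \<Rightarrow> real) \<Rightarrow> nat \<Rightarrow> (nat \<Rightarrow> real) \<Rightarrow> (nat \<Rightarrow> 'a \<Rightarrow> real) \<Rightarrow> 'a \<Rightarrow> real" where
  "elementary_integral B m u \<xi> \<omega> = (\<Sum>i<m. \<xi> i \<omega> * (B (u (Suc i)) \<omega> - B (u i) \<omega>))"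

text \<open>
  \<open>has_ito_integral M F B T H J\<close>: the random variable \<open>J\<close> is (a version of) the Ito integral
  of \<open>H\<close> against \<open>B\<close> over \<open>[0, T]\<close>. The integrand ranges over the usual domain of progressively
  measurable processes with almost surely square integrable paths, and the integral is the limit
  in probability of the integrals of approximating elementary processes; it is determined up to
  null sets. The pathwise integrals below are Bochner integrals; the square integrability
  conditions ensure that the junk value for non-integrable functions only occurs on a null set.
\<close>

definition has_ito_integral ::
  "'a measure \<Rightarrow> (real \<Rightarrow> 'a measure) \<Rightarrow> (real \<Rightarrow> 'a \<Rightarrow> real) \<Rightarrow> real \<Rightarrow>
   (real \<Rightarrow> 'a \<Rightarrow> real) \<Rightarrow> ('a \<Rightarrow> real) \<Rightarrow> bool" where
  "has_ito_integral M F B T H J \<longleftrightarrow>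
     (\<forall>u\<in>{0..T}. (\<lambda>(s, \<omega>). H s \<omega>) \<in> borel_measurable (restrict_space borel {0..u} \<Otimes>\<^sub>M F u)) \<and>
     (AE \<omega> in M. set_integrable lborel {0..T} (\<lambda>s. (H s \<omega>)\<^sup>2)) \<and>
     J \<in> borel_measurable M \<and>
     (\<exists>m u \<xi>. (\<forall>k. elementary_integrand M F T (m k) (u k) (\<xi> k)) \<and>
        converges_in_probability M
          (\<lambda>k \<omega>. LINT s:{0..T}|lborel. (elementary_process (m k) (u k) (\<xi> k) s \<omega> - H s \<omega>)\<^sup>2)
          (\<lambda>_. 0) \<and>
        converges_in_probability M (\<lambda>k. elementary_integral B (m k) (u k) (\<xi> k)) J)"

text \<open>
  Continuous weak solutions: for every \<open>t\<close> the Volterra equation holds almost surely, expressed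
  by saying that \<open>X\<^sub>t - x - \<integral>\<^sub>0\<^sup>t K (t - s) b (X\<^sub>s) ds\<close> is a version of the stochastic integral.
\<close>

definition continuous_weak_solution ::
  "(real \<Rightarrow> real) \<Rightarrow> (real \<Rightarrow> real) \<Rightarrow> (real \<Rightarrow> real) \<Rightarrow> real \<Rightarrow>
   'a measure \<Rightarrow> (real \<Rightarrow> 'a measure) \<Rightarrow> (real \<Rightarrow> 'a \<Rightarrow> real) \<Rightarrow> (real \<Rightarrow> 'a \<Rightarrow> real) \<Rightarrow> bool" where
  "continuous_weak_solution K b \<sigma> x M F B X \<longleftrightarrow>
     brownian_motion M F B \<and> adapted F X \<and> continuous_paths M X \<and>
     (\<forall>t\<ge>0. has_ito_integral M F B t (\<lambda>s \<omega>. K (t - s) * \<sigma> (X s \<omega>))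
        (\<lambda>\<omega>. X t \<omega> - x - (LINT s:{0..t}|lborel. K (t - s) * b (X s \<omega>))))"

text \<open>
  Weak convergence of the laws. The library's \<open>weak_conv_m\<close> covers real-valued random variables
  only.
\<close>

definition converges_in_distribution ::
  "(nat \<Rightarrow> 'a measure) \<Rightarrow> (nat \<Rightarrow> 'a \<Rightarrow> 'e::topological_space) \<Rightarrow>
   'b measure \<Rightarrow> ('b \<Rightarrow> 'e) \<Rightarrow> bool" where
  "converges_in_distribution M Z W Y \<longleftrightarrow>
     (\<forall>f :: 'e \<Rightarrow> real. continuous_on UNIV f \<longrightarrow> bounded (range f) \<longrightarrow>
        (\<lambda>n. \<integral>\<omega>. f (Z n \<omega>) \<partial>M n) \<longlonglongrightarrow> (\<integral>\<omega>. f (Y \<omega>) \<partial>W))"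

definition scaling :: "(real \<Rightarrow> real) \<Rightarrow> nat \<Rightarrow> real" where
  "scaling K n = inverse (LINT r:{0..1 / real n}|lborel. (K r)\<^sup>2)"

end

theory Submission
  imports Defs
begin

text \<open>
  Write \<open>\<kappa>(t) = \<integral>\<^sub>0\<^sup>t K\<^sup>2\<close>. At the small time \<open>T = \<tau> j / n\<close> the increment \<open>X\<^sub>T - x\<^sub>n\<close> splits into
  the drift integral, the stochastic integral of \<open>K (T - s) (\<sigma> (X\<^sub>s) - \<sigma> (x\<^sub>n))\<close>, and \<open>\<sigma> (x\<^sub>n)\<close> times the
  Wiener integral of \<open>K (T - s)\<close>. The Wiener integrals at the different times are jointly Gaussian, and
  after multiplication by \<open>\<lambda>(n)\<close> their covariances are precisely the quantities whose limits are the
  covariances of the limit process. The other two terms disappear in mean square: since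
  \<open>E |X\<^sub>s - x\<^sub>n|\<^sup>2\<close> is at most a constant times \<open>\<kappa>(s)\<close> (\<open>second_moment\<close>), the drift contributes at most a constant
  times \<open>\<lambda>(n) \<kappa>(T) T\<close>, and the fluctuation of \<open>\<sigma>\<close> at most a constant times \<open>\<lambda>(n) \<kappa>(T) a\<^bsup>\<chi>\<^esup>\<close>, where
  \<open>\<chi>\<close> is the Hoelder exponent of \<open>\<sigma>\<close> and \<open>a\<close> is of order \<open>\<kappa>(T) + 1/n\<close> (\<open>solution_wiener_approx\<close>).
  Here \<open>\<lambda>(n) \<kappa>(T)\<close> converges, by the covariance hypothesis for two equal times, while \<open>T\<close> and \<open>a\<close> tend to
  zero.

  The Ito integral is only given as a limit in probability of some sequence of elementary integrals. Apart
  from linearity in the integrand, all that is used about it is the inequality \<open>E [1\<^bsub>A(T)\<^esub> J\<^sup>2] \<le> E \<integral>\<^sub>0\<^sup>T 1\<^bsub>A(s)\<^esub> H\<^sub>s\<^sup>2 ds\<close> for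
  decreasing adapted events \<open>A(s)\<close> (\<open>ito_integral_localized_bound\<close>). With \<open>A(s)\<close> the event that the path has
  stayed in a bounded interval it yields the second moments of the solution, by absorption rather than by a
  Gronwall argument. Applied to the difference of the integrand and a deterministic step
  function it compares a stochastic integral with a finite linear combination of Brownian increments
  (\<open>wiener_approx_ito_integral\<close>), for which the expectation of a cosine is explicit
  (\<open>wiener_approx_expectation_cos\<close>). Expectations of cosines of linear functionals, together with bounded
  second moments, determine convergence in distribution (\<open>levy_continuity_cos\<close>).
\<close>

section \<open>Convergence in distribution from second moments and cosines\<close>

text \<open>
  Linear combinations of the test functions \<open>cos (u \<bullet> x + c)\<close> that occur in the continuity theorem
  below. Real phases \<open>c\<close> replace complex exponentials: by the addition formulas the set is
  already closed under products.
\<close>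

inductive_set trig_sums :: "('v::euclidean_space \<Rightarrow> real) set" where
  zero: "(\<lambda>_. 0) \<in> trig_sums"
| add_cos: "p \<in> trig_sums \<Longrightarrow> (\<lambda>x. p x + a * cos (u \<bullet> x + c)) \<in> trig_sums"

lemma trig_sums_cos: "(\<lambda>x. a * cos (u \<bullet> x + c)) \<in> trig_sums"
  using trig_sums.add_cos[OF trig_sums.zero, of a u c] by simp

lemma trig_sums_const: "(\<lambda>_. a) \<in> trig_sums"
  using trig_sums_cos[of a 0 0] by simp

lemma trig_sums_add:
  assumes "q \<in> trig_sums" "p \<in> trig_sums" shows "(\<lambda>x. p x + q x) \<in> trig_sums"
  using assms
proof induction
  case zero then show ?case by simp
next
  case (add_cos q a u c)
  from trig_sums.add_cos[OF add_cos.IH[OF add_cos.prems], of a u c]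
  show ?case by (simp add: add.assoc)
qed

lemma trig_sums_mult_cos:
  assumes "p \<in> trig_sums" shows "(\<lambda>x. p x * (a * cos (u \<bullet> x + c))) \<in> trig_sums"
  using assms
proof induction
  case zero then show ?case by (simp add: trig_sums.zero)
next
  case (add_cos p a' u' c')
  have "(\<lambda>x. p x * (a * cos (u \<bullet> x + c)) + (a' * a / 2) * cos ((u' - u) \<bullet> x + (c' - c))
      + (a' * a / 2) * cos ((u' + u) \<bullet> x + (c' + c))) \<in> trig_sums"
    by (intro trig_sums.add_cos add_cos.IH)
  also have "(\<lambda>x. p x * (a * cos (u \<bullet> x + c)) + (a' * a / 2) * cos ((u' - u) \<bullet> x + (c' - c))
      + (a' * a / 2) * cos ((u' + u) \<bullet> x + (c' + c)))
      = (\<lambda>x. (p x + a' * cos (u' \<bullet> x + c')) * (a * cos (u \<bullet> x + c)))"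
  proof
    fix x
    have "(u' - u) \<bullet> x + (c' - c) = (u' \<bullet> x + c') - (u \<bullet> x + c)"
         "(u' + u) \<bullet> x + (c' + c) = (u' \<bullet> x + c') + (u \<bullet> x + c)"
      by (simp_all add: inner_diff_left inner_add_left)
    then show "p x * (a * cos (u \<bullet> x + c)) + (a' * a / 2) * cos ((u' - u) \<bullet> x + (c' - c))
      + (a' * a / 2) * cos ((u' + u) \<bullet> x + (c' + c))
      = (p x + a' * cos (u' \<bullet> x + c')) * (a * cos (u \<bullet> x + c))"
      by (simp only: cos_add cos_diff) (simp add: field_simps)
  qed
  finally show ?case .
qed

lemma trig_sums_mult:
  assumes "q \<in> trig_sums" "p \<in> trig_sums" shows "(\<lambda>x. p x * q x) \<in> trig_sums"
  using assms
proof induction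
  case zero then show ?case by (simp add: trig_sums.zero)
next
  case (add_cos q a u c)
  from trig_sums_add[OF trig_sums_mult_cos[OF add_cos.prems, of a u c] add_cos.IH[OF add_cos.prems]]
  show ?case by (simp add: algebra_simps)
qed

lemma trig_sums_continuous: "p \<in> trig_sums \<Longrightarrow> continuous_on S p"
  by (induction rule: trig_sums.induct) (auto intro!: continuous_intros)

lemma trig_sums_bounded: "p \<in> trig_sums \<Longrightarrow> \<exists>L. \<forall>x. \<bar>p x\<bar> \<le> L"
proof (induction rule: trig_sums.induct)
  case (add_cos p a u c)
  then obtain L where L: "\<And>x. \<bar>p x\<bar> \<le> L" by auto
  have "\<bar>p x + a * cos (u \<bullet> x + c)\<bar> \<le> L + \<bar>a\<bar>" for x
  proof -
    have "\<bar>a * cos (u \<bullet> x + c)\<bar> \<le> \<bar>a\<bar> * 1" unfolding abs_mult by (intro mult_left_mono) auto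
    then show ?thesis using L[of x] by linarith
  qed
  then show ?case by blast
qed auto

text \<open>
  Composition with a polynomial is what allows an approximation that is good only on a compact set to
  be cut down to a globally bounded one.
\<close>

lemma trig_sums_polynomial:
  fixes q :: "real \<Rightarrow> real"
  assumes "real_polynomial_function q" and p: "p \<in> trig_sums"
  shows "(\<lambda>x. q (p x)) \<in> trig_sums"
  using assms(1)
proof induction
  case (linear h)
  then interpret bounded_linear h .
  have "(\<lambda>x. h (p x)) = (\<lambda>x. p x * h 1)"
  proof
    fix x show "h (p x) = p x * h 1" using scaleR[of "p x" 1] by simp
  qed
  then show ?case using trig_sums_mult[OF trig_sums_const p, of "h 1"] by simp
qed (auto intro: trig_sums_const trig_sums_add trig_sums_mult)

text \<open>
  Stone--Weierstrass; \<open>cos (v \<bullet> (z - y))\<close> separates \<open>x\<close> from \<open>y\<close> when \<open>v\<close> is scaled so that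
  \<open>v \<bullet> (x - y) = 1\<close>.
\<close>

lemma trig_sums_dense:
  fixes f :: "'v::euclidean_space \<Rightarrow> real"
  assumes f: "continuous_on UNIV f" and S: "compact S" and e: "e > 0"
  shows "\<exists>p\<in>trig_sums. \<forall>x\<in>S. \<bar>f x - p x\<bar> < e"
proof -
  have sep: "\<exists>p. p \<in> trig_sums \<and> p x \<noteq> p y" if "x \<noteq> y" for x y :: 'v
  proof (rule ccontr)
    assume *: "\<not> ?thesis"
    define v where "v = (x - y) /\<^sub>R (norm (x - y))\<^sup>2"
    have "v \<bullet> x - v \<bullet> y = v \<bullet> (x - y)" by (rule inner_diff_right[symmetric])
    also have "\<dots> = 1" using that by (simp add: v_def power2_norm_eq_inner)
    finally have "v \<bullet> x - v \<bullet> y = 1" .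
    moreover have "cos (v \<bullet> x + (- (v \<bullet> y))) = cos (v \<bullet> y + (- (v \<bullet> y)))"
      using * trig_sums_cos[of 1 v "- (v \<bullet> y)"] by auto
    ultimately have "cos (1::real) = 1" by simp
    then show False using cos_monotone_0_pi[of 0 1] pi_gt3 by simp
  qed
  have "\<exists>g. g \<in> trig_sums \<and> (\<forall>x \<in> S. \<bar>f x - g x\<bar> < e)"
    by (rule Stone_Weierstrass_HOL[of S "\<lambda>p. p \<in> trig_sums"])
      (use S e f sep in \<open>auto intro: trig_sums_const trig_sums_add trig_sums_mult trig_sums_continuous
        continuous_on_subset\<close>)
  then show ?thesis by blast
qed

text \<open>
  A trigonometric sum close to \<open>f\<close> on \<open>S\<close> may be huge elsewhere. Its values lie in some interval
  \<open>[-P, P]\<close>, on which clipping to \<open>[-L, L]\<close> is uniformly approximated by a polynomial; composing with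
  that polynomial stays among the trigonometric sums and gives a bound on the whole space.
\<close>

lemma trig_sums_dense_bounded:
  fixes f :: "'v::euclidean_space \<Rightarrow> real"
  assumes f: "continuous_on UNIV f" and L: "\<And>x. \<bar>f x\<bar> \<le> L" and S: "compact S" and e: "e > 0"
  shows "\<exists>h\<in>trig_sums. (\<forall>x\<in>S. \<bar>f x - h x\<bar> \<le> 2 * e) \<and> (\<forall>x. \<bar>h x\<bar> \<le> L + e)"
proof -
  obtain p where p: "p \<in> trig_sums" "\<And>x. x \<in> S \<Longrightarrow> \<bar>f x - p x\<bar> < e"
    using trig_sums_dense[OF f S e] by auto
  obtain P where P: "\<And>x. \<bar>p x\<bar> \<le> P" using trig_sums_bounded[OF p(1)] by auto
  have L0: "L \<ge> 0" using L[of 0] by linarith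
  define clip :: "real \<Rightarrow> real" where "clip y = max (- L) (min L y)" for y
  have "continuous_on {-P..P} clip" unfolding clip_def by (intro continuous_intros)
  then obtain q where q: "real_polynomial_function q" "\<And>y. y \<in> {-P..P} \<Longrightarrow> \<bar>clip y - q y\<bar> < e"
    using Stone_Weierstrass_real_polynomial_function[of "{-P..P}" clip e] e by auto
  have close: "\<bar>clip (p x) - q (p x)\<bar> < e" for x
    using q(2)[of "p x"] P[of x] by (auto simp: abs_le_iff)
  show ?thesis
  proof (intro bexI[of _ "\<lambda>x. q (p x)"] conjI ballI allI)
    show "(\<lambda>x. q (p x)) \<in> trig_sums" by (rule trig_sums_polynomial[OF q(1) p(1)])
    fix x
    show "\<bar>q (p x)\<bar> \<le> L + e" using close[of x] L0 unfolding clip_def by (auto simp: max_def min_def split: if_splits)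
    assume "x \<in> S"
    then have "\<bar>clip (p x) - f x\<bar> \<le> e"
      using p(2)[of x] L[of x] unfolding clip_def by (auto simp: max_def min_def split: if_splits)
    then show "\<bar>f x - q (p x)\<bar> \<le> 2 * e" using close[of x] by linarith
  qed
qed

lemma (in prob_space) integrable_bounded:
  fixes g :: "'a \<Rightarrow> real"
  assumes "g \<in> borel_measurable M" "\<And>\<omega>. \<bar>g \<omega>\<bar> \<le> L"
  shows "integrable M g"
  by (rule integrable_const_bound[of _ L]) (use assms in auto)

lemma (in prob_space) second_moment_tail:
  fixes Z :: "'a \<Rightarrow> 'v::euclidean_space"
  assumes Z[measurable]: "Z \<in> borel_measurable M" and S: "(\<integral>\<^sup>+\<omega>. (norm (Z \<omega>))\<^sup>2 \<partial>M) \<le> ennreal S"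
    and "S \<ge> 0" and R: "R > 0"
  shows "prob {\<omega>\<in>space M. R \<le> norm (Z \<omega>)} \<le> S / R\<^sup>2"
proof -
  have "ennreal (prob {\<omega>\<in>space M. R \<le> norm (Z \<omega>)}) = (\<integral>\<^sup>+\<omega>. indicator {\<omega>\<in>space M. R \<le> norm (Z \<omega>)} \<omega> \<partial>M)"
    by (simp add: emeasure_eq_measure)
  also have "\<dots> \<le> (\<integral>\<^sup>+\<omega>. ennreal (1 / R\<^sup>2) * ennreal ((norm (Z \<omega>))\<^sup>2) \<partial>M)"
  proof (intro nn_integral_mono)
    fix \<omega> assume "\<omega> \<in> space M"
    have "indicator {\<omega>\<in>space M. R \<le> norm (Z \<omega>)} \<omega> \<le> (1 / R\<^sup>2) * (norm (Z \<omega>))\<^sup>2"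
      using R by (auto simp: indicator_def field_simps intro!: power_mono)
    then have "ennreal (indicator {\<omega>\<in>space M. R \<le> norm (Z \<omega>)} \<omega>) \<le> ennreal ((1 / R\<^sup>2) * (norm (Z \<omega>))\<^sup>2)"
      by (rule ennreal_leI)
    then show "indicator {\<omega>\<in>space M. R \<le> norm (Z \<omega>)} \<omega> \<le> ennreal (1 / R\<^sup>2) * ennreal ((norm (Z \<omega>))\<^sup>2)"
      by (simp add: ennreal_mult[symmetric] ennreal_indicator)
  qed
  also have "\<dots> = ennreal (1 / R\<^sup>2) * (\<integral>\<^sup>+\<omega>. (norm (Z \<omega>))\<^sup>2 \<partial>M)"
    by (intro nn_integral_cmult) simp
  also have "\<dots> \<le> ennreal (1 / R\<^sup>2) * ennreal S" by (intro mult_left_mono S) simp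
  also have "\<dots> = ennreal (S / R\<^sup>2)" using \<open>S \<ge> 0\<close> by (simp add: ennreal_mult[symmetric])
  finally show ?thesis using \<open>S \<ge> 0\<close> by simp
qed

lemma (in prob_space) expectation_trig_approx:
  fixes Z :: "'a \<Rightarrow> 'v::euclidean_space" and f h :: "'v \<Rightarrow> real"
  assumes Z[measurable]: "Z \<in> borel_measurable M" and S: "(\<integral>\<^sup>+\<omega>. (norm (Z \<omega>))\<^sup>2 \<partial>M) \<le> ennreal S" "S \<ge> 0"
    and R: "R > 0" and fc: "continuous_on UNIV f" and hc: "continuous_on UNIV h"
    and f: "\<And>x. \<bar>f x\<bar> \<le> L" and h: "\<And>x. \<bar>h x\<bar> \<le> L + e" and e: "e > 0"
    and close: "\<And>x. norm x \<le> R \<Longrightarrow> \<bar>f x - h x\<bar> \<le> 2 * e"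
  shows "\<bar>expectation (\<lambda>\<omega>. f (Z \<omega>)) - expectation (\<lambda>\<omega>. h (Z \<omega>))\<bar> \<le> 2 * e + (2 * L + e) * (S / R\<^sup>2)"
proof -
  have [measurable]: "f \<in> borel_measurable borel" "h \<in> borel_measurable borel"
    using fc hc by (auto intro: borel_measurable_continuous_onI)
  let ?A = "{\<omega>\<in>space M. R \<le> norm (Z \<omega>)}"
  have L0: "L \<ge> 0" using f[of 0] by linarith
  have i: "integrable M (\<lambda>\<omega>. f (Z \<omega>))" "integrable M (\<lambda>\<omega>. h (Z \<omega>))"
    by (rule integrable_bounded[of _ L], use f in simp_all) (rule integrable_bounded[of _ "L + e"], use h in simp_all)
  have "\<bar>expectation (\<lambda>\<omega>. f (Z \<omega>)) - expectation (\<lambda>\<omega>. h (Z \<omega>))\<bar>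
      = \<bar>expectation (\<lambda>\<omega>. f (Z \<omega>) - h (Z \<omega>))\<bar>" using i by simp
  also have "\<dots> \<le> expectation (\<lambda>\<omega>. \<bar>f (Z \<omega>) - h (Z \<omega>)\<bar>)"
    by (rule integral_abs_bound)
  also have "\<dots> \<le> expectation (\<lambda>\<omega>. 2 * e + (2 * L + e) * indicator ?A \<omega>)"
  proof (intro integral_mono)
    show "integrable M (\<lambda>\<omega>. \<bar>f (Z \<omega>) - h (Z \<omega>)\<bar>)" using i by simp
    show "integrable M (\<lambda>\<omega>. 2 * e + (2 * L + e) * indicator ?A \<omega>)"
      by (intro integrable_bounded[of _ "2 * e + (2 * L + e)"]) (use e L0 in \<open>auto simp: indicator_def\<close>)
    fix \<omega> assume "\<omega> \<in> space M"
    then show "\<bar>f (Z \<omega>) - h (Z \<omega>)\<bar> \<le> 2 * e + (2 * L + e) * indicator ?A \<omega>"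
      using close[of "Z \<omega>"] f[of "Z \<omega>"] h[of "Z \<omega>"] e by (auto simp: indicator_def)
  qed
  also have "\<dots> = 2 * e + (2 * L + e) * prob ?A"
    by (subst Bochner_Integration.integral_add) (auto simp: emeasure_eq_measure prob_space)
  also have "\<dots> \<le> 2 * e + (2 * L + e) * (S / R\<^sup>2)"
    using second_moment_tail[OF Z S R] e L0 by (intro add_left_mono mult_left_mono) auto
  finally show ?thesis .
qed

lemma (in prob_space) expectation_trig_add:
  fixes Z :: "'a \<Rightarrow> 'v::euclidean_space"
  assumes p: "p \<in> trig_sums" and Z[measurable]: "Z \<in> borel_measurable M"
  shows "expectation (\<lambda>\<omega>. p (Z \<omega>) + a * cos (u \<bullet> Z \<omega> + c))
    = expectation (\<lambda>\<omega>. p (Z \<omega>)) + a * expectation (\<lambda>\<omega>. cos (u \<bullet> Z \<omega> + c))"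
proof -
  have [measurable]: "p \<in> borel_measurable borel"
    using p by (auto intro: borel_measurable_continuous_onI trig_sums_continuous)
  obtain L where "\<And>x. \<bar>p x\<bar> \<le> L" using trig_sums_bounded p by blast
  then have "integrable M (\<lambda>\<omega>. p (Z \<omega>))" by (intro integrable_bounded[of _ L]) auto
  moreover have "integrable M (\<lambda>\<omega>. cos (u \<bullet> Z \<omega> + c))"
    by (rule integrable_bounded[of _ 1]) auto
  ultimately show ?thesis by simp
qed

text \<open>
  A multivariate continuity theorem. The second moments give tightness, which makes the region where
  the bounded trigonometric approximation of a test function fails negligible for all \<open>n\<close> at once.
\<close>

theorem levy_continuity_cos:
  fixes Z :: "nat \<Rightarrow> 'a \<Rightarrow> 'v::euclidean_space" and Y :: "'b \<Rightarrow> 'v"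
  assumes M: "\<And>n. n \<ge> 1 \<Longrightarrow> prob_space (M n)" and W: "prob_space W"
    and Z: "\<And>n. n \<ge> 1 \<Longrightarrow> Z n \<in> borel_measurable (M n)" and Y[measurable]: "Y \<in> borel_measurable W"
    and ZS: "\<forall>\<^sub>F n in sequentially. (\<integral>\<^sup>+\<omega>. (norm (Z n \<omega>))\<^sup>2 \<partial>M n) \<le> ennreal S"
    and YS: "(\<integral>\<^sup>+\<omega>. (norm (Y \<omega>))\<^sup>2 \<partial>W) \<le> ennreal S"
    and conv: "\<And>u c. (\<lambda>n. \<integral>\<omega>. cos (u \<bullet> Z n \<omega> + c) \<partial>M n) \<longlonglongrightarrow> (\<integral>\<omega>. cos (u \<bullet> Y \<omega> + c) \<partial>W)"
  shows "converges_in_distribution M Z W Y"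
  unfolding converges_in_distribution_def
proof (intro allI impI)
  interpret W: prob_space W by (rule W)
  have convp: "(\<lambda>n. \<integral>\<omega>. p (Z n \<omega>) \<partial>M n) \<longlonglongrightarrow> (\<integral>\<omega>. p (Y \<omega>) \<partial>W)" if "p \<in> trig_sums" for p
    using that
  proof induction
    case (add_cos p a u c)
    have "(\<lambda>n. (\<integral>\<omega>. p (Z n \<omega>) \<partial>M n) + a * (\<integral>\<omega>. cos (u \<bullet> Z n \<omega> + c) \<partial>M n))
       \<longlonglongrightarrow> (\<integral>\<omega>. p (Y \<omega>) \<partial>W) + a * (\<integral>\<omega>. cos (u \<bullet> Y \<omega> + c) \<partial>W)"
      by (intro tendsto_intros add_cos.IH conv)
    also have "(\<integral>\<omega>. p (Y \<omega>) \<partial>W) + a * (\<integral>\<omega>. cos (u \<bullet> Y \<omega> + c) \<partial>W) = (\<integral>\<omega>. p (Y \<omega>) + a * cos (u \<bullet> Y \<omega> + c) \<partial>W)"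
      by (rule W.expectation_trig_add[OF add_cos.hyps Y, symmetric])
    finally show ?case
    proof (rule Lim_transform_eventually)
      show "\<forall>\<^sub>F n in sequentially. (\<integral>\<omega>. p (Z n \<omega>) \<partial>M n) + a * (\<integral>\<omega>. cos (u \<bullet> Z n \<omega> + c) \<partial>M n)
          = (\<integral>\<omega>. p (Z n \<omega>) + a * cos (u \<bullet> Z n \<omega> + c) \<partial>M n)"
        using eventually_ge_at_top[of 1]
        by eventually_elim (rule prob_space.expectation_trig_add[OF M add_cos.hyps Z, symmetric])
    qed
  qed simp
  fix f :: "'v \<Rightarrow> real" assume fc: "continuous_on UNIV f" and "bounded (range f)"
  then obtain L where L: "\<And>x. \<bar>f x\<bar> \<le> L" "L > 0"
    by (metis bounded_pos rangeI real_norm_def)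
  define T where "T = max S 0"
  have T: "T \<ge> 0" "ennreal S = ennreal T" by (auto simp: T_def max_def ennreal_neg)
  show "(\<lambda>n. \<integral>\<omega>. f (Z n \<omega>) \<partial>M n) \<longlonglongrightarrow> (\<integral>\<omega>. f (Y \<omega>) \<partial>W)"
  proof (rule LIMSEQ_I)
    fix r :: real assume r: "r > 0"
    \<comment> \<open>the radius \<open>R\<close> makes the tail term in \<open>expectation_trig_approx\<close> at most \<open>e\<close>\<close>
    define e where "e = r / 12"
    define R where "R = sqrt ((2 * L + e) * (T + 1) / e)"
    have e: "e > 0" using r by (simp add: e_def)
    have R: "R > 0" unfolding R_def using e L(2) T by simp
    have R2: "R\<^sup>2 = (2 * L + e) * (T + 1) / e" unfolding R_def using e L(2) T by simp
    have "2 * L + e \<noteq> 0" using e L(2) by simp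
    then have "(2 * L + e) * (T / R\<^sup>2) = e * (T / (T + 1))" unfolding R2 by simp
    also have "\<dots> \<le> e * 1" using e T by (intro mult_left_mono) auto
    finally have bnd: "2 * e + (2 * L + e) * (T / R\<^sup>2) \<le> 3 * e" by simp
    obtain h where h: "h \<in> trig_sums" "\<And>x. norm x \<le> R \<Longrightarrow> \<bar>f x - h x\<bar> \<le> 2 * e" "\<And>x. \<bar>h x\<bar> \<le> L + e"
      using trig_sums_dense_bounded[OF fc L(1) compact_cball[of 0 R] e] by (auto simp: dist_norm)
    have hc: "continuous_on UNIV h" by (rule trig_sums_continuous[OF h(1)])
    have "\<bar>(\<integral>\<omega>. f (Y \<omega>) \<partial>W) - (\<integral>\<omega>. h (Y \<omega>) \<partial>W)\<bar> \<le> 3 * e"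
      using W.expectation_trig_approx[OF Y _ T(1) R fc hc L(1) h(3) e h(2)] YS T bnd by auto
    note Yh = this
    have "\<forall>\<^sub>F n in sequentially. \<bar>(\<integral>\<omega>. f (Z n \<omega>) \<partial>M n) - (\<integral>\<omega>. h (Z n \<omega>) \<partial>M n)\<bar> \<le> 3 * e"
      using ZS eventually_ge_at_top[of 1]
    proof eventually_elim
      case (elim n)
      interpret prob_space "M n" by (rule M) fact
      show ?case
        using expectation_trig_approx[OF Z _ T(1) R fc hc L(1) h(3) e h(2)] elim T bnd by auto
    qed
    moreover have "\<forall>\<^sub>F n in sequentially. \<bar>(\<integral>\<omega>. h (Z n \<omega>) \<partial>M n) - (\<integral>\<omega>. h (Y \<omega>) \<partial>W)\<bar> < e"
      using convp[OF h(1)] e by (auto simp: tendsto_iff dist_real_def)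
    ultimately have "\<forall>\<^sub>F n in sequentially. norm ((\<integral>\<omega>. f (Z n \<omega>) \<partial>M n) - (\<integral>\<omega>. f (Y \<omega>) \<partial>W)) < r"
      by eventually_elim (use Yh r in \<open>unfold real_norm_def e_def, linarith\<close>)
    then show "\<exists>N. \<forall>n\<ge>N. norm ((\<integral>\<omega>. f (Z n \<omega>) \<partial>M n) - (\<integral>\<omega>. f (Y \<omega>) \<partial>W)) < r"
      by (simp add: eventually_sequentially)
  qed
qed

section \<open>Elementary processes and their refinements\<close>

text \<open>
  The single identity behind refinement of partitions. It is used with \<open>g\<close> a path of the integrator
  and, to obtain the corresponding statement on processes, with \<open>g = 1\<^bsub>[s, \<infinity>)\<^esub>\<close>.
\<close>

lemma increment_telescope:
  fixes p :: "nat \<Rightarrow> real" and g :: "real \<Rightarrow> real"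
  assumes p: "strict_mono_on {..N} p" and a: "a \<in> p ` {..N}" and b: "b \<in> p ` {..N}" and "a \<le> b"
  shows "g b - g a = (\<Sum>j<N. indicator {a<..b} (p (Suc j)) * (g (p (Suc j)) - g (p j)))"
proof -
  obtain \<alpha> \<beta> where *: "\<alpha> \<le> N" "\<beta> \<le> N" "a = p \<alpha>" "b = p \<beta>" using a b by auto
  have le: "\<alpha> \<le> \<beta>"
    using strict_mono_on_leD[OF p, of \<beta> \<alpha>] * \<open>a \<le> b\<close> strict_mono_onD[OF p, of \<beta> \<alpha>] by (meson atMost_iff leI not_le)
  have iff: "p (Suc j) \<in> {a<..b} \<longleftrightarrow> \<alpha> \<le> j \<and> j < \<beta>" if "j < N" for j
    using * that strict_mono_on_less[OF p, of \<alpha> "Suc j"] strict_mono_on_less_eq[OF p, of "Suc j" \<beta>] by auto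
  have "(\<Sum>j<N. indicator {a<..b} (p (Suc j)) * (g (p (Suc j)) - g (p j)))
      = (\<Sum>j\<in>{\<alpha>..<\<beta>}. g (p (Suc j)) - g (p j))"
    using * iff by (intro sum.mono_neutral_cong_right) (auto simp: indicator_def)
  also have "\<dots> = g (p \<beta>) - g (p \<alpha>)" by (rule sum_Suc_diff'[OF le])
  finally show ?thesis using * by simp
qed

text \<open>
  On a finer partition an elementary process has as coefficients its own values at the right end
  points of the cells. Passing to partitions with prescribed extra nodes puts different
  elementary processes on a common partition and makes the mesh small.
\<close>

lemma elementary_integral_refine:
  assumes p: "strict_mono_on {..N} p" and u: "u ` {..m} \<subseteq> p ` {..N}" and mono: "\<And>i. i < m \<Longrightarrow> u i \<le> u (Suc i)"
  shows "elementary_integral B m u \<xi> \<omega>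
    = elementary_integral B N p (\<lambda>j. elementary_process m u \<xi> (p (Suc j))) \<omega>"
proof -
  have "elementary_integral B m u \<xi> \<omega>
      = (\<Sum>i<m. \<xi> i \<omega> * (\<Sum>j<N. indicator {u i<..u (Suc i)} (p (Suc j)) * (B (p (Suc j)) \<omega> - B (p j) \<omega>)))"
    unfolding elementary_integral_def
    by (intro sum.cong refl arg_cong2[of _ _ _ _ "(*)"] increment_telescope[OF p, of _ _ "\<lambda>t. B t \<omega>"])
      (use u mono in auto)
  also have "\<dots> = (\<Sum>j<N. \<Sum>i<m. \<xi> i \<omega> * (indicator {u i<..u (Suc i)} (p (Suc j)) * (B (p (Suc j)) \<omega> - B (p j) \<omega>)))"
    unfolding sum_distrib_left by (rule sum.swap)
  also have "\<dots> = elementary_integral B N p (\<lambda>j. elementary_process m u \<xi> (p (Suc j))) \<omega>"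
    unfolding elementary_integral_def elementary_process_def sum_distrib_right mult.assoc ..
  finally show ?thesis .
qed

text \<open>
  The value of an elementary process at \<open>s\<close> is its integral against the step path \<open>1\<^bsub>[s, \<infinity>)\<^esub>\<close>, so that
  facts on integrals carry over.
\<close>

lemma elementary_process_eq_integral:
  assumes "\<And>i. i < m \<Longrightarrow> u i \<le> u (Suc i)"
  shows "elementary_process m u \<xi> s \<omega> = elementary_integral (\<lambda>t _. if s \<le> t then 1 else 0) m u \<xi> \<omega>"
  unfolding elementary_process_def elementary_integral_def
  by (intro sum.cong refl) (use assms in \<open>force simp: indicator_def not_le dest: order.strict_trans1\<close>)

lemma elementary_process_refine:
  assumes p: "strict_mono_on {..N} p" and u: "u ` {..m} \<subseteq> p ` {..N}" and mono: "\<And>i. i < m \<Longrightarrow> u i \<le> u (Suc i)"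
  shows "elementary_process m u \<xi> s \<omega>
    = elementary_process N p (\<lambda>j. elementary_process m u \<xi> (p (Suc j))) s \<omega>"
proof -
  have "p j \<le> p (Suc j)" if "j < N" for j using strict_mono_onD[OF p, of j "Suc j"] that by auto
  then show ?thesis
    using elementary_integral_refine[OF p u mono] mono by (simp add: elementary_process_eq_integral)
qed

lemma finite_set_enumeration:
  assumes "finite (S :: real set)" "S \<noteq> {}"
  obtains N :: nat and p :: "nat \<Rightarrow> real" where "strict_mono_on {..N} p" "p ` {..N} = S"
proof -
  let ?l = "sorted_list_of_set S" and ?N = "card S - 1"
  have c: "{..?N} = {..<length ?l}" 
    using assms by (cases "card S") (auto simp: less_Suc_eq_le)
  have "strict_mono_on {..?N} (\<lambda>i. ?l ! i)"
    unfolding c using strict_sorted_list_of_set[of S] by (auto simp: strict_mono_on_def sorted_wrt_iff_nth_less)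
  moreover have "(\<lambda>i. ?l ! i) ` {..?N} = set ?l" unfolding c set_conv_nth by auto
  ultimately show ?thesis using that[of ?N "\<lambda>i. ?l ! i"] assms by simp
qed

lemma elementary_process_cell:
  assumes p: "strict_mono_on {..N} p" and j: "j < N" and s: "s \<in> {p j<..p (Suc j)}"
  shows "elementary_process N p \<xi> s \<omega> = \<xi> j \<omega>"
proof -
  have "indicator {p i<..p (Suc i)} s = (if i = j then 1 else (0::real))" if "i < N" for i
  proof (cases i j rule: linorder_cases)
    case less
    then have "p (Suc i) \<le> p j" using strict_mono_on_leD[OF p, of "Suc i" j] j by auto
    then show ?thesis using s less by auto
  next
    case greater
    then have "p (Suc j) \<le> p i" using strict_mono_on_leD[OF p, of "Suc j" i] that by auto
    then show ?thesis using s greater by auto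
  qed (use s in auto)
  then have "elementary_process N p \<xi> s \<omega> = (\<Sum>i<N. \<xi> i \<omega> * (if i = j then 1 else 0))"
    unfolding elementary_process_def by (intro sum.cong) auto
  also have "\<dots> = (\<Sum>i<N. if i = j then \<xi> i \<omega> else 0)" by (intro sum.cong) auto
  also have "\<dots> = \<xi> j \<omega>" using j by simp
  finally show ?thesis .
qed

lemma elementary_process_outside:
  assumes p: "strict_mono_on {..N} p" and s: "s \<notin> {p 0<..p N}"
  shows "elementary_process N p \<xi> s \<omega> = 0"
proof -
  have "s \<notin> {p i<..p (Suc i)}" if "i < N" for i
    using s that strict_mono_on_leD[OF p, of 0 i] strict_mono_on_leD[OF p, of "Suc i" N] by auto
  then show ?thesis unfolding elementary_process_def by (intro sum.neutral) auto
qed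

lemma partition_cell:
  fixes p :: "nat \<Rightarrow> real"
  assumes "s \<in> {p 0<..p N}"
  obtains j where "j < N" "s \<in> {p j<..p (Suc j)}"
proof -
  define j where "j = (LEAST j. s \<le> p j)"
  have j: "s \<le> p j" "j \<le> N" unfolding j_def using assms by (auto intro: LeastI Least_le)
  have "j \<noteq> 0" using j assms by (metis greaterThanAtMost_iff not_le)
  then obtain k where k: "j = Suc k" by (cases j) auto
  then have "\<not> s \<le> p k" unfolding j_def by (metis lessI not_less_Least)
  then show ?thesis using that[of k] j k by auto
qed

lemma elementary_process_comp:
  fixes h :: "real \<Rightarrow> real"
  assumes p: "strict_mono_on {..N} p" and h: "h 0 = 0"
  shows "h (elementary_process N p \<xi> s \<omega>) = (\<Sum>i<N. h (\<xi> i \<omega>) * indicator {p i<..p (Suc i)} s)"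
proof (cases "s \<in> {p 0<..p N}")
  case True
  then obtain j where j: "j < N" "s \<in> {p j<..p (Suc j)}" by (rule partition_cell)
  have "h (elementary_process N p \<xi> s \<omega>) = elementary_process N p (\<lambda>i \<omega>. h (\<xi> i \<omega>)) s \<omega>"
    by (simp add: elementary_process_cell[OF p j])
  then show ?thesis by (simp add: elementary_process_def)
next
  case False
  have "(\<Sum>i<N. h (\<xi> i \<omega>) * indicator {p i<..p (Suc i)} s) = elementary_process N p (\<lambda>i \<omega>. h (\<xi> i \<omega>)) s \<omega>"
    unfolding elementary_process_def ..
  then show ?thesis by (simp only: elementary_process_outside[OF p False] h)
qed

lemma integral_elementary_process_sq:
  assumes p: "strict_mono_on {..N} p"
  shows "integrable lborel (\<lambda>s. (elementary_process N p \<xi> s \<omega>)\<^sup>2)"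
    and "(\<integral>s. (elementary_process N p \<xi> s \<omega>)\<^sup>2 \<partial>lborel) = (\<Sum>i<N. (\<xi> i \<omega>)\<^sup>2 * (p (Suc i) - p i))"
proof -
  have le: "p i \<le> p (Suc i)" if "i < N" for i using strict_mono_onD[OF p, of i "Suc i"] that by auto
  have e: "(\<lambda>s. (elementary_process N p \<xi> s \<omega>)\<^sup>2) = (\<lambda>s. \<Sum>i<N. (\<xi> i \<omega>)\<^sup>2 * indicator {p i<..p (Suc i)} s)"
    by (intro ext elementary_process_comp[OF p, of "\<lambda>y. y\<^sup>2"]) simp
  have i: "integrable lborel (\<lambda>s. (\<xi> i \<omega>)\<^sup>2 * indicator {p i<..p (Suc i)} s :: real)" for i
    by (cases "p i \<le> p (Suc i)") auto
  show "integrable lborel (\<lambda>s. (elementary_process N p \<xi> s \<omega>)\<^sup>2)" unfolding e by (intro Bochner_Integration.integrable_sum i)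
  show "(\<integral>s. (elementary_process N p \<xi> s \<omega>)\<^sup>2 \<partial>lborel) = (\<Sum>i<N. (\<xi> i \<omega>)\<^sup>2 * (p (Suc i) - p i))"
    unfolding e by (subst Bochner_Integration.integral_sum) (use i le in \<open>auto intro!: sum.cong\<close>)
qed

section \<open>Brownian increments and the elementary integral\<close>

locale brownian =
  fixes M :: "'a measure" and F :: "real \<Rightarrow> 'a measure" and B :: "real \<Rightarrow> 'a \<Rightarrow> real"
  assumes bm: "brownian_motion M F B"
begin

sublocale prob_space M using bm by (auto simp: brownian_motion_def filtered_prob_space_def)

lemma space_F: "0 \<le> t \<Longrightarrow> space (F t) = space M"
  using bm by (auto simp: brownian_motion_def filtered_prob_space_def subalgebra_def)

lemma measurable_F_mono:
  assumes "f \<in> measurable (F s) N" "0 \<le> s" "s \<le> t" shows "f \<in> measurable (F t) N"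
proof -
  have "subalgebra (F t) (F s)"
    using bm assms space_F[of s] space_F[of t]
    unfolding brownian_motion_def filtered_prob_space_def subalgebra_def by (metis order_trans)
  then show ?thesis using assms(1) measurable_from_subalg by blast
qed

lemma measurable_F_M: "f \<in> measurable (F s) N \<Longrightarrow> 0 \<le> s \<Longrightarrow> f \<in> measurable M N"
  using bm measurable_from_subalg unfolding brownian_motion_def filtered_prob_space_def by metis

lemma B_measurable_F: "0 \<le> t \<Longrightarrow> B t \<in> borel_measurable (F t)"
  using bm by (auto simp: brownian_motion_def adapted_def)

lemma B_measurable: "0 \<le> t \<Longrightarrow> B t \<in> borel_measurable M"
  using B_measurable_F measurable_F_M by blast

text \<open>
  The form in which independence of increments is used: jointly with any random variable known at
  the beginning of the increment.
\<close>

lemma indep_increment: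
  assumes "0 \<le> s" "s < t" and Z: "Z \<in> borel_measurable (F s)"
  shows "indep_var borel Z borel (\<lambda>\<omega>. B t \<omega> - B s \<omega>)"
  unfolding indep_var_eq
proof (intro conjI)
  let ?D = "\<lambda>\<omega>. B t \<omega> - B s \<omega>"
  show "random_variable borel Z" using measurable_F_M[OF Z] assms by auto
  show "random_variable borel ?D" using B_measurable assms by auto
  have ind: "indep_set (sets (F s)) (sets (vimage_algebra (space M) ?D borel))"
    using bm assms unfolding brownian_motion_def by blast
  have "sigma_sets (space M) {Z -` A \<inter> space M |A. A \<in> sets borel} \<subseteq> sets (F s)"
    unfolding space_F[OF assms(1), symmetric]
    by (intro sets.sigma_sets_subset) (auto intro: measurable_sets[OF Z])
  moreover have "sigma_sets (space M) {?D -` A \<inter> space M |A. A \<in> sets borel} = sets (vimage_algebra (space M) ?D borel)"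
    by (simp add: sets_vimage_algebra)
  ultimately show "indep_set (sigma_sets (space M) {Z -` A \<inter> space M |A. A \<in> sets borel})
      (sigma_sets (space M) {?D -` A \<inter> space M |A. A \<in> sets borel})"
    using ind unfolding indep_set_def
    by (elim indep_sets_mono_sets) (auto split: bool.split)
qed

lemma increment_moments:
  assumes "0 \<le> s" "s < t"
  shows "integrable M (\<lambda>\<omega>. B t \<omega> - B s \<omega>)" "expectation (\<lambda>\<omega>. B t \<omega> - B s \<omega>) = 0"
    "integrable M (\<lambda>\<omega>. (B t \<omega> - B s \<omega>)\<^sup>2)" "expectation (\<lambda>\<omega>. (B t \<omega> - B s \<omega>)\<^sup>2) = t - s"
proof -
  have d: "distributed M lborel (\<lambda>\<omega>. B t \<omega> - B s \<omega>) (normal_density 0 (sqrt (t - s)))"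
    using bm assms unfolding brownian_motion_def by blast
  have pos: "sqrt (t - s) > 0" using assms by simp
  show i1: "integrable M (\<lambda>\<omega>. B t \<omega> - B s \<omega>)"
    using distributed_integrable[OF d, of "\<lambda>x. x"] integrable_normal_moment[OF pos, of 0 1] by simp
  show e: "expectation (\<lambda>\<omega>. B t \<omega> - B s \<omega>) = 0"
    using normal_distributed_expectation[OF pos d] by simp
  show "integrable M (\<lambda>\<omega>. (B t \<omega> - B s \<omega>)\<^sup>2)"
    using distributed_integrable[OF d, of "\<lambda>x. x\<^sup>2"] integrable_normal_moment[OF pos, of 0 2] by simp
  show "expectation (\<lambda>\<omega>. (B t \<omega> - B s \<omega>)\<^sup>2) = t - s"
    using normal_distributed_variance[OF pos d] e assms by simp
qed

text \<open>
  Real and imaginary part of the Gaussian characteristic function.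
\<close>

lemma increment_trig:
  assumes "0 \<le> s" "s < t"
  shows "expectation (\<lambda>\<omega>. cos (a * (B t \<omega> - B s \<omega>))) = exp (- (a\<^sup>2 * (t - s)) / 2)"
    and "expectation (\<lambda>\<omega>. sin (a * (B t \<omega> - B s \<omega>))) = 0"
proof -
  let ?D = "\<lambda>\<omega>. B t \<omega> - B s \<omega>" and ?r = "sqrt (t - s)"
  have d: "distributed M lborel ?D (normal_density 0 ?r)"
    using bm assms unfolding brownian_motion_def by blast
  have pos: "?r > 0" using assms by simp
  have "distributed M lborel (\<lambda>\<omega>. 0 + ?D \<omega> * (1 / ?r)) (normal_density (0 + 0 * (1 / ?r)) (\<bar>1 / ?r\<bar> * ?r))"
    using normal_density_affine[OF d pos, of "1 / ?r" 0] pos by (simp add: mult.commute)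
  then have std: "distributed M lborel (\<lambda>\<omega>. ?D \<omega> / ?r) std_normal_density" using pos by simp
  have distr: "distr M lborel (\<lambda>\<omega>. ?D \<omega> / ?r) = std_normal_distribution"
    using std by (simp add: distributed_def)
  have [measurable]: "B t \<in> borel_measurable M" "B s \<in> borel_measurable M" using B_measurable assms by auto
  let ?b = "a * ?r"
  have "(CLINT x|std_normal_distribution. iexp (?b * x)) = complex_of_real (exp (- (?b\<^sup>2) / 2))"
    using fun_cong[OF char_std_normal_distribution, of ?b] by (simp add: char_def)
  then have "(CLINT \<omega>|M. iexp (?b * (?D \<omega> / ?r))) = complex_of_real (exp (- (?b\<^sup>2) / 2))"
    unfolding distr[symmetric] by (subst (asm) integral_distr) auto
  moreover have "?b * (?D \<omega> / ?r) = a * ?D \<omega>" for \<omega> using pos by simp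
  ultimately have c: "(CLINT \<omega>|M. iexp (a * ?D \<omega>)) = complex_of_real (exp (- (a\<^sup>2 * (t - s)) / 2))"
    using assms by (simp add: power_mult_distrib)
  have i: "integrable M (\<lambda>\<omega>. iexp (a * ?D \<omega>))"
    by (rule integrable_const_bound[of _ 1]) auto
  show "expectation (\<lambda>\<omega>. cos (a * ?D \<omega>)) = exp (- (a\<^sup>2 * (t - s)) / 2)"
    using integral_Re[OF i] c by (simp add: Re_exp)
  show "expectation (\<lambda>\<omega>. sin (a * ?D \<omega>)) = 0"
    using integral_Im[OF i] c by (simp add: Im_exp)
qed

lemma elementary_integral_measurable_F:
  assumes "elementary_integrand M F T m u \<xi>"
  shows "elementary_integral B m u \<xi> \<in> borel_measurable (F (u m))"
proof -
  have u0: "0 \<le> u 0" and mono: "\<And>i. i < m \<Longrightarrow> u i \<le> u (Suc i)"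
    and \<xi>: "\<And>i. i < m \<Longrightarrow> \<xi> i \<in> borel_measurable (F (u i))"
    using assms by (auto simp: elementary_integrand_def)
  have le: "u i \<le> u j" if "i \<le> j" "j \<le> m" for i j
    using that by (induction j rule: dec_induct) (use mono in \<open>auto intro: order_trans\<close>)
  have nn: "0 \<le> u i" if "i \<le> m" for i using le[of 0 i] that u0 by simp
  have "(\<lambda>\<omega>. \<xi> i \<omega> * (B (u (Suc i)) \<omega> - B (u i) \<omega>)) \<in> borel_measurable (F (u m))" if "i < m" for i
    using that nn le
    by (intro borel_measurable_times borel_measurable_diff)
      (auto intro: measurable_F_mono[OF \<xi>] measurable_F_mono[OF B_measurable_F])
  then show ?thesis unfolding elementary_integral_def[abs_def] by (intro borel_measurable_sum) auto
qed

lemma elementary_integrand_Suc: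
  assumes "elementary_integrand M F T (Suc m) u \<xi>"
  shows "elementary_integrand M F T m u \<xi>" "0 \<le> u m" "u m \<le> u (Suc m)"
    "\<xi> m \<in> borel_measurable (F (u m))" "\<exists>L. \<forall>\<omega>\<in>space M. \<bar>\<xi> m \<omega>\<bar> \<le> L"
proof -
  have u0: "0 \<le> u 0" and mono: "\<And>i. i < Suc m \<Longrightarrow> u i \<le> u (Suc i)"
    using assms by (auto simp: elementary_integrand_def)
  have le: "u i \<le> u j" if "i \<le> j" "j \<le> Suc m" for i j
    using that by (induction j rule: dec_induct) (use mono in \<open>auto intro: order_trans\<close>)
  show "0 \<le> u m" using le[of 0 m] u0 by simp
  show "elementary_integrand M F T m u \<xi>" "u m \<le> u (Suc m)" "\<xi> m \<in> borel_measurable (F (u m))"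
    using assms mono[of m] by (auto simp: elementary_integrand_def)
  show "\<exists>L. \<forall>\<omega>\<in>space M. \<bar>\<xi> m \<omega>\<bar> \<le> L"
    using assms by (auto simp: elementary_integrand_def bounded_iff)
qed

text \<open>
  The Ito isometry for elementary processes: mixed terms vanish because each increment is centred and
  independent of what precedes it.
\<close>

lemma elementary_isometry:
  assumes "elementary_integrand M F T m u \<xi>"
  shows "integrable M (\<lambda>\<omega>. (elementary_integral B m u \<xi> \<omega>)\<^sup>2) \<and>
    integrable M (\<lambda>\<omega>. \<Sum>i<m. (\<xi> i \<omega>)\<^sup>2 * (u (Suc i) - u i)) \<and>
    expectation (\<lambda>\<omega>. (elementary_integral B m u \<xi> \<omega>)\<^sup>2) = expectation (\<lambda>\<omega>. \<Sum>i<m. (\<xi> i \<omega>)\<^sup>2 * (u (Suc i) - u i))"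
  using assms
proof (induction m)
  case 0
  then show ?case by (simp add: elementary_integral_def)
next
  case (Suc m)
  note S = elementary_integrand_Suc[OF Suc.prems]
  note IH = Suc.IH[OF S(1)]
  let ?I = "elementary_integral B m u \<xi>" and ?D = "\<lambda>\<omega>. B (u (Suc m)) \<omega> - B (u m) \<omega>"
  obtain L where L: "\<And>\<omega>. \<omega> \<in> space M \<Longrightarrow> \<bar>\<xi> m \<omega>\<bar> \<le> L" using S(5) by auto
  have IF: "?I \<in> borel_measurable (F (u m))" by (rule elementary_integral_measurable_F[OF S(1)])
  have [measurable]: "\<xi> m \<in> borel_measurable M" "?I \<in> borel_measurable M"
    using measurable_F_M[OF S(4) S(2)] measurable_F_M[OF IF S(2)] by auto
  have \<xi>2: "integrable M (\<lambda>\<omega>. (\<xi> m \<omega>)\<^sup>2)"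
  proof (rule integrable_const_bound[of _ "L\<^sup>2"])
    show "AE \<omega> in M. norm ((\<xi> m \<omega>)\<^sup>2) \<le> L\<^sup>2"
      using L by (intro AE_I2) (auto simp: power2_le_iff_abs_le intro: abs_le_square_iff[THEN iffD1] order_trans[OF _ abs_ge_self])
  qed simp
  have I\<xi>: "integrable M (\<lambda>\<omega>. ?I \<omega> * \<xi> m \<omega>)"
  proof (rule Bochner_Integration.integrable_bound)
    show "integrable M (\<lambda>\<omega>. (?I \<omega>)\<^sup>2 + (\<xi> m \<omega>)\<^sup>2)" using IH \<xi>2 by simp
    have "\<bar>a * b\<bar> \<le> a\<^sup>2 + b\<^sup>2" for a b :: real
    proof -
      have "2 * \<bar>a * b\<bar> \<le> a\<^sup>2 + b\<^sup>2"
        using sum_squares_bound[of "\<bar>a\<bar>" "\<bar>b\<bar>"] by (simp add: abs_mult)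
      then show ?thesis using abs_ge_zero[of "a * b"] by linarith
    qed
    then show "AE \<omega> in M. norm (?I \<omega> * \<xi> m \<omega>) \<le> norm ((?I \<omega>)\<^sup>2 + (\<xi> m \<omega>)\<^sup>2)" by simp
  qed simp
  have key: "integrable M (\<lambda>\<omega>. ?I \<omega> * \<xi> m \<omega> * ?D \<omega>) \<and> expectation (\<lambda>\<omega>. ?I \<omega> * \<xi> m \<omega> * ?D \<omega>) = 0 \<and>
     integrable M (\<lambda>\<omega>. (\<xi> m \<omega>)\<^sup>2 * (?D \<omega>)\<^sup>2) \<and>
     expectation (\<lambda>\<omega>. (\<xi> m \<omega>)\<^sup>2 * (?D \<omega>)\<^sup>2) = expectation (\<lambda>\<omega>. (\<xi> m \<omega>)\<^sup>2) * (u (Suc m) - u m)"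
  proof (cases "u m < u (Suc m)")
    case True
    note mom = increment_moments[OF S(2) True]
    have i1: "indep_var borel (\<lambda>\<omega>. ?I \<omega> * \<xi> m \<omega>) borel ?D"
      by (intro indep_increment S(2) True borel_measurable_times IF S(4))
    have "indep_var borel (\<xi> m) borel ?D" by (intro indep_increment S True)
    then have i2: "indep_var borel ((\<lambda>y. y\<^sup>2) \<circ> \<xi> m) borel ((\<lambda>y. y\<^sup>2) \<circ> ?D)"
      by (rule indep_var_compose) auto
    show ?thesis
      using indep_var_integrable[OF i1 I\<xi> mom(1)] indep_var_lebesgue_integral[OF i1 I\<xi> mom(1)]
        indep_var_integrable[OF i2[unfolded comp_def] \<xi>2 mom(3)] indep_var_lebesgue_integral[OF i2[unfolded comp_def] \<xi>2 mom(3)] mom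
      by simp
  next
    case False
    then show ?thesis using S(3) by simp
  qed
  have e: "(elementary_integral B (Suc m) u \<xi> \<omega>)\<^sup>2 = (?I \<omega>)\<^sup>2 + 2 * (?I \<omega> * \<xi> m \<omega> * ?D \<omega>) + (\<xi> m \<omega>)\<^sup>2 * (?D \<omega>)\<^sup>2" for \<omega>
    by (simp add: elementary_integral_def power2_eq_square algebra_simps)
  show ?case unfolding e using IH key \<xi>2 by simp
qed

text \<open>
  The law of a Wiener integral of a step function. Splitting off the last increment, the addition
  formula turns the expectation into a product, the sine part of the increment being zero by symmetry;
  thus a shift \<open>c\<close> is carried through the induction.
\<close>

lemma elementary_integral_expectation_cos:
  fixes a :: "nat \<Rightarrow> real"
  assumes "0 \<le> u 0" "\<And>i. i < m \<Longrightarrow> u i \<le> u (Suc i)"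
  shows "expectation (\<lambda>\<omega>. cos (elementary_integral B m u (\<lambda>i _. a i) \<omega> + c))
    = cos c * exp (- (\<Sum>i<m. (a i)\<^sup>2 * (u (Suc i) - u i)) / 2)"
  using assms
proof (induction m arbitrary: c)
  case 0
  then show ?case by (simp add: elementary_integral_def prob_space)
next
  case (Suc m)
  let ?I = "elementary_integral B m u (\<lambda>i _. a i)" and ?D = "\<lambda>\<omega>. B (u (Suc m)) \<omega> - B (u m) \<omega>"
  let ?v = "\<Sum>i<m. (a i)\<^sup>2 * (u (Suc i) - u i)" and ?w = "(a m)\<^sup>2 * (u (Suc m) - u m)"
  have el: "elementary_integrand M F (u (Suc m)) (Suc m) u (\<lambda>i _. a i)"
    using Suc.prems by (auto simp: elementary_integrand_def bounded_iff)
  note S = elementary_integrand_Suc[OF el]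
  have IF: "?I \<in> borel_measurable (F (u m))" by (rule elementary_integral_measurable_F[OF S(1)])
  have [measurable]: "?I \<in> borel_measurable M" "?D \<in> borel_measurable M"
    using measurable_F_M[OF IF S(2)] B_measurable S by auto
  have IH: "expectation (\<lambda>\<omega>. cos (?I \<omega> + d)) = cos d * exp (- ?v / 2)" for d
    using Suc.IH Suc.prems by simp
  show ?case
  proof (cases "u m < u (Suc m)")
    case True
    have "indep_var borel ?I borel ?D" by (intro indep_increment S(2) True IF)
    then have i1: "indep_var borel ((\<lambda>y. cos (y + c)) \<circ> ?I) borel ((\<lambda>y. cos (a m * y)) \<circ> ?D)"
      and i2: "indep_var borel ((\<lambda>y. sin (y + c)) \<circ> ?I) borel ((\<lambda>y. sin (a m * y)) \<circ> ?D)"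
      by (auto intro!: indep_var_compose[where ?M1.0=borel and ?M2.0=borel])
    have int: "integrable M (\<lambda>\<omega>. cos (?I \<omega> + c))" "integrable M (\<lambda>\<omega>. cos (a m * ?D \<omega>))"
       "integrable M (\<lambda>\<omega>. sin (?I \<omega> + c))" "integrable M (\<lambda>\<omega>. sin (a m * ?D \<omega>))"
      by (auto intro!: integrable_bounded[of _ 1])
    note prod = indep_var_integrable[OF i1[unfolded comp_def] int(1,2)] indep_var_lebesgue_integral[OF i1[unfolded comp_def] int(1,2)]
      indep_var_integrable[OF i2[unfolded comp_def] int(3,4)] indep_var_lebesgue_integral[OF i2[unfolded comp_def] int(3,4)]
    have "expectation (\<lambda>\<omega>. cos (elementary_integral B (Suc m) u (\<lambda>i _. a i) \<omega> + c))
       = expectation (\<lambda>\<omega>. cos (?I \<omega> + c) * cos (a m * ?D \<omega>) - sin (?I \<omega> + c) * sin (a m * ?D \<omega>))"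
      by (intro Bochner_Integration.integral_cong refl)
        (simp add: elementary_integral_def cos_add[symmetric] algebra_simps)
    also have "\<dots> = cos c * exp (- ?v / 2) * exp (- ?w / 2)"
      using prod increment_trig[OF S(2) True] IH[of c] by simp
    also have "\<dots> = cos c * exp (- (?v + ?w) / 2)" by (simp add: exp_add[symmetric] add_divide_distrib)
    finally show ?thesis by simp
  next
    case False
    then have "u (Suc m) = u m" using S(3) by simp
    then show ?thesis using IH[of c] by (simp add: elementary_integral_def)
  qed
qed

end

section \<open>The second moment of a localized Ito integral\<close>

text \<open>
  Fatou's lemma in the form used below: bounds on the integrals of an approximating sequence pass to
  a function that lies below its lower limit.
\<close>

lemma nn_integral_le_limit:
  fixes u :: "nat \<Rightarrow> 'a \<Rightarrow> ennreal"
  assumes u: "\<And>k. u k \<in> borel_measurable M" and v: "AE x in M. v x \<le> liminf (\<lambda>k. u k x)"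
    and c: "\<And>k. (\<integral>\<^sup>+x. u k x \<partial>M) \<le> c k" and C: "c \<longlonglongrightarrow> C"
  shows "(\<integral>\<^sup>+x. v x \<partial>M) \<le> C"
proof -
  have "(\<integral>\<^sup>+x. v x \<partial>M) \<le> (\<integral>\<^sup>+x. liminf (\<lambda>k. u k x) \<partial>M)" by (rule nn_integral_mono_AE[OF v])
  also have "\<dots> \<le> liminf (\<lambda>k. \<integral>\<^sup>+x. u k x \<partial>M)" by (rule nn_integral_liminf[OF u])
  also have "\<dots> \<le> liminf c" using c by (intro Liminf_mono) auto
  also have "\<dots> = C" using C by (intro lim_imp_Liminf) auto
  finally show ?thesis .
qed

lemma power2_diff_bound:
  fixes a h \<eta> :: real assumes "\<eta> > 0"
  shows "\<bar>a\<^sup>2 - h\<^sup>2\<bar> \<le> (1 + 1 / \<eta>) * (a - h)\<^sup>2 + \<eta> * h\<^sup>2"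
proof -
  have "0 \<le> (\<bar>a - h\<bar> / sqrt \<eta> - sqrt \<eta> * \<bar>h\<bar>)\<^sup>2" by simp
  also have "\<dots> = (a - h)\<^sup>2 / \<eta> - 2 * \<bar>(a - h) * h\<bar> + \<eta> * h\<^sup>2"
    using assms by (simp add: power2_diff power_mult_distrib power_divide abs_mult)
  finally have "2 * \<bar>(a - h) * h\<bar> \<le> (a - h)\<^sup>2 / \<eta> + \<eta> * h\<^sup>2" by simp
  moreover have "a\<^sup>2 - h\<^sup>2 = (a - h)\<^sup>2 + 2 * ((a - h) * h)" by (simp add: power2_eq_square algebra_simps)
  moreover have "0 \<le> (a - h)\<^sup>2" by simp
  ultimately have "\<bar>a\<^sup>2 - h\<^sup>2\<bar> \<le> (a - h)\<^sup>2 + ((a - h)\<^sup>2 / \<eta> + \<eta> * h\<^sup>2)" by linarith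
  then show ?thesis by (simp add: algebra_simps)
qed

text \<open>
  Convergence in \<open>L\<^sup>2\<close> implies convergence of the \<open>L\<^sup>2\<close> norms.
\<close>

lemma L2_tendsto:
  fixes f :: "nat \<Rightarrow> 'a \<Rightarrow> real"
  assumes f[measurable]: "\<And>k. f k \<in> borel_measurable N" and h[measurable]: "h \<in> borel_measurable N"
    and h2: "integrable N (\<lambda>x. (h x)\<^sup>2)" and d: "\<And>k. integrable N (\<lambda>x. (f k x - h x)\<^sup>2)"
    and lim: "(\<lambda>k. \<integral>x. (f k x - h x)\<^sup>2 \<partial>N) \<longlonglongrightarrow> 0"
  shows "(\<lambda>k. \<integral>x. (f k x)\<^sup>2 \<partial>N) \<longlonglongrightarrow> (\<integral>x. (h x)\<^sup>2 \<partial>N)"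
proof -
  have f2: "integrable N (\<lambda>x. (f k x)\<^sup>2)" for k
  proof (rule Bochner_Integration.integrable_bound)
    show "integrable N (\<lambda>x. 2 * (f k x - h x)\<^sup>2 + 2 * (h x)\<^sup>2)" using d h2 by simp
    have "(f k x)\<^sup>2 \<le> 2 * (f k x - h x)\<^sup>2 + 2 * (h x)\<^sup>2" for x
      using power2_diff_bound[of 1 "f k x" "h x"] by (simp add: abs_le_iff)
    then show "AE x in N. norm ((f k x)\<^sup>2) \<le> norm (2 * (f k x - h x)\<^sup>2 + 2 * (h x)\<^sup>2)" by simp
  qed simp
  let ?H = "\<integral>x. (h x)\<^sup>2 \<partial>N"
  have bnd: "\<bar>(\<integral>x. (f k x)\<^sup>2 \<partial>N) - ?H\<bar> \<le> (1 + 1 / \<eta>) * (\<integral>x. (f k x - h x)\<^sup>2 \<partial>N) + \<eta> * ?H" if "\<eta> > 0" for k \<eta>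
  proof -
    have "\<bar>(\<integral>x. (f k x)\<^sup>2 \<partial>N) - ?H\<bar> = \<bar>\<integral>x. (f k x)\<^sup>2 - (h x)\<^sup>2 \<partial>N\<bar>" using f2 h2 by simp
    also have "\<dots> \<le> (\<integral>x. \<bar>(f k x)\<^sup>2 - (h x)\<^sup>2\<bar> \<partial>N)" by (rule integral_abs_bound)
    also have "\<dots> \<le> (\<integral>x. (1 + 1 / \<eta>) * (f k x - h x)\<^sup>2 + \<eta> * (h x)\<^sup>2 \<partial>N)"
      using f2 h2 d power2_diff_bound[OF that] by (intro integral_mono) auto
    also have "\<dots> = (1 + 1 / \<eta>) * (\<integral>x. (f k x - h x)\<^sup>2 \<partial>N) + \<eta> * ?H" using d h2 by simp
    finally show ?thesis .
  qed
  have H0: "?H \<ge> 0" by simp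
  show ?thesis
  proof (rule LIMSEQ_I)
    fix r :: real assume r: "r > 0"
    define \<eta> where "\<eta> = r / (2 * (?H + 1))"
    have \<eta>: "\<eta> > 0" 
    unfolding \<eta>_def by (intro divide_pos_pos r mult_pos_pos add_nonneg_pos[OF H0]) simp_all
    have H1: "?H + 1 > 0" by (rule add_nonneg_pos[OF H0]) simp
    have "\<eta> * ?H \<le> r / 2 * (?H / (?H + 1))" unfolding \<eta>_def by simp
    also have "\<dots> \<le> r / 2 * 1" 
      using r H1 by (intro mult_left_mono) (simp_all add: divide_le_eq_1_pos)
    finally have 1: "\<eta> * ?H \<le> r / 2" by simp
    have "(\<lambda>k. (1 + 1 / \<eta>) * (\<integral>x. (f k x - h x)\<^sup>2 \<partial>N)) \<longlonglongrightarrow> (1 + 1 / \<eta>) * 0"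
      by (intro tendsto_intros lim)
    then have "\<forall>\<^sub>F k in sequentially. (1 + 1 / \<eta>) * (\<integral>x. (f k x - h x)\<^sup>2 \<partial>N) < r / 2"
      using r by (intro order_tendstoD) auto
    then have "\<forall>\<^sub>F k in sequentially. norm ((\<integral>x. (f k x)\<^sup>2 \<partial>N) - ?H) < r"
    proof eventually_elim
      case (elim k)
      then show ?case using bnd[OF \<eta>, of k] 1 unfolding real_norm_def by linarith
    qed
    then show "\<exists>n0. \<forall>k\<ge>n0. norm ((\<integral>x. (f k x)\<^sup>2 \<partial>N) - ?H) < r" by (simp add: eventually_sequentially)
  qed
qed

lemma integrable_diff_power2:
  fixes f g :: "'a \<Rightarrow> real"
  assumes [measurable]: "f \<in> borel_measurable N" "g \<in> borel_measurable N"
    and "integrable N (\<lambda>x. (f x)\<^sup>2)" "integrable N (\<lambda>x. (g x)\<^sup>2)"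
  shows "integrable N (\<lambda>x. (f x - g x)\<^sup>2)"
proof (rule Bochner_Integration.integrable_bound)
  show "integrable N (\<lambda>x. 2 * (f x)\<^sup>2 + 2 * (g x)\<^sup>2)" using assms by simp
  have "(f x - g x)\<^sup>2 \<le> 2 * (f x)\<^sup>2 + 2 * (g x)\<^sup>2" for x
    using sum_squares_bound[of "f x" "- g x"] by (simp add: power2_diff)
  then show "AE x in N. norm ((f x - g x)\<^sup>2) \<le> norm (2 * (f x)\<^sup>2 + 2 * (g x)\<^sup>2)" by simp
qed simp

lemma (in prob_space) converges_in_probability_truncated_mean:
  assumes [measurable]: "\<And>n. Z n \<in> borel_measurable M" "V \<in> borel_measurable M"
    and conv: "converges_in_probability M Z V"
  shows "(\<lambda>n. expectation (\<lambda>\<omega>. min 1 \<bar>Z n \<omega> - V \<omega>\<bar>)) \<longlonglongrightarrow> 0"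
proof (rule LIMSEQ_I)
  fix r :: real assume r: "r > 0"
  let ?A = "\<lambda>n. {\<omega>\<in>space M. r / 2 \<le> \<bar>Z n \<omega> - V \<omega>\<bar>}"
  have "(\<lambda>n. prob (?A n)) \<longlonglongrightarrow> 0"
    by (rule conv[unfolded converges_in_probability_def, rule_format]) (use r in simp)
  then have "\<forall>\<^sub>F n in sequentially. prob (?A n) < r / 2" using r by (intro order_tendstoD) auto
  then have "\<forall>\<^sub>F n in sequentially. norm (expectation (\<lambda>\<omega>. min 1 \<bar>Z n \<omega> - V \<omega>\<bar>) - 0) < r"
  proof eventually_elim
    case (elim n)
    have "expectation (\<lambda>\<omega>. min 1 \<bar>Z n \<omega> - V \<omega>\<bar>) \<le> expectation (\<lambda>\<omega>. r / 2 + indicator (?A n) \<omega>)"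
    proof (rule integral_mono)
      show "integrable M (\<lambda>\<omega>. min 1 \<bar>Z n \<omega> - V \<omega>\<bar>)" by (rule integrable_const_bound[of _ 1]) auto
      show "integrable M (\<lambda>\<omega>. r / 2 + indicator (?A n) \<omega>)"
        by (rule integrable_const_bound[of _ "r / 2 + 1"]) (use r in \<open>auto simp: indicator_def\<close>)
      fix \<omega> assume "\<omega> \<in> space M"
      then show "min 1 \<bar>Z n \<omega> - V \<omega>\<bar> \<le> r / 2 + indicator (?A n) \<omega>"
        using r min.cobounded1[of 1 "\<bar>Z n \<omega> - V \<omega>\<bar>"] min.cobounded2[of 1 "\<bar>Z n \<omega> - V \<omega>\<bar>"]
        by (cases "r / 2 \<le> \<bar>Z n \<omega> - V \<omega>\<bar>") (simp_all add: indicator_def del: min.cobounded1 min.cobounded2)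
    qed
    also have "\<dots> = r / 2 + prob (?A n)"
      by (subst Bochner_Integration.integral_add) (auto simp: emeasure_eq_measure prob_space)
    finally have "expectation (\<lambda>\<omega>. min 1 \<bar>Z n \<omega> - V \<omega>\<bar>) < r" using elim by simp
    moreover have "0 \<le> expectation (\<lambda>\<omega>. min 1 \<bar>Z n \<omega> - V \<omega>\<bar>)" by (intro Bochner_Integration.integral_nonneg) auto
    ultimately show ?case by simp
  qed
  then show "\<exists>n0. \<forall>n\<ge>n0. norm (expectation (\<lambda>\<omega>. min 1 \<bar>Z n \<omega> - V \<omega>\<bar>) - 0) < r"
    by (simp add: eventually_sequentially)
qed

lemma tendsto_of_truncated_distance:
  fixes a :: "nat \<Rightarrow> real" and l :: real
  assumes "(\<lambda>k. min 1 \<bar>a k - l\<bar>) \<longlonglongrightarrow> 0"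
  shows "a \<longlonglongrightarrow> l"
proof -
  have "(\<lambda>k. \<bar>a k - l\<bar>) \<longlonglongrightarrow> 0"
  proof (rule Lim_transform_eventually[OF assms])
    have "\<forall>\<^sub>F k in sequentially. min 1 \<bar>a k - l\<bar> < 1" by (rule order_tendstoD(2)[OF assms]) simp
    then show "\<forall>\<^sub>F k in sequentially. min 1 \<bar>a k - l\<bar> = \<bar>a k - l\<bar>"
      by eventually_elim (auto simp: min_def)
  qed
  then show ?thesis using LIM_zero_cancel tendsto_rabs_zero_iff by blast
qed

lemma (in prob_space) converges_in_probability_subseq2:
  assumes [measurable]: "\<And>n. Z n \<in> borel_measurable M" "V \<in> borel_measurable M"
    "\<And>n. Z' n \<in> borel_measurable M" "V' \<in> borel_measurable M"
    and "converges_in_probability M Z V" "converges_in_probability M Z' V'"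
  obtains r where "strict_mono (r :: nat \<Rightarrow> nat)"
    "AE \<omega> in M. (\<lambda>k. Z (r k) \<omega>) \<longlonglongrightarrow> V \<omega> \<and> (\<lambda>k. Z' (r k) \<omega>) \<longlonglongrightarrow> V' \<omega>"
proof -
  define g where "g n \<omega> = min 1 \<bar>Z n \<omega> - V \<omega>\<bar> + min 1 \<bar>Z' n \<omega> - V' \<omega>\<bar>" for n \<omega>
  have i: "integrable M (\<lambda>\<omega>. min 1 \<bar>Z n \<omega> - V \<omega>\<bar>)" "integrable M (\<lambda>\<omega>. min 1 \<bar>Z' n \<omega> - V' \<omega>\<bar>)" for n
    by (auto intro!: integrable_const_bound[of _ 1])
  have "(\<lambda>n. expectation (\<lambda>\<omega>. min 1 \<bar>Z n \<omega> - V \<omega>\<bar>) + expectation (\<lambda>\<omega>. min 1 \<bar>Z' n \<omega> - V' \<omega>\<bar>)) \<longlonglongrightarrow> 0 + 0"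
    by (intro tendsto_add converges_in_probability_truncated_mean) (use assms in auto)
  moreover have "\<bar>g n \<omega>\<bar> = g n \<omega>" for n \<omega> by (auto simp: g_def)
  ultimately have "(\<lambda>n. expectation (\<lambda>\<omega>. norm (g n \<omega>))) \<longlonglongrightarrow> 0" using i by (simp add: g_def)
  moreover have "integrable M (g n)" for n unfolding g_def[abs_def] by (intro Bochner_Integration.integrable_add i)
  ultimately obtain r where r: "strict_mono (r :: nat \<Rightarrow> nat)" "AE \<omega> in M. (\<lambda>k. g (r k) \<omega>) \<longlonglongrightarrow> 0"
    using tendsto_L1_AE_subseq[of M g] by auto
  from r(2) have "AE \<omega> in M. (\<lambda>k. Z (r k) \<omega>) \<longlonglongrightarrow> V \<omega> \<and> (\<lambda>k. Z' (r k) \<omega>) \<longlonglongrightarrow> V' \<omega>"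
  proof eventually_elim
    case (elim \<omega>)
    have *: "(\<lambda>k. min 1 \<bar>Z (r k) \<omega> - V \<omega>\<bar>) \<longlonglongrightarrow> 0" "(\<lambda>k. min 1 \<bar>Z' (r k) \<omega> - V' \<omega>\<bar>) \<longlonglongrightarrow> 0"
      by (rule tendsto_sandwich[OF _ _ tendsto_const elim]; auto simp: g_def)+
    show ?case using tendsto_of_truncated_distance[OF *(1)] tendsto_of_truncated_distance[OF *(2)] by simp
  qed
  with r(1) that show ?thesis by blast
qed

lemma finite_set_partition:
  assumes "finite S" "S \<subseteq> {0..T}" "0 \<in> S" "T \<in> S"
  obtains N and p :: "nat \<Rightarrow> real" where "strict_mono_on {..N} p" "p ` {..N} = S" "p 0 = 0" "p N = T"
proof -
  obtain N :: nat and p where p: "strict_mono_on {..N} p" "p ` {..N} = S"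
    using finite_set_enumeration[of S] assms by blast
  have "p 0 \<in> S" "p N \<in> S" using p(2) by auto
  obtain i j where ij: "i \<le> N" "p i = 0" "j \<le> N" "p j = T" using assms(3,4) unfolding p(2)[symmetric] by auto
  have "p 0 \<le> p i" "p j \<le> p N" using strict_mono_on_leD[OF p(1), of 0 i] strict_mono_on_leD[OF p(1), of j N] ij by auto
  then have "p 0 = 0" "p N = T" using ij \<open>p 0 \<in> S\<close> \<open>p N \<in> S\<close> assms(2) by auto
  with p that show ?thesis by blast
qed

text \<open>
  The event that the conditions \<open>E r\<close> held at all rational times before \<open>s\<close>. Restricting to rational
  times makes the indicator jointly measurable in \<open>(s, \<omega>)\<close> and adapted for arbitrary \<open>E r\<close> in \<open>F r\<close>; the
  strict inequality makes it left continuous in \<open>s\<close>, so that it can be sampled at the left end points of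
  small cells. It serves as the indicator of the stochastic interval up to a stopping time.
\<close>

definition past :: "'a measure \<Rightarrow> (real \<Rightarrow> 'a set) \<Rightarrow> real \<Rightarrow> 'a set" where
  "past M E s = {\<omega>\<in>space M. \<forall>r\<in>\<rat>. 0 \<le> r \<longrightarrow> r < s \<longrightarrow> \<omega> \<in> E r}"

context brownian
begin

lemma elementary_nodes:
  assumes "elementary_integrand M F T m u \<xi>"
  shows "u ` {..m} \<subseteq> {0..T}" and "\<And>i. i < m \<Longrightarrow> u i \<le> u (Suc i)"
proof -
  show mono: "u i \<le> u (Suc i)" if "i < m" for i using assms that by (auto simp: elementary_integrand_def)
  have le: "u i \<le> u j" if "i \<le> j" "j \<le> m" for i j
    using that by (induction j rule: dec_induct) (use mono in \<open>auto intro: order_trans\<close>)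
  have "0 \<le> u i \<and> u i \<le> T" if "i \<le> m" for i
    using le[of 0 i] le[of i m] that assms by (auto simp: elementary_integrand_def)
  then show "u ` {..m} \<subseteq> {0..T}" by auto
qed

lemma elementary_integrand_coeff:
  assumes "elementary_integrand M F T m u \<xi>" "i < m"
  shows "\<xi> i \<in> borel_measurable (F (u i))" "\<xi> i \<in> borel_measurable M" "0 \<le> u i"
    "\<exists>L. \<forall>\<omega>\<in>space M. \<bar>\<xi> i \<omega>\<bar> \<le> L"
proof -
  show 1: "\<xi> i \<in> borel_measurable (F (u i))" using assms by (auto simp: elementary_integrand_def)
  have "u i \<in> u ` {..m}" using assms(2) by simp
  then show "0 \<le> u i" using elementary_nodes(1)[OF assms(1)] by auto
  then show "\<xi> i \<in> borel_measurable M" using 1 measurable_F_M by blast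
  show "\<exists>L. \<forall>\<omega>\<in>space M. \<bar>\<xi> i \<omega>\<bar> \<le> L"
    using assms by (auto simp: elementary_integrand_def bounded_iff)
qed

lemma elementary_integrand_refine:
  assumes e: "elementary_integrand M F T m u \<xi>"
    and p: "strict_mono_on {..N} p" "u ` {..m} \<subseteq> p ` {..N}" "0 \<le> p 0" "p N \<le> T"
  shows "elementary_integrand M F T N p (\<lambda>j. elementary_process m u \<xi> (p (Suc j)))"
  unfolding elementary_integrand_def
proof (intro conjI allI impI p)
  fix j assume j: "j < N"
  show "p j \<le> p (Suc j)" using strict_mono_onD[OF p(1), of j "Suc j"] j by auto
  have "(\<lambda>\<omega>. \<xi> i \<omega> * indicator {u i<..u (Suc i)} (p (Suc j))) \<in> borel_measurable (F (p j))" if i: "i < m" for i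
  proof (cases "u i < p (Suc j)")
    case True
    obtain \<alpha> where \<alpha>: "\<alpha> \<le> N" "u i = p \<alpha>" using p(2) i by (metis atMost_iff imageE image_subset_iff less_imp_le)
    then have "\<alpha> \<le> j" using True strict_mono_on_less[OF p(1), of \<alpha> "Suc j"] j by auto
    then have "u i \<le> p j" using strict_mono_on_leD[OF p(1), of \<alpha> j] j \<alpha> by auto
    then have "\<xi> i \<in> borel_measurable (F (p j))"
      using measurable_F_mono elementary_integrand_coeff[OF e i] by blast
    then show ?thesis by (intro borel_measurable_times) auto
  next
    case False
    then show ?thesis by simp
  qed
  then show "elementary_process m u \<xi> (p (Suc j)) \<in> borel_measurable (F (p j))"
    unfolding elementary_process_def[abs_def] by (intro borel_measurable_sum) auto
  have "\<exists>L. \<forall>i<m. \<forall>\<omega>\<in>space M. \<bar>\<xi> i \<omega>\<bar> \<le> L i"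
    using elementary_integrand_coeff(4)[OF e] by metis
  then obtain L where L: "\<And>i \<omega>. i < m \<Longrightarrow> \<omega> \<in> space M \<Longrightarrow> \<bar>\<xi> i \<omega>\<bar> \<le> L i" by blast
  have "\<bar>elementary_process m u \<xi> (p (Suc j)) \<omega>\<bar> \<le> (\<Sum>i<m. L i)" if "\<omega> \<in> space M" for \<omega>
    unfolding elementary_process_def
  proof (rule order_trans[OF sum_abs], rule sum_mono)
    fix i assume "i \<in> {..<m}"
    then show "\<bar>\<xi> i \<omega> * indicator {u i<..u (Suc i)} (p (Suc j))\<bar> \<le> L i"
      using L[of i \<omega>] that abs_ge_zero[of "\<xi> i \<omega>"] by (auto simp: indicator_def)
  qed
  then show "bounded (elementary_process m u \<xi> (p (Suc j)) ` space M)"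
    unfolding bounded_iff by auto
qed

text \<open>
  The coefficients are switched off outside \<open>A (p i)\<close> and as soon as the accumulated square integral
  exceeds \<open>R\<close>. On a cell this integral is already known at the left end point, so the truncated process
  is again elementary, and its square integral is at most \<open>min R V\<close> without any overshoot. On the event
  \<open>A T \<inter> {V \<le> R}\<close> nothing was changed, whence the isometry gives the bound.
\<close>

lemma truncated_elementary_bound:
  assumes e: "elementary_integrand M F T N p \<xi>"
    and A: "\<And>t. 0 \<le> t \<Longrightarrow> A t \<in> sets (F t)" "\<And>s t. 0 \<le> s \<Longrightarrow> s \<le> t \<Longrightarrow> A t \<subseteq> A s"
    and V: "\<And>\<omega>. V \<omega> = (\<Sum>i<N. (\<xi> i \<omega> * indicator (A (p i)) \<omega>)\<^sup>2 * (p (Suc i) - p i))"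
    and R: "R \<ge> 0"
  shows "(\<integral>\<^sup>+\<omega>. indicator (A T) \<omega> * indicator {\<omega>. V \<omega> \<le> R} \<omega> * ennreal ((elementary_integral B N p \<xi> \<omega>)\<^sup>2) \<partial>M)
    \<le> (\<integral>\<^sup>+\<omega>. ennreal (min R (V \<omega>)) \<partial>M)"
proof -
  note nodes = elementary_nodes[OF e]
  have le: "p i \<le> p j" if "i \<le> j" "j \<le> N" for i j
    using that by (induction j rule: dec_induct) (use nodes(2) in \<open>auto intro: order_trans\<close>)
  have p0: "0 \<le> p i" "p i \<le> T" if "i \<le> N" for i using nodes(1) that by auto
  define v where "v n \<omega> = (\<Sum>i<n. (\<xi> i \<omega> * indicator (A (p i)) \<omega>)\<^sup>2 * (p (Suc i) - p i))" for n \<omega>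
  define \<theta> where "\<theta> i \<omega> = \<xi> i \<omega> * indicator (A (p i)) \<omega> * indicator {\<omega>. v (Suc i) \<omega> \<le> R} \<omega>" for i \<omega>
  have vm: "v n \<in> borel_measurable (F (p i))" if "n \<le> Suc i" "i < N" for n i
  proof -
    have "(\<lambda>\<omega>. (\<xi> j \<omega> * indicator (A (p j)) \<omega>)\<^sup>2 * (p (Suc j) - p j)) \<in> borel_measurable (F (p i))" if "j < n" for j
    proof -
      have j: "j \<le> i" "j < N" using that \<open>n \<le> Suc i\<close> \<open>i < N\<close> by auto
      have "\<xi> j \<in> borel_measurable (F (p i))" "(indicator (A (p j)) :: _ \<Rightarrow> real) \<in> borel_measurable (F (p i))"
        using measurable_F_mono[OF elementary_integrand_coeff(1)[OF e j(2)]] le[of j i] p0[of j] j \<open>i < N\<close>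
          measurable_F_mono[OF borel_measurable_indicator[OF A(1)[of "p j"]], of "p i"] by auto
      then show ?thesis by measurable
    qed
    then show ?thesis unfolding v_def[abs_def] by (intro borel_measurable_sum) auto
  qed
  have el: "elementary_integrand M F T N p \<theta>"
    unfolding elementary_integrand_def
  proof (intro conjI allI impI)
    show "0 \<le> p 0" "p N \<le> T" using p0 by auto
    fix i assume i: "i < N"
    show "p i \<le> p (Suc i)" using nodes(2) i by simp
    have [measurable]: "v (Suc i) \<in> borel_measurable (F (p i))" "\<xi> i \<in> borel_measurable (F (p i))"
       "A (p i) \<in> sets (F (p i))"
      using vm[of "Suc i" i] elementary_integrand_coeff(1)[OF e i] A(1) p0[of i] i by auto
    have "(\<lambda>\<omega>. \<xi> i \<omega> * indicator (A (p i)) \<omega> * (if v (Suc i) \<omega> \<le> R then 1 else 0)) \<in> borel_measurable (F (p i))"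
      by measurable
    then show "\<theta> i \<in> borel_measurable (F (p i))" unfolding \<theta>_def[abs_def] indicator_def by simp
    obtain L where L: "\<And>\<omega>. \<omega> \<in> space M \<Longrightarrow> \<bar>\<xi> i \<omega>\<bar> \<le> L" using elementary_integrand_coeff(4)[OF e i] by blast
    have "\<bar>\<theta> i \<omega>\<bar> \<le> L" if "\<omega> \<in> space M" for \<omega>
      using L[OF that] abs_ge_zero[of "\<xi> i \<omega>"] by (auto simp: \<theta>_def indicator_def)
    then show "bounded (\<theta> i ` space M)" by (auto simp: bounded_iff)
  qed
  have vmono: "v n \<omega> \<le> v n' \<omega>" if "n \<le> n'" "n' \<le> N" for n n' \<omega>
    unfolding v_def using that nodes(2) by (intro sum_mono2) (auto intro!: mult_nonneg_nonneg)
  have bnd: "(\<Sum>i<n. (\<theta> i \<omega>)\<^sup>2 * (p (Suc i) - p i)) \<le> min R (v n \<omega>)" if "n \<le> N" for n \<omega>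
    using that
  proof (induction n)
    case 0 then show ?case using R by (simp add: v_def)
  next
    case (Suc n)
    have each: "(\<Sum>i<Suc n. (\<theta> i \<omega>)\<^sup>2 * (p (Suc i) - p i)) \<le> v (Suc n) \<omega>"
      unfolding v_def
    proof (intro sum_mono mult_right_mono)
      fix i assume "i \<in> {..<Suc n}"
      then show "0 \<le> p (Suc i) - p i" using nodes(2)[of i] Suc.prems by simp
      show "(\<theta> i \<omega>)\<^sup>2 \<le> (\<xi> i \<omega> * indicator (A (p i)) \<omega>)\<^sup>2" by (simp add: \<theta>_def indicator_def)
    qed
    show ?case
    proof (cases "v (Suc n) \<omega> \<le> R")
      case False
      then have "\<theta> n \<omega> = 0" by (simp add: \<theta>_def)
      then show ?thesis using Suc vmono[of n "Suc n" \<omega>] by auto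
    qed (use each in auto)
  qed
  have "(\<integral>\<^sup>+\<omega>. indicator (A T) \<omega> * indicator {\<omega>. V \<omega> \<le> R} \<omega> * ennreal ((elementary_integral B N p \<xi> \<omega>)\<^sup>2) \<partial>M)
     \<le> (\<integral>\<^sup>+\<omega>. ennreal ((elementary_integral B N p \<theta> \<omega>)\<^sup>2) \<partial>M)"
  proof (rule nn_integral_mono)
    fix \<omega> assume "\<omega> \<in> space M"
    have "elementary_integral B N p \<theta> \<omega> = elementary_integral B N p \<xi> \<omega>" if "\<omega> \<in> A T" "V \<omega> \<le> R"
      unfolding elementary_integral_def
    proof (intro sum.cong refl arg_cong2[of _ _ _ _ "(*)"])
      fix i assume i: "i \<in> {..<N}"
      have "\<omega> \<in> A (p i)" using A(2)[of "p i" T] p0[of i] i that by auto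
      moreover have "v (Suc i) \<omega> \<le> R" using vmono[of "Suc i" N \<omega>] i that V[of \<omega>] by (simp add: v_def)
      ultimately show "\<theta> i \<omega> = \<xi> i \<omega>" by (simp add: \<theta>_def)
    qed
    then show "indicator (A T) \<omega> * indicator {\<omega>. V \<omega> \<le> R} \<omega> * ennreal ((elementary_integral B N p \<xi> \<omega>)\<^sup>2)
      \<le> ennreal ((elementary_integral B N p \<theta> \<omega>)\<^sup>2)"
      by (auto simp: indicator_def)
  qed
  also have "\<dots> = ennreal (expectation (\<lambda>\<omega>. (elementary_integral B N p \<theta> \<omega>)\<^sup>2))"
    using elementary_isometry[OF el] by (intro nn_integral_eq_integral) auto
  also have "\<dots> = ennreal (expectation (\<lambda>\<omega>. \<Sum>i<N. (\<theta> i \<omega>)\<^sup>2 * (p (Suc i) - p i)))"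
    using elementary_isometry[OF el] by simp
  also have "\<dots> = (\<integral>\<^sup>+\<omega>. ennreal (\<Sum>i<N. (\<theta> i \<omega>)\<^sup>2 * (p (Suc i) - p i)) \<partial>M)"
    using elementary_isometry[OF el] nodes(2)
    by (intro nn_integral_eq_integral[symmetric]) (auto intro!: sum_nonneg)
  also have "\<dots> \<le> (\<integral>\<^sup>+\<omega>. ennreal (min R (V \<omega>)) \<partial>M)"
    by (intro nn_integral_mono ennreal_leI) (use bnd[of N] V in \<open>simp add: v_def\<close>)
  finally show ?thesis .
qed

lemma progressive_joint_measurable:
  assumes "(\<lambda>(s, \<omega>). H s \<omega> :: real) \<in> borel_measurable (restrict_space borel {0..T} \<Otimes>\<^sub>M F T)" and T: "0 \<le> T"
  shows "(\<lambda>(s, \<omega>). indicator {0..T} s * H s \<omega>) \<in> borel_measurable (borel \<Otimes>\<^sub>M M)"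
proof -
  define r where "r s = max 0 (min T s)" for s :: real
  have r1: "r \<in> borel \<rightarrow>\<^sub>M restrict_space borel {0..T}"
    unfolding r_def[abs_def] using T by (intro measurable_restrict_space2) auto
  have id: "(\<lambda>\<omega>. \<omega>) \<in> M \<rightarrow>\<^sub>M F T" by (rule measurable_F_M[OF _ T]) simp
  have "(\<lambda>z. (r (fst z), snd z)) \<in> (borel \<Otimes>\<^sub>M M) \<rightarrow>\<^sub>M (restrict_space borel {0..T} \<Otimes>\<^sub>M F T)"
    by (intro measurable_Pair measurable_compose[OF measurable_fst r1] measurable_compose[OF measurable_snd id])
  from measurable_compose[OF this assms(1)]
  have "(\<lambda>z. H (r (fst z)) (snd z)) \<in> borel_measurable (borel \<Otimes>\<^sub>M M)" by simp
  then have "(\<lambda>z. indicator {0..T} (fst z) * H (r (fst z)) (snd z)) \<in> borel_measurable (borel \<Otimes>\<^sub>M M)"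
    by (intro borel_measurable_times measurable_compose[OF measurable_fst]) auto
  also have "(\<lambda>z. indicator {0..T} (fst z) * H (r (fst z)) (snd z)) = (\<lambda>(s, \<omega>). indicator {0..T} s * H s \<omega>)"
    by (auto simp: fun_eq_iff indicator_def r_def)
  finally show ?thesis .
qed


lemma past_sets:
  assumes E: "\<And>r. 0 \<le> r \<Longrightarrow> E r \<in> sets (F r)" and s: "0 \<le> s"
  shows "past M E s \<in> sets (F s)"
proof -
  have eq: "past M E s = space (F s) - (\<Union>r\<in>\<rat> \<inter> {0..<s}. space (F s) - E r)"
    unfolding past_def space_F[OF s] by auto
  have "space (F s) - E r \<in> sets (F s)" if "r \<in> \<rat> \<inter> {0..<s}" for r
  proof -
    have "(indicator (E r) :: 'a \<Rightarrow> real) \<in> borel_measurable (F s)"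
      using that by (intro measurable_F_mono[OF borel_measurable_indicator[OF E]]) auto
    then have "E r \<inter> space (F s) \<in> sets (F s)" by (simp add: borel_measurable_indicator_iff)
    moreover have "space (F s) - E r = space (F s) - (E r \<inter> space (F s))" by auto
    ultimately show ?thesis by auto
  qed
  moreover have "countable (\<rat> \<inter> {0..<s})" using countable_rat by (rule countable_Int1)
  ultimately have "(\<Union>r\<in>\<rat> \<inter> {0..<s}. space (F s) - E r) \<in> sets (F s)" by (intro sets.countable_UN'')
  then show ?thesis unfolding eq by (intro sets.Diff sets.top)
qed

lemma past_antimono: "s \<le> t \<Longrightarrow> past M E t \<subseteq> past M E s"
  by (auto simp: past_def)

lemma past_joint_measurable:
  assumes E: "\<And>r. 0 \<le> r \<Longrightarrow> E r \<in> sets (F r)"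
  shows "(\<lambda>(s, \<omega>). indicator (past M E s) \<omega> :: real) \<in> borel_measurable (borel \<Otimes>\<^sub>M M)"
proof -
  let ?S = "space (borel \<Otimes>\<^sub>M M) - (\<Union>r\<in>\<rat> \<inter> {0::real..}. {r<..} \<times> (space M - E r))"
  have "E r \<in> sets M" if "0 \<le> r" for r
    using E[OF that] bm that unfolding brownian_motion_def filtered_prob_space_def subalgebra_def by blast
  then have "?S \<in> sets (borel \<Otimes>\<^sub>M M)"
    using countable_rat by (intro sets.Diff sets.countable_UN'' countable_Int1) auto
  then have "(\<lambda>z. indicator ?S z * 1 :: real) \<in> borel_measurable (borel \<Otimes>\<^sub>M M)" by simp
  then show ?thesis
    by (rule measurable_cong[THEN iffD1, rotated])
      (auto simp: space_pair_measure past_def indicator_def split: if_splits)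
qed

lemma elementary_process_joint_measurable:
  assumes e: "elementary_integrand M F T m u \<xi>"
  shows "(\<lambda>(s, \<omega>). elementary_process m u \<xi> s \<omega>) \<in> borel_measurable (borel \<Otimes>\<^sub>M M)"
proof -
  have "(\<lambda>z. \<xi> i (snd z) * indicator {u i<..u (Suc i)} (fst z)) \<in> borel_measurable (borel \<Otimes>\<^sub>M M)" if "i < m" for i
    by (intro borel_measurable_times measurable_compose[OF measurable_snd elementary_integrand_coeff(2)[OF e that]]
      measurable_compose[OF measurable_fst]) auto
  then have "(\<lambda>z. \<Sum>i<m. \<xi> i (snd z) * indicator {u i<..u (Suc i)} (fst z)) \<in> borel_measurable (borel \<Otimes>\<^sub>M M)"
    by (intro borel_measurable_sum) auto
  then show ?thesis by (simp add: elementary_process_def case_prod_beta')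
qed

text \<open>
  One half of the Ito isometry, localized by events that are decreasing in time. The integral is only
  known to be a limit in probability, so no bound is inherited directly from the approximating elementary
  integrals. Along a subsequence everything converges almost surely, and the truncated square integrals
  \<open>min R V\<close> converge boundedly; Fatou's lemma then gives the bound on \<open>{V < R}\<close>, and \<open>R \<rightarrow> \<infinity>\<close>.
\<close>

theorem ito_integral_localized_bound:
  fixes E :: "real \<Rightarrow> 'a set"
  assumes J: "has_ito_integral M F B T H J" and T: "0 \<le> T"
    and E: "\<And>r. 0 \<le> r \<Longrightarrow> E r \<in> sets (F r)"
  shows "(\<integral>\<^sup>+\<omega>. indicator (past M E T) \<omega> * ennreal ((J \<omega>)\<^sup>2) \<partial>M)
    \<le> (\<integral>\<^sup>+s. indicator {0..T} s * (\<integral>\<^sup>+\<omega>. indicator (past M E s) \<omega> * ennreal ((H s \<omega>)\<^sup>2) \<partial>M) \<partial>lborel)"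
proof -
  let ?A = "past M E"
  define h where "h s \<omega> = indicator {0..T} s * H s \<omega>" for s \<omega>
  have prog: "(\<lambda>(s, \<omega>). H s \<omega>) \<in> borel_measurable (restrict_space borel {0..T} \<Otimes>\<^sub>M F T)"
    and AEsq: "AE \<omega> in M. set_integrable lborel {0..T} (\<lambda>s. (H s \<omega>)\<^sup>2)"
    and Jm[measurable]: "J \<in> borel_measurable M"
    using J T unfolding has_ito_integral_def by auto
  obtain m u \<xi> where el: "\<And>k. elementary_integrand M F T (m k) (u k) (\<xi> k)"
    and conv1: "converges_in_probability M
      (\<lambda>k \<omega>. LINT s:{0..T}|lborel. (elementary_process (m k) (u k) (\<xi> k) s \<omega> - H s \<omega>)\<^sup>2) (\<lambda>_. 0)"
    and conv2: "converges_in_probability M (\<lambda>k. elementary_integral B (m k) (u k) (\<xi> k)) J"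
    using J unfolding has_ito_integral_def by blast
  define \<phi> where "\<phi> k = elementary_process (m k) (u k) (\<xi> k)" for k
  define I where "I k = elementary_integral B (m k) (u k) (\<xi> k)" for k
  define D where "D k \<omega> = (\<integral>s. (\<phi> k s \<omega> - h s \<omega>)\<^sup>2 \<partial>lborel)" for k \<omega>
  have hm[measurable]: "(\<lambda>(s, \<omega>). h s \<omega>) \<in> borel_measurable (borel \<Otimes>\<^sub>M M)"
    unfolding h_def by (rule progressive_joint_measurable[OF prog T])
  have \<phi>m[measurable]: "(\<lambda>(s, \<omega>). \<phi> k s \<omega>) \<in> borel_measurable (borel \<Otimes>\<^sub>M M)" for k
    unfolding \<phi>_def by (rule elementary_process_joint_measurable[OF el])
  have Am[measurable]: "(\<lambda>(s, \<omega>). indicator (?A s) \<omega> :: real) \<in> borel_measurable (borel \<Otimes>\<^sub>M M)"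
    by (rule past_joint_measurable[OF E])
  have Im[measurable]: "I k \<in> borel_measurable M" for k
  proof -
    have "u k (m k) \<in> u k ` {..m k}" by simp
    then have "0 \<le> u k (m k)" using elementary_nodes(1)[OF el, of k] by auto
    then show ?thesis unfolding I_def by (rule measurable_F_M[OF elementary_integral_measurable_F[OF el]])
  qed
  have \<phi>0: "\<phi> k s \<omega> = 0" if "s \<notin> {0..T}" for k s \<omega>
  proof -
    have "indicator {u k i<..u k (Suc i)} s = (0::real)" if i: "i < m k" for i
    proof -
      have "u k i \<in> u k ` {..m k}" "u k (Suc i) \<in> u k ` {..m k}" using i by auto
      then have "u k i \<in> {0..T}" "u k (Suc i) \<in> {0..T}" using elementary_nodes(1)[OF el, of k] by blast+
      then show ?thesis using \<open>s \<notin> {0..T}\<close> by (auto simp: indicator_def)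
    qed
    then show ?thesis unfolding \<phi>_def elementary_process_def by (intro sum.neutral) auto
  qed
  have D_eq: "D k \<omega> = (LINT s:{0..T}|lborel. (elementary_process (m k) (u k) (\<xi> k) s \<omega> - H s \<omega>)\<^sup>2)" for k \<omega>
    unfolding D_def set_lebesgue_integral_def
    by (intro Bochner_Integration.integral_cong refl) (use \<phi>0 in \<open>auto simp: h_def indicator_def \<phi>_def\<close>)
  have Dm[measurable]: "D k \<in> borel_measurable M" for k
    unfolding D_def[abs_def] by measurable
  obtain r where r: "strict_mono (r :: nat \<Rightarrow> nat)"
    "AE \<omega> in M. (\<lambda>k. D (r k) \<omega>) \<longlonglongrightarrow> 0 \<and> (\<lambda>k. I (r k) \<omega>) \<longlonglongrightarrow> J \<omega>"
    using converges_in_probability_subseq2[of D "\<lambda>_. 0" I J] conv1[folded D_eq] conv2[folded I_def] by auto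
  \<comment> \<open>The partitions contain more and more rational times: a failure of \<open>E r\<close> before \<open>s\<close> is then noticed at
    the left end point of the cell containing \<open>s\<close>, for all large \<open>k\<close>.\<close>
  define q :: "nat \<Rightarrow> real" where "q = from_nat_into \<rat>"
  have q: "range q = \<rat>" unfolding q_def by (rule range_from_nat_into) (use Rats_0 countable_rat in auto)
  define S where "S k = insert 0 (insert T (u k ` {..m k} \<union> (q ` {..k} \<inter> {0..T})))" for k
  have "\<exists>N (p :: nat \<Rightarrow> real). strict_mono_on {..N} p \<and> p ` {..N} = S k \<and> p 0 = 0 \<and> p N = T" for k
  proof -
    have "finite (S k)" "S k \<subseteq> {0..T}" "0 \<in> S k" "T \<in> S k"
      using T elementary_nodes(1)[OF el, of k] by (auto simp: S_def)
    then show ?thesis by (rule finite_set_partition) blast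
  qed
  then obtain N :: "nat \<Rightarrow> nat" and p :: "nat \<Rightarrow> nat \<Rightarrow> real" where p: "\<And>k. strict_mono_on {..N k} (p k)"
    "\<And>k. p k ` {..N k} = S k" "\<And>k. p k 0 = 0" "\<And>k. p k (N k) = T"
    by metis
  define \<eta> where "\<eta> k j = elementary_process (m k) (u k) (\<xi> k) (p k (Suc j))" for k j
  \<comment> \<open>\<open>a k\<close> samples the indicator of the past at the left end points of the cells, \<open>\<psi> k = \<phi> k * a k\<close> is the
    localized process, and its square integral \<open>V k\<close> tends to \<open>V\<^sub>0\<close>\<close>
  define a where "a k = elementary_process (N k) (p k) (\<lambda>j. indicator (?A (p k j)))" for k
  define \<psi> where "\<psi> k = elementary_process (N k) (p k) (\<lambda>j \<omega>. \<eta> k j \<omega> * indicator (?A (p k j)) \<omega>)" for k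
  define V where "V k \<omega> = (\<Sum>i<N k. (\<eta> k i \<omega> * indicator (?A (p k i)) \<omega>)\<^sup>2 * (p k (Suc i) - p k i))" for k \<omega>
  define V\<^sub>0 where "V\<^sub>0 \<omega> = (\<integral>s. (h s \<omega> * indicator (?A s) \<omega>)\<^sup>2 \<partial>lborel)" for \<omega>
  have sub: "u k ` {..m k} \<subseteq> p k ` {..N k}" for k unfolding p S_def by auto
  have \<phi>_eq: "\<phi> k s \<omega> = elementary_process (N k) (p k) (\<eta> k) s \<omega>" for k s \<omega>
    unfolding \<phi>_def \<eta>_def by (rule elementary_process_refine[OF p(1) sub elementary_nodes(2)[OF el]])
  have I_eq: "I k \<omega> = elementary_integral B (N k) (p k) (\<eta> k) \<omega>" for k \<omega>
    unfolding I_def \<eta>_def by (rule elementary_integral_refine[OF p(1) sub elementary_nodes(2)[OF el]])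
  have el\<eta>: "elementary_integrand M F T (N k) (p k) (\<eta> k)" for k
    unfolding \<eta>_def by (rule elementary_integrand_refine[OF el p(1) sub]) (use p in auto)
  have cell: "\<psi> k s \<omega> = \<phi> k s \<omega> * a k s \<omega> \<and> 0 \<le> a k s \<omega> \<and> a k s \<omega> \<le> 1" for k s \<omega>
  proof (cases "s \<in> {p k 0<..p k (N k)}")
    case True
    then obtain j where "j < N k" "s \<in> {p k j<..p k (Suc j)}" by (rule partition_cell)
    then show ?thesis unfolding \<psi>_def \<phi>_eq a_def by (simp add: elementary_process_cell[OF p(1)])
  next
    case False
    then show ?thesis unfolding \<psi>_def \<phi>_eq a_def by (simp add: elementary_process_outside[OF p(1)])
  qed
  have a_lim: "(\<lambda>k. a k s \<omega>) \<longlonglongrightarrow> indicator (?A s) \<omega>" if s: "0 < s" "s \<le> T" and \<omega>: "\<omega> \<in> space M" for s \<omega>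
  proof (rule tendsto_eventually)
    have "\<forall>\<^sub>F k in sequentially. \<omega> \<in> ?A s \<or> (\<exists>j. j < N k \<and> s \<in> {p k j<..p k (Suc j)} \<and> \<omega> \<notin> ?A (p k j))"
    proof (cases "\<omega> \<in> ?A s")
      case False
      then obtain r where r: "r \<in> \<rat>" "0 \<le> r" "r < s" "\<omega> \<notin> E r" using \<omega> by (auto simp: past_def)
      obtain r' where r': "r' \<in> \<rat>" "r < r'" "r' < s" using Rats_dense_in_real[OF r(3)] by blast
      then obtain i where i: "r' = q i" using q by (metis imageE)
      show ?thesis using eventually_ge_at_top[of i]
      proof eventually_elim
        case (elim k)
        have "s \<in> {p k 0<..p k (N k)}" using s p by auto
        then obtain j where j: "j < N k" "s \<in> {p k j<..p k (Suc j)}" by (rule partition_cell)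
        have "r' \<in> S k" using elim i r r' s by (auto simp: S_def)
        then obtain l where l: "l \<le> N k" "r' = p k l" unfolding p(2)[symmetric] by auto
        have "l \<le> j"
        proof (rule ccontr)
          assume "\<not> l \<le> j"
          then have "p k (Suc j) \<le> p k l" using strict_mono_on_leD[OF p(1), of "Suc j" k l] l j by auto
          then show False using j l r' by auto
        qed
        then have "r < p k j" using strict_mono_on_leD[OF p(1), of l k j] l j r' by auto
        then have "\<omega> \<notin> ?A (p k j)" using r by (auto simp: past_def)
        then show ?case using j by blast
      qed
    qed simp
    then show "\<forall>\<^sub>F k in sequentially. a k s \<omega> = indicator (?A s) \<omega>"
    proof eventually_elim
      case (elim k)
      have "s \<in> {p k 0<..p k (N k)}" using s p by auto
      then obtain j where j: "j < N k" "s \<in> {p k j<..p k (Suc j)}" by (rule partition_cell)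
      show ?case
      proof (cases "\<omega> \<in> ?A s")
        case True
        then have "\<omega> \<in> ?A (p k j)" using past_antimono[of "p k j" s] j by auto
        then show ?thesis using True unfolding a_def by (simp add: elementary_process_cell[OF p(1) j])
      next
        case False
        then obtain j' where j': "j' < N k" "s \<in> {p k j'<..p k (Suc j')}" "\<omega> \<notin> ?A (p k j')" using elim by blast
        then show ?thesis using False unfolding a_def by (simp add: elementary_process_cell[OF p(1) j'(1,2)])
      qed
    qed
  qed
  have V_eq: "V k \<omega> = (\<integral>s. (\<psi> k s \<omega>)\<^sup>2 \<partial>lborel)" "integrable lborel (\<lambda>s. (\<psi> k s \<omega>)\<^sup>2)" for k \<omega>
    unfolding \<psi>_def V_def
    by (rule integral_elementary_process_sq(2)[OF p(1), symmetric], rule integral_elementary_process_sq(1)[OF p(1)])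
  have V0[simp]: "0 \<le> V k \<omega>" "0 \<le> V\<^sub>0 \<omega>" for k \<omega> unfolding V_eq V\<^sub>0_def by auto
  have am[measurable]: "(\<lambda>s. a k s \<omega>) \<in> borel_measurable borel" "(\<lambda>s. \<psi> k s \<omega>) \<in> borel_measurable borel"
    "(\<lambda>s. \<phi> k s \<omega>) \<in> borel_measurable borel" for k \<omega>
    unfolding a_def \<psi>_def \<phi>_def elementary_process_def[abs_def] by measurable
  have V_lim: "AE \<omega> in M. (\<lambda>k. V (r k) \<omega>) \<longlonglongrightarrow> V\<^sub>0 \<omega>"
    using r(2) AEsq AE_space
  proof eventually_elim
    case (elim \<omega>)
    have [measurable]: "(\<lambda>s. h s \<omega>) \<in> borel_measurable borel" "(\<lambda>s. indicator (?A s) \<omega> :: real) \<in> borel_measurable borel"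
      using measurable_compose[OF measurable_Pair2'[OF elim(3)] hm] measurable_compose[OF measurable_Pair2'[OF elim(3)] Am]
      by auto
    have h2: "integrable lborel (\<lambda>s. (h s \<omega>)\<^sup>2)"
    proof -
      have "(\<lambda>s. (h s \<omega>)\<^sup>2) = (\<lambda>s. indicator {0..T} s *\<^sub>R (H s \<omega>)\<^sup>2)" by (auto simp: h_def indicator_def)
      then show ?thesis using elim(2) by (simp add: set_integrable_def)
    qed
    have \<phi>2: "integrable lborel (\<lambda>s. (\<phi> k s \<omega>)\<^sup>2)" for k
      unfolding \<phi>_eq by (rule integral_elementary_process_sq(1)[OF p(1)])
    have hA2: "integrable lborel (\<lambda>s. (h s \<omega> * indicator (?A s) \<omega>)\<^sup>2)"
    proof (rule Bochner_Integration.integrable_bound[OF h2])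
      show "(\<lambda>s. (h s \<omega> * indicator (?A s) \<omega>)\<^sup>2) \<in> borel_measurable lborel" by measurable
    qed (auto simp: indicator_def)
    have D2: "integrable lborel (\<lambda>s. (\<phi> k s \<omega> - h s \<omega>)\<^sup>2)" for k
      by (rule integrable_diff_power2) (use \<phi>2 h2 in auto)
    have P2: "integrable lborel (\<lambda>s. (\<psi> k s \<omega> - h s \<omega> * indicator (?A s) \<omega>)\<^sup>2)" for k
      by (rule integrable_diff_power2) (use V_eq hA2 in auto)
    define e where "e k s = (h s \<omega>)\<^sup>2 * (a k s \<omega> - indicator (?A s) \<omega>)\<^sup>2" for k s
    have e_le: "\<bar>e k s\<bar> \<le> (h s \<omega>)\<^sup>2" for k s
    proof -
      have "\<bar>a k s \<omega> - indicator (?A s) \<omega>\<bar> \<le> 1" using cell[of k s \<omega>] by (auto simp: indicator_def)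
      then have "(a k s \<omega> - indicator (?A s) \<omega>)\<^sup>2 \<le> 1" by (simp add: abs_square_le_1)
      then show ?thesis unfolding e_def by (simp add: mult_left_le)
    qed
    have em[measurable]: "e k \<in> borel_measurable lborel" for k unfolding e_def[abs_def] by measurable
    have e_int: "integrable lborel (e k)" for k
      by (rule Bochner_Integration.integrable_bound[OF h2]) (use e_le in auto)
    have "(\<lambda>k. \<integral>s. e k s \<partial>lborel) \<longlonglongrightarrow> (\<integral>s. 0 \<partial>(lborel :: real measure))"
    proof (rule integral_dominated_convergence[where w="\<lambda>s. (h s \<omega>)\<^sup>2"])
      show "AE s in lborel. (\<lambda>k. e k s) \<longlonglongrightarrow> 0"
        using AE_lborel_singleton[of 0]
      proof eventually_elim
        case (elim s)
        show ?case
        proof (cases "s \<in> {0..T}")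
          case True
          then have "(\<lambda>k. e k s) \<longlonglongrightarrow> (h s \<omega>)\<^sup>2 * (indicator (?A s) \<omega> - indicator (?A s) \<omega>)\<^sup>2"
            unfolding e_def using elim \<open>\<omega> \<in> space M\<close> by (intro tendsto_intros a_lim) auto
          then show ?thesis by simp
        qed (simp add: e_def h_def)
      qed
    qed (use h2 e_le in auto)
    from LIMSEQ_subseq_LIMSEQ[OF this r(1)]
    have e_lim: "(\<lambda>k. \<integral>s. e (r k) s \<partial>lborel) \<longlonglongrightarrow> 0" by (simp add: comp_def)
    have "(\<lambda>k. \<integral>s. (\<psi> (r k) s \<omega> - h s \<omega> * indicator (?A s) \<omega>)\<^sup>2 \<partial>lborel) \<longlonglongrightarrow> 0"
    proof (rule tendsto_sandwich[OF _ _ tendsto_const])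
      show "(\<lambda>k. 2 * D (r k) \<omega> + 2 * (\<integral>s. e (r k) s \<partial>lborel)) \<longlonglongrightarrow> 0"
        using tendsto_add[OF tendsto_mult_left[OF conjunct1[OF elim(1)], of 2] tendsto_mult_left[OF e_lim, of 2]] by simp
      have "(\<integral>s. (\<psi> k s \<omega> - h s \<omega> * indicator (?A s) \<omega>)\<^sup>2 \<partial>lborel) \<le> 2 * D k \<omega> + 2 * (\<integral>s. e k s \<partial>lborel)" for k
      proof -
        have "(\<integral>s. (\<psi> k s \<omega> - h s \<omega> * indicator (?A s) \<omega>)\<^sup>2 \<partial>lborel)
            \<le> (\<integral>s. 2 * (\<phi> k s \<omega> - h s \<omega>)\<^sup>2 + 2 * e k s \<partial>lborel)"
        proof (rule integral_mono[OF P2])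
          show "integrable lborel (\<lambda>s. 2 * (\<phi> k s \<omega> - h s \<omega>)\<^sup>2 + 2 * e k s)" using D2 e_int by simp
          fix s
          let ?x = "(\<phi> k s \<omega> - h s \<omega>) * a k s \<omega>" and ?y = "h s \<omega> * (a k s \<omega> - indicator (?A s) \<omega>)"
          have "\<psi> k s \<omega> - h s \<omega> * indicator (?A s) \<omega> = ?x + ?y" using cell[of k s \<omega>] by (simp add: algebra_simps)
          moreover have "(?x + ?y)\<^sup>2 \<le> 2 * ?x\<^sup>2 + 2 * ?y\<^sup>2"
            using sum_squares_bound[of ?x ?y] by (simp add: power2_sum)
          moreover have "?x\<^sup>2 \<le> (\<phi> k s \<omega> - h s \<omega>)\<^sup>2"
            using cell[of k s \<omega>] by (simp add: power_mult_distrib mult_left_le power_le_one)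
          ultimately show "(\<psi> k s \<omega> - h s \<omega> * indicator (?A s) \<omega>)\<^sup>2 \<le> 2 * (\<phi> k s \<omega> - h s \<omega>)\<^sup>2 + 2 * e k s"
            by (simp add: e_def power_mult_distrib)
        qed
        also have "\<dots> = 2 * D k \<omega> + 2 * (\<integral>s. e k s \<partial>lborel)" unfolding D_def using D2 e_int by simp
        finally show ?thesis .
      qed
      then show "\<forall>\<^sub>F k in sequentially. (\<integral>s. (\<psi> (r k) s \<omega> - h s \<omega> * indicator (?A s) \<omega>)\<^sup>2 \<partial>lborel)
          \<le> 2 * D (r k) \<omega> + 2 * (\<integral>s. e (r k) s \<partial>lborel)" by simp
    qed simp
    then show ?case unfolding V_eq V\<^sub>0_def by (intro L2_tendsto P2 hA2) auto
  qed
  have Vm[measurable]: "V k \<in> borel_measurable M" for k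
  proof -
    have "\<eta> k i \<in> borel_measurable M" "(indicator (?A (p k i)) :: 'a \<Rightarrow> real) \<in> borel_measurable M" if "i < N k" for i
      using elementary_integrand_coeff[OF el\<eta> that] measurable_F_M[OF borel_measurable_indicator[OF past_sets[OF E]]] by auto
    then show ?thesis 
      unfolding V_def[abs_def]
      by (intro borel_measurable_sum borel_measurable_times borel_measurable_power borel_measurable_const) auto
  qed
  have V0m[measurable]: "V\<^sub>0 \<in> borel_measurable M" unfolding V\<^sub>0_def[abs_def] by measurable
  have AT[measurable]: "?A T \<in> sets M"
    using past_sets[OF E T] bm T unfolding brownian_motion_def filtered_prob_space_def subalgebra_def by blast
  have trunc: "(\<integral>\<^sup>+\<omega>. indicator (?A T) \<omega> * indicator {\<omega>. V\<^sub>0 \<omega> < R} \<omega> * ennreal ((J \<omega>)\<^sup>2) \<partial>M) \<le> (\<integral>\<^sup>+\<omega>. ennreal (V\<^sub>0 \<omega>) \<partial>M)"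
    if R: "R \<ge> 0" for R
  proof -
    have "(\<integral>\<^sup>+\<omega>. indicator (?A T) \<omega> * indicator {\<omega>. V\<^sub>0 \<omega> < R} \<omega> * ennreal ((J \<omega>)\<^sup>2) \<partial>M) \<le> (\<integral>\<^sup>+\<omega>. ennreal (min R (V\<^sub>0 \<omega>)) \<partial>M)"
    proof (rule nn_integral_le_limit)
      let ?u = "\<lambda>k \<omega>. indicator (?A T) \<omega> * indicator {\<omega>. V (r k) \<omega> \<le> R} \<omega> * ennreal ((I (r k) \<omega>)\<^sup>2)"
      have "(\<lambda>\<omega>. indicator (?A T) \<omega> * (if V (r k) \<omega> \<le> R then 1 else 0) * ennreal ((I (r k) \<omega>)\<^sup>2)) \<in> borel_measurable M" for k
        by measurable
      then show "?u k \<in> borel_measurable M" for k by (simp add: indicator_def)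
      show "(\<integral>\<^sup>+\<omega>. ?u k \<omega> \<partial>M) \<le> (\<integral>\<^sup>+\<omega>. ennreal (min R (V (r k) \<omega>)) \<partial>M)" for k
        unfolding I_eq by (rule truncated_elementary_bound[OF el\<eta> past_sets[OF E] past_antimono V_def R])
      show "(\<lambda>k. \<integral>\<^sup>+\<omega>. ennreal (min R (V (r k) \<omega>)) \<partial>M) \<longlonglongrightarrow> (\<integral>\<^sup>+\<omega>. ennreal (min R (V\<^sub>0 \<omega>)) \<partial>M)"
      proof (rule nn_integral_dominated_convergence[where w="\<lambda>_. ennreal R"])
        show "AE \<omega> in M. (\<lambda>k. ennreal (min R (V (r k) \<omega>))) \<longlonglongrightarrow> ennreal (min R (V\<^sub>0 \<omega>))"
          using V_lim by eventually_elim (intro tendsto_ennrealI tendsto_min tendsto_const)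
        show "AE \<omega> in M. ennreal (min R (V (r k) \<omega>)) \<le> ennreal R" for k
          by (intro AE_I2 ennreal_leI min.cobounded1)
      qed (auto simp: emeasure_space_1)
      show "AE \<omega> in M. indicator (?A T) \<omega> * indicator {\<omega>. V\<^sub>0 \<omega> < R} \<omega> * ennreal ((J \<omega>)\<^sup>2) \<le> liminf (\<lambda>k. ?u k \<omega>)"
        using V_lim r(2)
      proof eventually_elim
        case (elim \<omega>)
        show ?case
        proof (cases "\<omega> \<in> ?A T \<and> V\<^sub>0 \<omega> < R")
          case True
          have "(\<lambda>k. ennreal ((I (r k) \<omega>)\<^sup>2)) \<longlonglongrightarrow> ennreal ((J \<omega>)\<^sup>2)"
            using elim by (intro tendsto_ennrealI tendsto_power) auto
          moreover have "\<forall>\<^sub>F k in sequentially. ennreal ((I (r k) \<omega>)\<^sup>2) = ?u k \<omega>"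
            using order_tendstoD(2)[OF elim(1), of R] True by (auto elim!: eventually_mono)
          ultimately have "(\<lambda>k. ?u k \<omega>) \<longlonglongrightarrow> ennreal ((J \<omega>)\<^sup>2)" by (rule Lim_transform_eventually)
          then have "liminf (\<lambda>k. ?u k \<omega>) = ennreal ((J \<omega>)\<^sup>2)" by (intro lim_imp_Liminf) auto
          then show ?thesis by (auto simp: indicator_def)
        qed (auto simp: indicator_def)
      qed
    qed
    also have "\<dots> \<le> (\<integral>\<^sup>+\<omega>. ennreal (V\<^sub>0 \<omega>) \<partial>M)" by (intro nn_integral_mono ennreal_leI) auto
    finally show ?thesis .
  qed
  have "(\<integral>\<^sup>+\<omega>. indicator (?A T) \<omega> * ennreal ((J \<omega>)\<^sup>2) \<partial>M) \<le> (\<integral>\<^sup>+\<omega>. ennreal (V\<^sub>0 \<omega>) \<partial>M)"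
  proof (rule nn_integral_le_limit)
    let ?u = "\<lambda>k \<omega>. indicator (?A T) \<omega> * indicator {\<omega>. V\<^sub>0 \<omega> < real k} \<omega> * ennreal ((J \<omega>)\<^sup>2)"
    have "(\<lambda>\<omega>. indicator (?A T) \<omega> * (if V\<^sub>0 \<omega> < real k then 1 else 0) * ennreal ((J \<omega>)\<^sup>2)) \<in> borel_measurable M" for k
      by measurable
    then show "?u k \<in> borel_measurable M" for k by (simp add: indicator_def)
    show "(\<integral>\<^sup>+\<omega>. ?u k \<omega> \<partial>M) \<le> (\<integral>\<^sup>+\<omega>. ennreal (V\<^sub>0 \<omega>) \<partial>M)" for k by (rule trunc) simp
    show "AE \<omega> in M. indicator (?A T) \<omega> * ennreal ((J \<omega>)\<^sup>2) \<le> liminf (\<lambda>k. ?u k \<omega>)"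
    proof (intro AE_I2 Liminf_bounded)
      fix \<omega>
      obtain k0 where "V\<^sub>0 \<omega> < real k0" using reals_Archimedean2 by blast
      then show "\<forall>\<^sub>F k in sequentially. indicator (?A T) \<omega> * ennreal ((J \<omega>)\<^sup>2) \<le> ?u k \<omega>"
        unfolding eventually_sequentially by (intro exI[of _ k0]) (auto simp: indicator_def)
    qed
  qed simp
  also have "\<dots> \<le> (\<integral>\<^sup>+\<omega>. \<integral>\<^sup>+s. ennreal ((h s \<omega> * indicator (?A s) \<omega>)\<^sup>2) \<partial>lborel \<partial>M)"
  proof (rule nn_integral_mono)
    fix \<omega>
    show "ennreal (V\<^sub>0 \<omega>) \<le> (\<integral>\<^sup>+s. ennreal ((h s \<omega> * indicator (?A s) \<omega>)\<^sup>2) \<partial>lborel)"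
    proof (cases "integrable lborel (\<lambda>s. (h s \<omega> * indicator (?A s) \<omega>)\<^sup>2)")
      case True
      then show ?thesis unfolding V\<^sub>0_def by (subst nn_integral_eq_integral) auto
    next
      case False
      then show ?thesis unfolding V\<^sub>0_def by (simp add: not_integrable_integral_eq)
    qed
  qed
  also have "\<dots> = (\<integral>\<^sup>+s. \<integral>\<^sup>+\<omega>. ennreal ((h s \<omega> * indicator (?A s) \<omega>)\<^sup>2) \<partial>M \<partial>lborel)"
  proof -
    interpret pair_sigma_finite lborel M ..
    show ?thesis by (rule Fubini') measurable
  qed
  also have "\<dots> = (\<integral>\<^sup>+s. indicator {0..T} s * (\<integral>\<^sup>+\<omega>. indicator (?A s) \<omega> * ennreal ((H s \<omega>)\<^sup>2) \<partial>M) \<partial>lborel)"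
  proof (intro nn_integral_cong)
    fix s
    have "ennreal ((h s \<omega> * indicator (?A s) \<omega>)\<^sup>2) = (if s \<in> {0..T} then indicator (?A s) \<omega> * ennreal ((H s \<omega>)\<^sup>2) else 0)" for \<omega>
      by (auto simp: h_def indicator_def)
    then show "(\<integral>\<^sup>+\<omega>. ennreal ((h s \<omega> * indicator (?A s) \<omega>)\<^sup>2) \<partial>M)
       = indicator {0..T} s * (\<integral>\<^sup>+\<omega>. indicator (?A s) \<omega> * ennreal ((H s \<omega>)\<^sup>2) \<partial>M)"
      by (auto simp: indicator_def)
  qed
  finally show ?thesis .
qed

end

section \<open>Approximation by Wiener integrals of step functions\<close>

lemma elementary_lincomb:
  "elementary_process N p (\<lambda>j \<omega>. x * \<xi> j \<omega> + y * \<xi>' j \<omega>) s \<omega> = x * elementary_process N p \<xi> s \<omega> + y * elementary_process N p \<xi>' s \<omega>"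
  "elementary_integral B N p (\<lambda>j \<omega>. x * \<xi> j \<omega> + y * \<xi>' j \<omega>) \<omega> = x * elementary_integral B N p \<xi> \<omega> + y * elementary_integral B N p \<xi>' \<omega>"
  by (simp_all only: elementary_process_def elementary_integral_def sum_distrib_left sum.distrib[symmetric] distrib_right mult.assoc)

text \<open>
  \<open>I\<close> is the integral of the deterministic step function \<open>g\<close>. The nodes are strictly increasing, so that
  \<open>g\<close> determines the coefficients.
\<close>

definition wiener_step :: "(real \<Rightarrow> 'a \<Rightarrow> real) \<Rightarrow> real \<Rightarrow> (real \<Rightarrow> real) \<Rightarrow> ('a \<Rightarrow> real) \<Rightarrow> bool" where
  "wiener_step B T g I \<longleftrightarrow> (\<exists>m u c. strict_mono_on {..m} u \<and> 0 \<le> u 0 \<and> u m \<le> T \<and>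
     elementary_process m u (\<lambda>i _. c i) = (\<lambda>s (_::'a). g s) \<and> I = elementary_integral B m u (\<lambda>i _. c i))"

lemma wiener_stepE:
  assumes "wiener_step B T g I"
  obtains m u c where "strict_mono_on {..m} u" "0 \<le> u 0" "u m \<le> T" "u ` {..m} \<subseteq> {0..T}"
    "\<And>i. i < m \<Longrightarrow> u i \<le> u (Suc i)" "elementary_process m u (\<lambda>i _. c i) = (\<lambda>s (_::'a). g s)"
    "I = elementary_integral B m u (\<lambda>i (_::'a). c i)"
proof -
  obtain m u c where *: "strict_mono_on {..m} u" "0 \<le> u 0" "u m \<le> T"
    "elementary_process m u (\<lambda>i _. c i) = (\<lambda>s (_::'a). g s)" "I = elementary_integral B m u (\<lambda>i _. c i)"
    using assms unfolding wiener_step_def by blast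
  have "0 \<le> u i \<and> u i \<le> T" if "i \<le> m" for i
    using strict_mono_on_leD[OF *(1), of 0 i] strict_mono_on_leD[OF *(1), of i m] that * by auto
  then have "u ` {..m} \<subseteq> {0..T}" by auto
  moreover have "u i \<le> u (Suc i)" if "i < m" for i using strict_mono_on_leD[OF *(1), of i "Suc i"] that by auto
  ultimately show ?thesis using that[OF *(1-3) _ _ *(4,5)] by blast
qed

lemma wiener_step_mono:
  fixes B :: "real \<Rightarrow> 'a \<Rightarrow> real"
  shows "wiener_step B T g I \<Longrightarrow> T \<le> T' \<Longrightarrow> wiener_step B T' g I"
proof -
  assume "wiener_step B T g I" "T \<le> T'"
  then obtain m u c where u: "strict_mono_on {..m} u" "0 \<le> u 0" "u m \<le> T" "u ` {..m} \<subseteq> {0..T}"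
    "\<And>i. i < m \<Longrightarrow> u i \<le> u (Suc i)" "elementary_process m u (\<lambda>i _. c i) = (\<lambda>s (_::'a). g s)"
    "I = elementary_integral B m u (\<lambda>i (_::'a). c i)" using wiener_stepE by blast
  have "u m \<le> T'" using u(3) \<open>T \<le> T'\<close> by simp
  then show "wiener_step B T' g I" unfolding wiener_step_def using u(1,2,6,7) by blast
qed

lemma wiener_step_zero: "0 \<le> T \<Longrightarrow> wiener_step B T (\<lambda>_. 0) (\<lambda>_. 0)"
  unfolding wiener_step_def
  by (intro exI[of _ 0] exI[of _ "\<lambda>_. 0"]) (auto simp: strict_mono_on_def elementary_process_def elementary_integral_def fun_eq_iff)

lemma wiener_step_lincomb:
  fixes B :: "real \<Rightarrow> 'a \<Rightarrow> real"
  assumes 1: "wiener_step B T g I" and 2: "wiener_step B T g' I'"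
  shows "wiener_step B T (\<lambda>s. x * g s + y * g' s) (\<lambda>\<omega>. x * I \<omega> + y * I' \<omega>)"
proof -
  obtain m u c where u: "strict_mono_on {..m} u" "0 \<le> u 0" "u m \<le> T" "u ` {..m} \<subseteq> {0..T}"
    "\<And>i. i < m \<Longrightarrow> u i \<le> u (Suc i)" "elementary_process m u (\<lambda>i _. c i) = (\<lambda>s (_::'a). g s)"
    "I = elementary_integral B m u (\<lambda>i (_::'a). c i)" using wiener_stepE[OF 1] by blast
  obtain m' u' c' where u': "strict_mono_on {..m'} u'" "0 \<le> u' 0" "u' m' \<le> T" "u' ` {..m'} \<subseteq> {0..T}"
    "\<And>i. i < m' \<Longrightarrow> u' i \<le> u' (Suc i)" "elementary_process m' u' (\<lambda>i _. c' i) = (\<lambda>s (_::'a). g' s)"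
    "I' = elementary_integral B m' u' (\<lambda>i (_::'a). c' i)" using wiener_stepE[OF 2] by blast
  have "finite (u ` {..m} \<union> u' ` {..m'})" "u ` {..m} \<union> u' ` {..m'} \<noteq> {}" by auto
  then obtain N :: nat and p where p: "strict_mono_on {..N} p" "p ` {..N} = u ` {..m} \<union> u' ` {..m'}"
    by (rule finite_set_enumeration)
  have "p 0 \<in> p ` {..N}" "p N \<in> p ` {..N}" by auto
  then have p0: "0 \<le> p 0" "p N \<le> T" unfolding p(2) using u(4) u'(4) by auto
  have sub: "u ` {..m} \<subseteq> p ` {..N}" "u' ` {..m'} \<subseteq> p ` {..N}" unfolding p(2) by auto
  have ref: "g s = elementary_process N p (\<lambda>j _. g (p (Suc j))) s \<omega>" "g' s = elementary_process N p (\<lambda>j _. g' (p (Suc j))) s \<omega>"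
    "I \<omega> = elementary_integral B N p (\<lambda>j _. g (p (Suc j))) \<omega>" "I' \<omega> = elementary_integral B N p (\<lambda>j _. g' (p (Suc j))) \<omega>"
    for s and \<omega> :: 'a
    using elementary_process_refine[OF p(1) sub(1) u(5), of "\<lambda>i _. c i" s \<omega>]
      elementary_process_refine[OF p(1) sub(2) u'(5), of "\<lambda>i _. c' i" s \<omega>]
      elementary_integral_refine[OF p(1) sub(1) u(5), of B "\<lambda>i _. c i" \<omega>]
      elementary_integral_refine[OF p(1) sub(2) u'(5), of B "\<lambda>i _. c' i" \<omega>]
    unfolding u(6) u'(6) u(7) u'(7) by auto
  show ?thesis
    unfolding wiener_step_def
    by (intro exI[of _ N] exI[of _ p] exI[of _ "\<lambda>j. x * g (p (Suc j)) + y * g' (p (Suc j))"] conjI p(1) p0 ext)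
      (simp_all add: elementary_lincomb ref[symmetric])
qed

lemma wiener_step_sum:
  assumes "finite S" "\<And>j. j \<in> S \<Longrightarrow> wiener_step B T (g j) (I j)" "0 \<le> T"
  shows "wiener_step B T (\<lambda>s. \<Sum>j\<in>S. w j * g j s) (\<lambda>\<omega>. \<Sum>j\<in>S. w j * I j \<omega>)"
  using assms(1,2)
proof (induction S)
  case empty then show ?case using wiener_step_zero[OF assms(3)] by simp
next
  case (insert i S)
  have "wiener_step B T (\<lambda>s. w i * g i s + 1 * (\<Sum>j\<in>S. w j * g j s)) (\<lambda>\<omega>. w i * I i \<omega> + 1 * (\<Sum>j\<in>S. w j * I j \<omega>))"
    by (intro wiener_step_lincomb insert) auto
  then show ?case using insert.hyps by simp
qed

lemma wiener_step_measurable: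
  fixes B :: "real \<Rightarrow> 'a \<Rightarrow> real"
  assumes "wiener_step B T g I"
  shows "g \<in> borel_measurable borel" "integrable lborel (\<lambda>s. (g s)\<^sup>2)" "s \<notin> {0..T} \<Longrightarrow> g s = 0"
proof -
  obtain m u c where u: "strict_mono_on {..m} u" "u ` {..m} \<subseteq> {0..T}" "elementary_process m u (\<lambda>i _. c i) = (\<lambda>s (_::'a). g s)"
    using wiener_stepE[OF assms] by metis
  have "g = (\<lambda>s. \<Sum>i<m. c i * indicator {u i<..u (Suc i)} s)"
    using fun_cong[OF u(3)] unfolding elementary_process_def by metis
  also have "\<dots> \<in> borel_measurable borel" by measurable
  finally show "g \<in> borel_measurable borel" .
  show "integrable lborel (\<lambda>s. (g s)\<^sup>2)" 
    using integral_elementary_process_sq(1)[OF u(1), of "\<lambda>i (_::'a). c i" undefined] by (simp only: u(3))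
  assume s: "s \<notin> {0..T}"
  have "u 0 \<in> u ` {..m}" "u m \<in> u ` {..m}" by auto
  then have "u 0 \<in> {0..T}" "u m \<in> {0..T}" using u(2) by blast+
  then have "s \<notin> {u 0<..u m}" using s by auto
  from elementary_process_outside[OF u(1) this, of "\<lambda>i (_::'a). c i" undefined]
  show "g s = 0" by (simp only: u(3))
qed

lemma integrable_bounded_support:
  fixes f :: "real \<Rightarrow> real"
  assumes "f \<in> borel_measurable borel" "\<And>s. \<bar>f s\<bar> \<le> L * indicator {0..T} s"
  shows "integrable lborel f"
proof (rule Bochner_Integration.integrable_bound)
  show "integrable lborel (\<lambda>s. L * indicator {0..T} s :: real)"
    by (cases "0 \<le> T") auto
  show "AE s in lborel. norm (f s) \<le> norm (L * indicator {0..T} s :: real)"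
    using assms(2) by (auto intro!: AE_I2 order_trans[OF assms(2)] abs_ge_self simp del: abs_mult)
qed (use assms in auto)

lemma integral_tendsto_0_bounded_support:
  fixes f :: "nat \<Rightarrow> real \<Rightarrow> real"
  assumes "\<And>k. f k \<in> borel_measurable borel" "\<And>k s. \<bar>f k s\<bar> \<le> L * indicator {0..T} s"
    and "AE s in lborel. (\<lambda>k. f k s) \<longlonglongrightarrow> 0"
  shows "(\<lambda>k. \<integral>s. f k s \<partial>lborel) \<longlonglongrightarrow> 0"
proof -
  have "(\<lambda>k. \<integral>s. f k s \<partial>lborel) \<longlonglongrightarrow> (\<integral>s. 0 \<partial>(lborel :: real measure) :: real)"
  proof (rule integral_dominated_convergence[where w="\<lambda>s. L * indicator {0..T} s"])
    show "integrable lborel (\<lambda>s. L * indicator {0..T} s :: real)" by (cases "0 \<le> T") auto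
  qed (use assms in auto)
  then show ?thesis by simp
qed

text \<open>
  Three approximations in \<open>L\<^sup>2\<close>, each by dominated convergence: truncation, replacement by a
  continuous function, and sampling on a uniform grid.
\<close>

lemma step_functions_dense:
  fixes a :: "real \<Rightarrow> real" and B :: "real \<Rightarrow> 'a \<Rightarrow> real"
  assumes a[measurable]: "a \<in> borel_measurable borel" and a2: "integrable lborel (\<lambda>s. (a s)\<^sup>2)"
    and supp: "\<And>s. s \<notin> {0..T} \<Longrightarrow> a s = 0" and T: "0 \<le> T" and \<epsilon>: "\<epsilon> > 0"
  shows "\<exists>g I. wiener_step B T g I \<and> (\<integral>s. (a s - g s)\<^sup>2 \<partial>lborel) < \<epsilon>"
proof (cases "T = 0")
  case True
  have "AE s in lborel. (a s - 0)\<^sup>2 = 0" using AE_lborel_singleton[of 0]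
    by eventually_elim (use supp True in auto)
  then have "(\<integral>s. (a s - 0)\<^sup>2 \<partial>lborel) = 0" by (subst integral_cong_AE[where g="\<lambda>_. 0"]) auto
  then have "(\<integral>s. (a s - 0)\<^sup>2 \<partial>lborel) < \<epsilon>" using \<epsilon> by (simp only:)
  with wiener_step_zero[OF T, of B] show ?thesis by blast
next
  case False
  then have T: "T > 0" using T by simp
  define clip where "clip R y = max (- R) (min R y)" for R y :: real
  have clip_m[measurable]: "clip R \<in> borel_measurable borel" for R unfolding clip_def[abs_def] by measurable
  have clip_abs: "\<bar>clip R y\<bar> \<le> R" if "R \<ge> 0" for R y using that by (auto simp: clip_def)
  have clip_diff: "\<bar>y - clip R y\<bar> \<le> \<bar>y\<bar>" if "R \<ge> 0" for R y using that by (auto simp: clip_def)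
  have "(\<lambda>k. \<integral>s. (a s - clip (real k) (a s))\<^sup>2 \<partial>lborel) \<longlonglongrightarrow> (\<integral>s. 0 \<partial>(lborel :: real measure) :: real)"
  proof (rule integral_dominated_convergence[where w="\<lambda>s. (a s)\<^sup>2"])
    show "AE s in lborel. (\<lambda>k. (a s - clip (real k) (a s))\<^sup>2) \<longlonglongrightarrow> 0"
    proof (rule AE_I2, rule tendsto_eventually)
      fix s
      obtain k0 where "\<bar>a s\<bar> < real k0" using reals_Archimedean2 by blast
      then show "\<forall>\<^sub>F k in sequentially. (a s - clip (real k) (a s))\<^sup>2 = 0"
        unfolding eventually_sequentially by (intro exI[of _ k0]) (auto simp: clip_def)
    qed
    show "AE s in lborel. norm ((a s - clip (real k) (a s))\<^sup>2) \<le> (a s)\<^sup>2" for k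
      using clip_diff[of "real k"] by (auto intro!: AE_I2 simp: abs_le_square_iff)
  qed (use a2 in auto)
  then have "\<forall>\<^sub>F k in sequentially. (\<integral>s. (a s - clip (real k) (a s))\<^sup>2 \<partial>lborel) < \<epsilon> / 9"
    using \<epsilon> by (intro order_tendstoD) auto
  then obtain k where k: "(\<integral>s. (a s - clip (real k) (a s))\<^sup>2 \<partial>lborel) < \<epsilon> / 9"
    by (meson eventually_happens sequentially_bot)
  define R where "R = real k"
  define a1 where "a1 s = clip R (a s)" for s
  have R: "R \<ge> 0" by (simp add: R_def)
  have [measurable]: "a1 \<in> borel_measurable borel" unfolding a1_def[abs_def] by measurable
  have a1_supp: "a1 s = 0" if "s \<notin> {0..T}" for s using supp[OF that] R by (simp add: a1_def clip_def)
  have a1_int: "(\<integral>s. (a s - a1 s)\<^sup>2 \<partial>lborel) < \<epsilon> / 9" using k by (simp add: a1_def R_def)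
  have d1: "integrable lborel (\<lambda>s. (a s - a1 s)\<^sup>2)"
  proof (rule Bochner_Integration.integrable_bound[OF a2])
    show "AE s in lborel. norm ((a s - a1 s)\<^sup>2) \<le> norm ((a s)\<^sup>2)"
      using clip_diff[OF R] by (auto intro!: AE_I2 simp: abs_le_square_iff a1_def)
  qed measurable
  have "a1 measurable_on {0..T}"
    by (rule lebesgue_measurable_imp_measurable_on) (auto intro: measurable_completion)
  then obtain Ng g where g: "negligible Ng" "\<And>n. continuous_on UNIV (g n)"
    "\<And>s. s \<notin> Ng \<Longrightarrow> (\<lambda>n. g n s) \<longlonglongrightarrow> (if s \<in> {0..T} then a1 s else 0)"
    unfolding measurable_on_def by blast
  define c where "c n s = clip R (g n s)" for n s
  have c_cont: "continuous_on UNIV (c n)" for n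
    unfolding c_def clip_def by (intro continuous_intros g)
  have [measurable]: "c n \<in> borel_measurable borel" for n
    using c_cont by (rule borel_measurable_continuous_onI)
  have c_abs: "\<bar>c n s\<bar> \<le> R" "\<bar>a1 s\<bar> \<le> R" for n s unfolding c_def a1_def by (rule clip_abs[OF R])+
  have diff_sq: "(y - z)\<^sup>2 \<le> (2 * R)\<^sup>2" if "\<bar>y\<bar> \<le> R" "\<bar>z\<bar> \<le> R" for y z
  proof -
    have "\<bar>y - z\<bar> \<le> \<bar>2 * R\<bar>" using that by linarith
    then show ?thesis by (simp only: abs_le_square_iff)
  qed
  let ?e = "\<lambda>n s. indicator {0..T} s * (a1 s - c n s)\<^sup>2"
  have "AE s in lebesgue. s \<notin> Ng"
    using g(1) unfolding negligible_iff_null_sets by (rule AE_not_in)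
  then have Ng: "AE s in lborel. s \<notin> Ng" by (simp only: AE_completion_iff)
  have "(\<lambda>n. \<integral>s. ?e n s \<partial>lborel) \<longlonglongrightarrow> 0"
  proof (rule integral_tendsto_0_bounded_support)
    show "\<bar>?e n s\<bar> \<le> (2 * R)\<^sup>2 * indicator {0..T} s" for n s
      using diff_sq[OF c_abs(2) c_abs(1), of s n s] by (auto simp: indicator_def)
    show "AE s in lborel. (\<lambda>n. ?e n s) \<longlonglongrightarrow> 0"
      using Ng
    proof eventually_elim
      case (elim s)
      have "(if s \<in> {0..T} then a1 s else 0) = a1 s" using a1_supp by auto
      then have "(\<lambda>n. g n s) \<longlonglongrightarrow> a1 s" using g(3)[OF elim] by simp
      then have "(\<lambda>n. c n s) \<longlonglongrightarrow> clip R (a1 s)" unfolding c_def clip_def by (intro tendsto_intros)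
      also have "clip R (a1 s) = a1 s" using c_abs(2)[of s] by (auto simp: clip_def abs_le_iff)
      finally have "(\<lambda>n. ?e n s) \<longlonglongrightarrow> indicator {0..T} s * (a1 s - a1 s)\<^sup>2" by (intro tendsto_intros)
      then show ?case by simp
    qed
  qed measurable
  then have "\<forall>\<^sub>F n in sequentially. (\<integral>s. ?e n s \<partial>lborel) < \<epsilon> / 9"
    using \<epsilon> by (intro order_tendstoD) auto
  then obtain n where n: "(\<integral>s. ?e n s \<partial>lborel) < \<epsilon> / 9"
    by (meson eventually_happens sequentially_bot)
  define u where "u k i = T * real i / real (Suc k)" for k i
  define st where "st k s = elementary_process (Suc k) (u k) (\<lambda>i _. c n (u k i)) s (undefined :: 'a)" for k s
  have u_mono: "strict_mono_on {..Suc k} (u k)" for k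
    unfolding u_def strict_mono_on_def using T by (auto simp: divide_strict_right_mono mult_strict_left_mono)
  have u_ends: "u k 0 = 0" "u k (Suc k) = T" for k by (auto simp: u_def)
  have st_eq: "elementary_process (Suc k) (u k) (\<lambda>i _. c n (u k i)) = (\<lambda>s (_ :: 'a). st k s)" for k
    unfolding st_def elementary_process_def by simp
  have st_w: "wiener_step B T (st k) (elementary_integral B (Suc k) (u k) (\<lambda>i _. c n (u k i)))" for k
    unfolding wiener_step_def
    by (intro exI[of _ "Suc k"] exI[of _ "u k"] exI[of _ "\<lambda>i. c n (u k i)"] conjI u_mono st_eq refl) (auto simp: u_ends)
  have [measurable]: "st k \<in> borel_measurable borel" for k using wiener_step_measurable(1)[OF st_w] .
  have st_cell: "st k s = c n (u k j)" if "j < Suc k" "s \<in> {u k j<..u k (Suc j)}" for k j s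
    unfolding st_def by (rule elementary_process_cell[OF u_mono that])
  have st_abs: "\<bar>st k s\<bar> \<le> R" for k s
  proof (cases "s \<in> {u k 0<..u k (Suc k)}")
    case True
    then obtain j where "j < Suc k" "s \<in> {u k j<..u k (Suc j)}" by (rule partition_cell)
    then show ?thesis using st_cell c_abs(1) by simp
  next
    case False
    then have "st k s = 0" unfolding st_def by (rule elementary_process_outside[OF u_mono])
    then show ?thesis using R by simp
  qed
  let ?f = "\<lambda>k s. indicator {0..T} s * (c n s - st k s)\<^sup>2"
  have "(\<lambda>k. \<integral>s. ?f k s \<partial>lborel) \<longlonglongrightarrow> 0"
  proof (rule integral_tendsto_0_bounded_support)
    show "\<bar>?f k s\<bar> \<le> (2 * R)\<^sup>2 * indicator {0..T} s" for k s
      using diff_sq[OF c_abs(1) st_abs, of n s k s] by (auto simp: indicator_def)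
    show "AE s in lborel. (\<lambda>k. ?f k s) \<longlonglongrightarrow> 0"
      using AE_lborel_singleton[of 0]
    proof eventually_elim
      case (elim s)
      show ?case
      proof (cases "s \<in> {0..T}")
        case True
        then have s: "0 < s" "s \<le> T" using elim by auto
        have "(\<lambda>k. st k s) \<longlonglongrightarrow> c n s"
        proof (rule LIMSEQ_I)
          fix e :: real assume "e > 0"
          then have "\<exists>\<delta>>0. \<forall>y. \<bar>y - s\<bar> < \<delta> \<longrightarrow> \<bar>c n y - c n s\<bar> < e"
            using c_cont[of n] by (simp add: continuous_on_iff dist_real_def)
          then obtain \<delta> where \<delta>: "\<delta> > 0" "\<And>y. \<bar>y - s\<bar> < \<delta> \<Longrightarrow> \<bar>c n y - c n s\<bar> < e" by blast
          obtain k0 where k0: "T / \<delta> < real k0" using reals_Archimedean2 by blast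
          have "norm (st k s - c n s) < e" if "k \<ge> k0" for k
          proof -
            have "s \<in> {u k 0<..u k (Suc k)}" using s u_ends by auto
            then obtain j where j: "j < Suc k" "s \<in> {u k j<..u k (Suc j)}" by (rule partition_cell)
            have "T / \<delta> < real (Suc k)" using k0 that by simp
            then have "T / real (Suc k) < \<delta>" using \<delta>(1) by (simp add: field_simps)
            moreover have "u k (Suc j) - u k j = T / real (Suc k)"
              unfolding u_def by (simp add: diff_divide_distrib[symmetric] algebra_simps)
            ultimately have "\<bar>u k j - s\<bar> < \<delta>" using j by auto
            then show ?thesis using \<delta>(2) st_cell[OF j] by simp
          qed
          then show "\<exists>k0. \<forall>k\<ge>k0. norm (st k s - c n s) < e" by blast
        qed
        then have "(\<lambda>k. ?f k s) \<longlonglongrightarrow> indicator {0..T} s * (c n s - c n s)\<^sup>2" by (intro tendsto_intros)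
        then show ?thesis by simp
      qed simp
    qed
  qed measurable
  then have "\<forall>\<^sub>F k in sequentially. (\<integral>s. ?f k s \<partial>lborel) < \<epsilon> / 9"
    using \<epsilon> by (intro order_tendstoD) auto
  then obtain l where l: "(\<integral>s. ?f l s \<partial>lborel) < \<epsilon> / 9"
    by (meson eventually_happens sequentially_bot)
  have d2: "integrable lborel (?e n)"
    by (rule integrable_bounded_support[of _ "(2 * R)\<^sup>2" T])
      (use diff_sq[OF c_abs(2) c_abs(1)] in \<open>auto simp: indicator_def\<close>)
  have d3: "integrable lborel (?f l)"
    by (rule integrable_bounded_support[of _ "(2 * R)\<^sup>2" T])
      (use diff_sq[OF c_abs(1) st_abs] in \<open>auto simp: indicator_def\<close>)
  have "(\<integral>s. (a s - st l s)\<^sup>2 \<partial>lborel) \<le> (\<integral>s. 3 * ((a s - a1 s)\<^sup>2 + ?e n s + ?f l s) \<partial>lborel)"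
  proof (rule integral_mono)
    show "integrable lborel (\<lambda>s. (a s - st l s)\<^sup>2)"
      by (rule integrable_diff_power2) (use a2 wiener_step_measurable(2)[OF st_w] in auto)
    show "integrable lborel (\<lambda>s. 3 * ((a s - a1 s)\<^sup>2 + ?e n s + ?f l s))"
      by (intro integrable_mult_right Bochner_Integration.integrable_add d1 d2 d3)
    fix s
    show "(a s - st l s)\<^sup>2 \<le> 3 * ((a s - a1 s)\<^sup>2 + ?e n s + ?f l s)"
    proof (cases "s \<in> {0..T}")
      case True
      have "(x + y + z)\<^sup>2 \<le> 3 * (x\<^sup>2 + y\<^sup>2 + z\<^sup>2)" for x y z :: real
      proof -
        have "0 \<le> (x - y)\<^sup>2 + (y - z)\<^sup>2 + (x - z)\<^sup>2" by simp
        then show ?thesis by (simp add: power2_eq_square algebra_simps)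
      qed
      from this[of "a s - a1 s" "a1 s - c n s" "c n s - st l s"] show ?thesis using True by simp
    next
      case False
      then show ?thesis using supp wiener_step_measurable(3)[OF st_w] a1_supp by simp
    qed
  qed
  also have "\<dots> = 3 * ((\<integral>s. (a s - a1 s)\<^sup>2 \<partial>lborel) + (\<integral>s. ?e n s \<partial>lborel) + (\<integral>s. ?f l s \<partial>lborel))"
    using d1 d2 d3 by simp
  also have "\<dots> < \<epsilon>" using a1_int n l by simp
  finally show ?thesis using st_w by blast
qed


lemma (in prob_space) expectation_abs_le_sqrt:
  assumes Y[measurable]: "Y \<in> borel_measurable M" and b: "(\<integral>\<^sup>+\<omega>. ennreal ((Y \<omega>)\<^sup>2) \<partial>M) \<le> ennreal v" and v: "v \<ge> 0"
  shows "integrable M Y" "expectation (\<lambda>\<omega>. \<bar>Y \<omega>\<bar>) \<le> sqrt v"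
proof -
  have Y2: "integrable M (\<lambda>\<omega>. (Y \<omega>)\<^sup>2)"
    by (rule integrableI_bounded) (use order_le_less_trans[OF b] in auto)
  then show Y1: "integrable M Y" by (rule square_integrable_imp_integrable[rotated]) simp
  have "ennreal (expectation (\<lambda>\<omega>. (Y \<omega>)\<^sup>2)) \<le> ennreal v"
    using b nn_integral_eq_integral[OF Y2] by simp
  then have "expectation (\<lambda>\<omega>. (Y \<omega>)\<^sup>2) \<le> v" using v by simp
  moreover have "0 \<le> expectation (\<lambda>\<omega>. (\<bar>Y \<omega>\<bar> - expectation (\<lambda>\<omega>. \<bar>Y \<omega>\<bar>))\<^sup>2)" by simp
  moreover have "expectation (\<lambda>\<omega>. (\<bar>Y \<omega>\<bar> - expectation (\<lambda>\<omega>. \<bar>Y \<omega>\<bar>))\<^sup>2)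
      = expectation (\<lambda>\<omega>. (Y \<omega>)\<^sup>2) - (expectation (\<lambda>\<omega>. \<bar>Y \<omega>\<bar>))\<^sup>2"
    using Y1 Y2 variance_eq[of "\<lambda>\<omega>. \<bar>Y \<omega>\<bar>"] by simp
  ultimately have "(expectation (\<lambda>\<omega>. \<bar>Y \<omega>\<bar>))\<^sup>2 \<le> v" by simp
  then show "expectation (\<lambda>\<omega>. \<bar>Y \<omega>\<bar>) \<le> sqrt v" by (rule real_le_rsqrt)
qed

lemma abs_cos_diff_le: "\<bar>cos x - cos y\<bar> \<le> \<bar>x - y\<bar>" for x y :: real
proof -
  have "\<bar>cos x - cos y\<bar> = 2 * (\<bar>sin ((x + y) / 2)\<bar> * \<bar>sin ((y - x) / 2)\<bar>)"
    unfolding cos_diff_cos by (simp add: abs_mult)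
  also have "\<dots> \<le> 2 * (1 * \<bar>(y - x) / 2\<bar>)"
    by (intro mult_left_mono mult_mono abs_sin_x_le_abs_x abs_sin_le_one) auto
  finally show ?thesis by simp
qed

lemma two_ennreal: "0 \<le> x \<Longrightarrow> 2 * ennreal x = ennreal (2 * x)"
  by (simp add: ennreal_mult)

lemma ennreal_square_add_le:
  "ennreal ((a + b)\<^sup>2) \<le> 2 * ennreal (a\<^sup>2) + 2 * ennreal (b\<^sup>2)"
proof -
  have "(a + b)\<^sup>2 \<le> 2 * a\<^sup>2 + 2 * b\<^sup>2" using sum_squares_bound[of a b] by (simp add: power2_sum)
  then have "ennreal ((a + b)\<^sup>2) \<le> ennreal (2 * a\<^sup>2 + 2 * b\<^sup>2)" by (rule ennreal_leI)
  also have "\<dots> = 2 * ennreal (a\<^sup>2) + 2 * ennreal (b\<^sup>2)" by (simp add: ennreal_mult ennreal_plus)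
  finally show ?thesis .
qed

text \<open>
  The random variable \<open>R\<close> is, up to a mean square error of order \<open>\<rho>\<close>, the Wiener integral of \<open>a\<close>
  over \<open>[0, T]\<close>. Quantifying over step functions near \<open>a\<close> avoids constructing the Wiener integral itself,
  and the notion passes to linear combinations, which is all that is needed for finite-dimensional laws.
\<close>

definition wiener_approx ::
  "'a measure \<Rightarrow> (real \<Rightarrow> 'a \<Rightarrow> real) \<Rightarrow> real \<Rightarrow> real \<Rightarrow> ('a \<Rightarrow> real) \<Rightarrow> (real \<Rightarrow> real) \<Rightarrow> bool" where
  "wiener_approx M B T \<rho> R a \<longleftrightarrow>
     a \<in> borel_measurable borel \<and> integrable lborel (\<lambda>s. (a s)\<^sup>2) \<and> R \<in> borel_measurable M \<and>
     (\<forall>\<epsilon>>0. \<exists>g I. wiener_step B T g I \<and> (\<integral>s. (a s - g s)\<^sup>2 \<partial>lborel) \<le> \<epsilon> \<and>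
       (\<integral>\<^sup>+\<omega>. ennreal ((R \<omega> - I \<omega>)\<^sup>2) \<partial>M) \<le> ennreal (\<rho> + \<epsilon>))"

context brownian
begin

lemma wiener_step_integral_measurable:
  assumes "wiener_step B T g I" shows "I \<in> borel_measurable M"
proof -
  obtain m u c where u: "u ` {..m} \<subseteq> {0..T}" and i: "I = elementary_integral B m u (\<lambda>i (_::'a). c i)"
    using wiener_stepE[OF assms] by metis
  have "u i \<ge> 0" if "i \<le> m" for i using u that by auto
  then show ?thesis unfolding i elementary_integral_def[abs_def]
    by (intro borel_measurable_sum borel_measurable_times borel_measurable_diff borel_measurable_const B_measurable) auto
qed

lemma wiener_step_expectation_cos:
  assumes "wiener_step B T g I"
  shows "expectation (\<lambda>\<omega>. cos (I \<omega> + c)) = cos c * exp (- (\<integral>s. (g s)\<^sup>2 \<partial>lborel) / 2)"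
proof -
  obtain m u d where u: "strict_mono_on {..m} u" "0 \<le> u 0" "\<And>i. i < m \<Longrightarrow> u i \<le> u (Suc i)"
    "elementary_process m u (\<lambda>i _. d i) = (\<lambda>s (_::'a). g s)" "I = elementary_integral B m u (\<lambda>i (_::'a). d i)"
    using wiener_stepE[OF assms] by metis
  have "(\<integral>s. (elementary_process m u (\<lambda>i (_::'a). d i) s undefined)\<^sup>2 \<partial>lborel) = (\<Sum>i<m. (d i)\<^sup>2 * (u (Suc i) - u i))"
    by (rule integral_elementary_process_sq(2)[OF u(1)])
  then show ?thesis using elementary_integral_expectation_cos[OF u(2,3), of m d c] by (simp only: u(4,5))
qed

text \<open>
  Exact for step functions, and the cosine is Lipschitz, so the error is controlled by the first
  moment of the difference.
\<close>

theorem wiener_approx_expectation_cos: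
  assumes w: "wiener_approx M B T \<rho> R a" and \<rho>: "\<rho> \<ge> 0"
  shows "\<bar>expectation (\<lambda>\<omega>. cos (R \<omega> + c)) - cos c * exp (- (\<integral>s. (a s)\<^sup>2 \<partial>lborel) / 2)\<bar> \<le> sqrt \<rho>"
proof -
  have a[measurable]: "a \<in> borel_measurable borel" and a2: "integrable lborel (\<lambda>s. (a s)\<^sup>2)" and R[measurable]: "R \<in> borel_measurable M"
    using w by (auto simp: wiener_approx_def)
  define \<epsilon> where "\<epsilon> k = inverse (real (Suc k))" for k
  have "\<forall>k. \<exists>gI. wiener_step B T (fst gI) (snd gI) \<and> (\<integral>s. (a s - fst gI s)\<^sup>2 \<partial>lborel) \<le> \<epsilon> k \<and>
       (\<integral>\<^sup>+\<omega>. ennreal ((R \<omega> - snd gI \<omega>)\<^sup>2) \<partial>M) \<le> ennreal (\<rho> + \<epsilon> k)"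
  proof
    fix k
    have "\<epsilon> k > 0" by (simp add: \<epsilon>_def)
    then obtain g I where "wiener_step B T g I \<and> (\<integral>s. (a s - g s)\<^sup>2 \<partial>lborel) \<le> \<epsilon> k \<and>
       (\<integral>\<^sup>+\<omega>. ennreal ((R \<omega> - I \<omega>)\<^sup>2) \<partial>M) \<le> ennreal (\<rho> + \<epsilon> k)"
      using w unfolding wiener_approx_def by blast
    then show "\<exists>gI. wiener_step B T (fst gI) (snd gI) \<and> (\<integral>s. (a s - fst gI s)\<^sup>2 \<partial>lborel) \<le> \<epsilon> k \<and>
       (\<integral>\<^sup>+\<omega>. ennreal ((R \<omega> - snd gI \<omega>)\<^sup>2) \<partial>M) \<le> ennreal (\<rho> + \<epsilon> k)" by (intro exI[of _ "(g, I)"]) simp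
  qed
  from choice[OF this] obtain gI where gI: "\<And>k. wiener_step B T (fst (gI k)) (snd (gI k))" "\<And>k. (\<integral>s. (a s - fst (gI k) s)\<^sup>2 \<partial>lborel) \<le> \<epsilon> k"
    "\<And>k. (\<integral>\<^sup>+\<omega>. ennreal ((R \<omega> - snd (gI k) \<omega>)\<^sup>2) \<partial>M) \<le> ennreal (\<rho> + \<epsilon> k)"
    by blast
  define g where "g k = fst (gI k)" for k
  define I where "I k = snd (gI k)" for k
  note gI = gI[folded g_def I_def]
  have \<epsilon>: "\<epsilon> \<longlonglongrightarrow> 0" "\<epsilon> k \<ge> 0" for k unfolding \<epsilon>_def using LIMSEQ_inverse_real_of_nat by auto
  have [measurable]: "g k \<in> borel_measurable borel" "I k \<in> borel_measurable M" for k
    using wiener_step_measurable(1)[OF gI(1)] wiener_step_integral_measurable[OF gI(1)] by auto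
  have d: "integrable lborel (\<lambda>s. (g k s - a s)\<^sup>2)" for k
    using integrable_diff_power2[OF _ _ wiener_step_measurable(2)[OF gI(1)] a2] by auto
  have "(\<lambda>k. \<integral>s. (g k s - a s)\<^sup>2 \<partial>lborel) \<longlonglongrightarrow> 0"
  proof (rule tendsto_sandwich[OF _ _ tendsto_const \<epsilon>(1)])
    show "\<forall>\<^sub>F k in sequentially. (\<integral>s. (g k s - a s)\<^sup>2 \<partial>lborel) \<le> \<epsilon> k"
      using gI(2) by (simp add: power2_commute)
  qed simp
  then have glim: "(\<lambda>k. \<integral>s. (g k s)\<^sup>2 \<partial>lborel) \<longlonglongrightarrow> (\<integral>s. (a s)\<^sup>2 \<partial>lborel)"
    by (intro L2_tendsto a2 d) auto
  have bnd: "\<bar>expectation (\<lambda>\<omega>. cos (R \<omega> + c)) - cos c * exp (- (\<integral>s. (g k s)\<^sup>2 \<partial>lborel) / 2)\<bar> \<le> sqrt (\<rho> + \<epsilon> k)" for k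
  proof -
    have e: "integrable M (\<lambda>\<omega>. R \<omega> - I k \<omega>)" "expectation (\<lambda>\<omega>. \<bar>R \<omega> - I k \<omega>\<bar>) \<le> sqrt (\<rho> + \<epsilon> k)"
      using expectation_abs_le_sqrt[OF _ gI(3)] \<rho> \<epsilon>(2)[of k] by auto
    have i: "integrable M (\<lambda>\<omega>. cos (R \<omega> + c))" "integrable M (\<lambda>\<omega>. cos (I k \<omega> + c))"
      by (auto intro!: integrable_bounded[of _ 1])
    have "\<bar>expectation (\<lambda>\<omega>. cos (R \<omega> + c)) - expectation (\<lambda>\<omega>. cos (I k \<omega> + c))\<bar>
       = \<bar>expectation (\<lambda>\<omega>. cos (R \<omega> + c) - cos (I k \<omega> + c))\<bar>" using i by simp
    also have "\<dots> \<le> expectation (\<lambda>\<omega>. \<bar>cos (R \<omega> + c) - cos (I k \<omega> + c)\<bar>)" by (rule integral_abs_bound)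
    also have "\<dots> \<le> expectation (\<lambda>\<omega>. \<bar>R \<omega> - I k \<omega>\<bar>)"
    proof (rule integral_mono)
      fix \<omega>
      show "\<bar>cos (R \<omega> + c) - cos (I k \<omega> + c)\<bar> \<le> \<bar>R \<omega> - I k \<omega>\<bar>"
        using abs_cos_diff_le[of "R \<omega> + c" "I k \<omega> + c"] by simp
    qed (use i e in auto)
    finally show ?thesis using e(2) wiener_step_expectation_cos[OF gI(1)] by simp
  qed
  show ?thesis
  proof (rule LIMSEQ_le)
    show "(\<lambda>k. \<bar>expectation (\<lambda>\<omega>. cos (R \<omega> + c)) - cos c * exp (- (\<integral>s. (g k s)\<^sup>2 \<partial>lborel) / 2)\<bar>)
      \<longlonglongrightarrow> \<bar>expectation (\<lambda>\<omega>. cos (R \<omega> + c)) - cos c * exp (- (\<integral>s. (a s)\<^sup>2 \<partial>lborel) / 2)\<bar>"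
      by (intro tendsto_intros glim) simp
    have "(\<lambda>k. sqrt (\<rho> + \<epsilon> k)) \<longlonglongrightarrow> sqrt (\<rho> + 0)" by (intro tendsto_intros \<epsilon>)
    then show "(\<lambda>k. sqrt (\<rho> + \<epsilon> k)) \<longlonglongrightarrow> sqrt \<rho>" by simp
  qed (use bnd in auto)
qed

lemma wiener_approx_perturb:
  assumes w: "wiener_approx M B T \<rho> R a" and R'[measurable]: "R' \<in> borel_measurable M"
    and b: "(\<integral>\<^sup>+\<omega>. ennreal ((R' \<omega> - R \<omega>)\<^sup>2) \<partial>M) \<le> ennreal v" and "v \<ge> 0" "\<rho> \<ge> 0"
  shows "wiener_approx M B T (2 * v + 2 * \<rho>) R' a"
  unfolding wiener_approx_def
proof (intro conjI allI impI)
  show "a \<in> borel_measurable borel" "integrable lborel (\<lambda>s. (a s)\<^sup>2)" "R' \<in> borel_measurable M"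
    using w by (auto simp: wiener_approx_def)
  have [measurable]: "R \<in> borel_measurable M" using w by (auto simp: wiener_approx_def)
  fix \<epsilon> :: real assume \<epsilon>: "\<epsilon> > 0"
  then have "\<epsilon> / 2 > 0" by simp
  then obtain g I where g: "wiener_step B T g I" "(\<integral>s. (a s - g s)\<^sup>2 \<partial>lborel) \<le> \<epsilon> / 2"
    "(\<integral>\<^sup>+\<omega>. ennreal ((R \<omega> - I \<omega>)\<^sup>2) \<partial>M) \<le> ennreal (\<rho> + \<epsilon> / 2)"
    using w unfolding wiener_approx_def by blast
  have [measurable]: "I \<in> borel_measurable M" by (rule wiener_step_integral_measurable[OF g(1)])
  have "(\<integral>\<^sup>+\<omega>. ennreal ((R' \<omega> - I \<omega>)\<^sup>2) \<partial>M)
      \<le> (\<integral>\<^sup>+\<omega>. 2 * ennreal ((R' \<omega> - R \<omega>)\<^sup>2) + 2 * ennreal ((R \<omega> - I \<omega>)\<^sup>2) \<partial>M)"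
  proof (rule nn_integral_mono)
    fix \<omega> show "ennreal ((R' \<omega> - I \<omega>)\<^sup>2) \<le> 2 * ennreal ((R' \<omega> - R \<omega>)\<^sup>2) + 2 * ennreal ((R \<omega> - I \<omega>)\<^sup>2)"
      using ennreal_square_add_le[of "R' \<omega> - R \<omega>" "R \<omega> - I \<omega>"] by simp
  qed
  also have "\<dots> = 2 * (\<integral>\<^sup>+\<omega>. ennreal ((R' \<omega> - R \<omega>)\<^sup>2) \<partial>M) + 2 * (\<integral>\<^sup>+\<omega>. ennreal ((R \<omega> - I \<omega>)\<^sup>2) \<partial>M)"
    by (subst nn_integral_add) (auto simp: nn_integral_cmult)
  also have "\<dots> \<le> 2 * ennreal v + 2 * ennreal (\<rho> + \<epsilon> / 2)" by (intro add_mono mult_left_mono b g) auto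
  also have "\<dots> = ennreal (2 * v + 2 * \<rho> + \<epsilon>)"
    using \<open>v \<ge> 0\<close> \<open>\<rho> \<ge> 0\<close> \<epsilon> by (simp add: two_ennreal ennreal_plus[symmetric] del: ennreal_plus)
  finally show "\<exists>g I. wiener_step B T g I \<and> (\<integral>s. (a s - g s)\<^sup>2 \<partial>lborel) \<le> \<epsilon> \<and>
      (\<integral>\<^sup>+\<omega>. ennreal ((R' \<omega> - I \<omega>)\<^sup>2) \<partial>M) \<le> ennreal (2 * v + 2 * \<rho> + \<epsilon>)"
    using g \<epsilon> by (intro exI[of _ g] exI[of _ I]) auto
qed

lemma wiener_approx_sum:
  fixes w :: "'i \<Rightarrow> real"
  assumes S: "finite S" and T: "0 \<le> T" and \<rho>: "0 \<le> \<rho>" and A: "\<And>j. j \<in> S \<Longrightarrow> wiener_approx M B T \<rho> (R j) (a j)"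
  shows "wiener_approx M B T ((\<Sum>j\<in>S. (w j)\<^sup>2) * card S * \<rho>) (\<lambda>\<omega>. \<Sum>j\<in>S. w j * R j \<omega>) (\<lambda>s. \<Sum>j\<in>S. w j * a j s)"
  unfolding wiener_approx_def
proof (intro conjI allI impI)
  have m: "a j \<in> borel_measurable borel" "integrable lborel (\<lambda>s. (a j s)\<^sup>2)" "R j \<in> borel_measurable M" if "j \<in> S" for j
    using A[OF that] by (auto simp: wiener_approx_def)
  have sq: "(\<Sum>j\<in>S. w j * x j)\<^sup>2 \<le> (\<Sum>j\<in>S. (w j)\<^sup>2 * (x j)\<^sup>2) * card S" for x
    using sum_squared_le_sum_of_squares[of "\<lambda>j. w j * x j" S] by (simp add: power_mult_distrib)
  show am: "(\<lambda>s. \<Sum>j\<in>S. w j * a j s) \<in> borel_measurable borel" using m by auto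
  show "(\<lambda>\<omega>. \<Sum>j\<in>S. w j * R j \<omega>) \<in> borel_measurable M" using m by auto
  have i: "integrable lborel (\<lambda>s. (\<Sum>j\<in>S. (w j)\<^sup>2 * (f j s)\<^sup>2) * card S)"
    if "\<And>j. j \<in> S \<Longrightarrow> integrable lborel (\<lambda>s. (f j s)\<^sup>2)" for f
    using that by (intro integrable_mult_left Bochner_Integration.integrable_sum integrable_mult_right)
  show "integrable lborel (\<lambda>s. (\<Sum>j\<in>S. w j * a j s)\<^sup>2)"
  proof (rule Bochner_Integration.integrable_bound[OF i[of a]])
    show "AE s in lborel. norm ((\<Sum>j\<in>S. w j * a j s)\<^sup>2) \<le> norm ((\<Sum>j\<in>S. (w j)\<^sup>2 * (a j s)\<^sup>2) * card S)"
      using sq by (auto intro!: AE_I2 order_trans[OF sq] abs_ge_self simp del: abs_mult)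
  qed (use m am in auto)
  fix \<epsilon> :: real assume \<epsilon>: "\<epsilon> > 0"
  define W where "W = (\<Sum>j\<in>S. (w j)\<^sup>2) * card S"
  have W: "W \<ge> 0" unfolding W_def by (auto intro!: mult_nonneg_nonneg sum_nonneg)
  define \<delta> where "\<delta> = \<epsilon> / (W + 1)"
  have \<delta>: "\<delta> > 0" "W * \<delta> \<le> \<epsilon>" using W \<epsilon> by (auto simp: \<delta>_def field_simps)
  have "\<forall>j\<in>S. \<exists>gI. wiener_step B T (fst gI) (snd gI) \<and> (\<integral>s. (a j s - fst gI s)\<^sup>2 \<partial>lborel) \<le> \<delta> \<and>
       (\<integral>\<^sup>+\<omega>. ennreal ((R j \<omega> - snd gI \<omega>)\<^sup>2) \<partial>M) \<le> ennreal (\<rho> + \<delta>)"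
  proof
    fix j assume "j \<in> S"
    then obtain g I where "wiener_step B T g I \<and> (\<integral>s. (a j s - g s)\<^sup>2 \<partial>lborel) \<le> \<delta> \<and>
       (\<integral>\<^sup>+\<omega>. ennreal ((R j \<omega> - I \<omega>)\<^sup>2) \<partial>M) \<le> ennreal (\<rho> + \<delta>)"
      using A \<delta> unfolding wiener_approx_def by blast
    then show "\<exists>gI. wiener_step B T (fst gI) (snd gI) \<and> (\<integral>s. (a j s - fst gI s)\<^sup>2 \<partial>lborel) \<le> \<delta> \<and>
       (\<integral>\<^sup>+\<omega>. ennreal ((R j \<omega> - snd gI \<omega>)\<^sup>2) \<partial>M) \<le> ennreal (\<rho> + \<delta>)" by (intro exI[of _ "(g, I)"]) simp
  qed
  from bchoice[OF this] obtain gI where gI: "\<And>j. j \<in> S \<Longrightarrow> wiener_step B T (fst (gI j)) (snd (gI j))"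
    "\<And>j. j \<in> S \<Longrightarrow> (\<integral>s. (a j s - fst (gI j) s)\<^sup>2 \<partial>lborel) \<le> \<delta>"
    "\<And>j. j \<in> S \<Longrightarrow> (\<integral>\<^sup>+\<omega>. ennreal ((R j \<omega> - snd (gI j) \<omega>)\<^sup>2) \<partial>M) \<le> ennreal (\<rho> + \<delta>)"
    by blast
  define g where "g j = fst (gI j)" for j
  define I where "I j = snd (gI j)" for j
  note gI = gI[folded g_def I_def]
  have gm: "g j \<in> borel_measurable borel" "integrable lborel (\<lambda>s. (g j s)\<^sup>2)" "I j \<in> borel_measurable M" if "j \<in> S" for j
    using wiener_step_measurable(1,2)[OF gI(1)[OF that]] wiener_step_integral_measurable[OF gI(1)[OF that]] by auto
  have d: "integrable lborel (\<lambda>s. (a j s - g j s)\<^sup>2)" if "j \<in> S" for j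
    by (rule integrable_diff_power2) (use m gm that in auto)
  have st: "wiener_step B T (\<lambda>s. \<Sum>j\<in>S. w j * g j s) (\<lambda>\<omega>. \<Sum>j\<in>S. w j * I j \<omega>)"
    by (rule wiener_step_sum[OF S gI(1) T])
  have "(\<integral>s. ((\<Sum>j\<in>S. w j * a j s) - (\<Sum>j\<in>S. w j * g j s))\<^sup>2 \<partial>lborel)
      \<le> (\<integral>s. (\<Sum>j\<in>S. (w j)\<^sup>2 * (a j s - g j s)\<^sup>2) * card S \<partial>lborel)"
  proof (rule integral_mono')
    show "integrable lborel (\<lambda>s. (\<Sum>j\<in>S. (w j)\<^sup>2 * (a j s - g j s)\<^sup>2) * card S)" by (rule i[OF d])
    fix s
    have "(\<Sum>j\<in>S. w j * a j s) - (\<Sum>j\<in>S. w j * g j s) = (\<Sum>j\<in>S. w j * (a j s - g j s))"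
      by (simp only: sum_subtractf[symmetric] right_diff_distrib)
    then show "((\<Sum>j\<in>S. w j * a j s) - (\<Sum>j\<in>S. w j * g j s))\<^sup>2 \<le> (\<Sum>j\<in>S. (w j)\<^sup>2 * (a j s - g j s)\<^sup>2) * card S"
      by (simp only: sq)
  qed (auto intro!: mult_nonneg_nonneg sum_nonneg)
  also have "\<dots> = (\<Sum>j\<in>S. (w j)\<^sup>2 * (\<integral>s. (a j s - g j s)\<^sup>2 \<partial>lborel)) * card S"
    using d by (simp add: Bochner_Integration.integral_sum)
  also have "\<dots> \<le> (\<Sum>j\<in>S. (w j)\<^sup>2 * \<delta>) * card S"
    by (intro mult_right_mono sum_mono mult_left_mono gI(2)) auto
  also have "\<dots> = W * \<delta>" by (simp add: W_def sum_distrib_right[symmetric])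
  finally have 1: "(\<integral>s. ((\<Sum>j\<in>S. w j * a j s) - (\<Sum>j\<in>S. w j * g j s))\<^sup>2 \<partial>lborel) \<le> \<epsilon>" using \<delta>(2) by simp
  have "(\<integral>\<^sup>+\<omega>. ennreal (((\<Sum>j\<in>S. w j * R j \<omega>) - (\<Sum>j\<in>S. w j * I j \<omega>))\<^sup>2) \<partial>M)
     \<le> (\<integral>\<^sup>+\<omega>. (\<Sum>j\<in>S. ennreal ((w j)\<^sup>2 * card S) * ennreal ((R j \<omega> - I j \<omega>)\<^sup>2)) \<partial>M)"
  proof (rule nn_integral_mono)
    fix \<omega>
    have "(\<Sum>j\<in>S. w j * R j \<omega>) - (\<Sum>j\<in>S. w j * I j \<omega>) = (\<Sum>j\<in>S. w j * (R j \<omega> - I j \<omega>))"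
      by (simp only: sum_subtractf[symmetric] right_diff_distrib)
    then have "((\<Sum>j\<in>S. w j * R j \<omega>) - (\<Sum>j\<in>S. w j * I j \<omega>))\<^sup>2 \<le> (\<Sum>j\<in>S. (w j)\<^sup>2 * (R j \<omega> - I j \<omega>)\<^sup>2) * card S"
      by (simp only: sq)
    also have "\<dots> = (\<Sum>j\<in>S. ((w j)\<^sup>2 * card S) * (R j \<omega> - I j \<omega>)\<^sup>2)"
      unfolding sum_distrib_right by (intro sum.cong refl) (simp add: mult_ac)
    finally show "ennreal (((\<Sum>j\<in>S. w j * R j \<omega>) - (\<Sum>j\<in>S. w j * I j \<omega>))\<^sup>2)
       \<le> (\<Sum>j\<in>S. ennreal ((w j)\<^sup>2 * card S) * ennreal ((R j \<omega> - I j \<omega>)\<^sup>2))"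
      by (simp add: ennreal_mult[symmetric] sum_ennreal ennreal_leI)
  qed
  also have "\<dots> = (\<Sum>j\<in>S. ennreal ((w j)\<^sup>2 * card S) * (\<integral>\<^sup>+\<omega>. ennreal ((R j \<omega> - I j \<omega>)\<^sup>2) \<partial>M))"
  proof -
    have mm: "(\<lambda>\<omega>. ennreal ((R j \<omega> - I j \<omega>)\<^sup>2)) \<in> borel_measurable M" if "j \<in> S" for j
      using m(3)[OF that] gm(3)[OF that] by measurable
    have "(\<integral>\<^sup>+\<omega>. (\<Sum>j\<in>S. ennreal ((w j)\<^sup>2 * card S) * ennreal ((R j \<omega> - I j \<omega>)\<^sup>2)) \<partial>M)
        = (\<Sum>j\<in>S. \<integral>\<^sup>+\<omega>. ennreal ((w j)\<^sup>2 * card S) * ennreal ((R j \<omega> - I j \<omega>)\<^sup>2) \<partial>M)"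
      by (rule nn_integral_sum) (intro borel_measurable_times_ennreal borel_measurable_const mm)
    also have "\<dots> = (\<Sum>j\<in>S. ennreal ((w j)\<^sup>2 * card S) * (\<integral>\<^sup>+\<omega>. ennreal ((R j \<omega> - I j \<omega>)\<^sup>2) \<partial>M))"
      by (intro sum.cong refl nn_integral_cmult mm)
    finally show ?thesis .
  qed
  also have "\<dots> \<le> (\<Sum>j\<in>S. ennreal ((w j)\<^sup>2 * card S) * ennreal (\<rho> + \<delta>))"
    by (intro sum_mono mult_left_mono gI(3)) auto
  also have "\<dots> = ennreal (\<Sum>j\<in>S. ((w j)\<^sup>2 * card S) * (\<rho> + \<delta>))"
  proof -
    have "(\<Sum>j\<in>S. ennreal ((w j)\<^sup>2 * card S) * ennreal (\<rho> + \<delta>)) = (\<Sum>j\<in>S. ennreal (((w j)\<^sup>2 * card S) * (\<rho> + \<delta>)))"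
      by (intro sum.cong refl ennreal_mult[symmetric]) (use \<rho> \<delta>(1) in auto)
    also have "\<dots> = ennreal (\<Sum>j\<in>S. ((w j)\<^sup>2 * card S) * (\<rho> + \<delta>))"
      by (rule sum_ennreal) (use \<rho> \<delta>(1) in \<open>auto intro!: mult_nonneg_nonneg\<close>)
    finally show ?thesis .
  qed
  also have "(\<Sum>j\<in>S. ((w j)\<^sup>2 * card S) * (\<rho> + \<delta>)) = W * \<rho> + W * \<delta>"
    unfolding W_def by (simp only: sum_distrib_right[symmetric] distrib_left[of "sum _ _ * _", symmetric])
  also have "ennreal (W * \<rho> + W * \<delta>) \<le> ennreal (W * \<rho> + \<epsilon>)" using \<delta> by (intro ennreal_leI) simp
  finally show "\<exists>g I. wiener_step B T g I \<and> (\<integral>s. ((\<Sum>j\<in>S. w j * a j s) - g s)\<^sup>2 \<partial>lborel) \<le> \<epsilon> \<and>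
       (\<integral>\<^sup>+\<omega>. ennreal (((\<Sum>j\<in>S. w j * R j \<omega>) - I \<omega>)\<^sup>2) \<partial>M) \<le> ennreal ((\<Sum>j\<in>S. (w j)\<^sup>2) * card S * \<rho> + \<epsilon>)"
    using st 1 unfolding W_def by blast
qed

lemma wiener_approx_scale:
  assumes "wiener_approx M B T \<rho> R a" "0 \<le> T" "0 \<le> \<rho>"
  shows "wiener_approx M B T (w\<^sup>2 * \<rho>) (\<lambda>\<omega>. w * R \<omega>) (\<lambda>s. w * a s)"
  using wiener_approx_sum[of "{()}" T \<rho> "\<lambda>_. R" "\<lambda>_. a" "\<lambda>_. w"] assms by simp

lemma wiener_approx_mono:
  assumes "wiener_approx M B T \<rho> R a" "T \<le> T'" "\<rho> \<le> \<rho>'"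
  shows "wiener_approx M B T' \<rho>' R a"
  unfolding wiener_approx_def
proof (intro conjI allI impI)
  fix \<epsilon> :: real assume "\<epsilon> > 0"
  then obtain g I where g: "wiener_step B T g I" "(\<integral>s. (a s - g s)\<^sup>2 \<partial>lborel) \<le> \<epsilon>"
    "(\<integral>\<^sup>+\<omega>. ennreal ((R \<omega> - I \<omega>)\<^sup>2) \<partial>M) \<le> ennreal (\<rho> + \<epsilon>)"
    using assms(1) unfolding wiener_approx_def by blast
  have "ennreal (\<rho> + \<epsilon>) \<le> ennreal (\<rho>' + \<epsilon>)" using assms(3) by (intro ennreal_leI) simp
  then show "\<exists>g I. wiener_step B T' g I \<and> (\<integral>s. (a s - g s)\<^sup>2 \<partial>lborel) \<le> \<epsilon> \<and>
       (\<integral>\<^sup>+\<omega>. ennreal ((R \<omega> - I \<omega>)\<^sup>2) \<partial>M) \<le> ennreal (\<rho>' + \<epsilon>)"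
    using wiener_step_mono[OF g(1) assms(2)] g(2) order_trans[OF g(3)] by blast
qed (use assms in \<open>auto simp: wiener_approx_def\<close>)

text \<open>
  Subtracting \<open>g\<close> from the approximating elementary processes, on a common partition, leaves the
  approximation errors of integrand and integral unchanged.
\<close>

lemma has_ito_integral_diff_step:
  assumes J: "has_ito_integral M F B T H J" and T: "0 \<le> T" and w: "wiener_step B T g I"
  shows "has_ito_integral M F B T (\<lambda>s \<omega>. H s \<omega> - g s) (\<lambda>\<omega>. J \<omega> - I \<omega>)"
  unfolding has_ito_integral_def
proof (intro conjI ballI)
  have prog: "\<And>t. t \<in> {0..T} \<Longrightarrow> (\<lambda>(s, \<omega>). H s \<omega>) \<in> borel_measurable (restrict_space borel {0..t} \<Otimes>\<^sub>M F t)"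
    and AEsq: "AE \<omega> in M. set_integrable lborel {0..T} (\<lambda>s. (H s \<omega>)\<^sup>2)"
    and Jm: "J \<in> borel_measurable M"
    using J unfolding has_ito_integral_def by auto
  obtain m u \<xi> where el: "\<And>k. elementary_integrand M F T (m k) (u k) (\<xi> k)"
    and conv1: "converges_in_probability M
      (\<lambda>k \<omega>. LINT s:{0..T}|lborel. (elementary_process (m k) (u k) (\<xi> k) s \<omega> - H s \<omega>)\<^sup>2) (\<lambda>_. 0)"
    and conv2: "converges_in_probability M (\<lambda>k. elementary_integral B (m k) (u k) (\<xi> k)) J"
    using J unfolding has_ito_integral_def by blast
  note gm = wiener_step_measurable[OF w]
  have Im: "I \<in> borel_measurable M" by (rule wiener_step_integral_measurable[OF w])
  show "(\<lambda>\<omega>. J \<omega> - I \<omega>) \<in> borel_measurable M" using Jm Im by simp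
  show "(\<lambda>(s, \<omega>). H s \<omega> - g s) \<in> borel_measurable (restrict_space borel {0..t} \<Otimes>\<^sub>M F t)" if t: "t \<in> {0..T}" for t
  proof -
    have "g \<in> borel_measurable (restrict_space borel {0..t})" using gm(1) by (rule measurable_restrict_space1)
    then have "(\<lambda>z. g (fst z)) \<in> borel_measurable (restrict_space borel {0..t} \<Otimes>\<^sub>M F t)"
      by (rule measurable_compose[OF measurable_fst])
    with prog[OF t] show ?thesis unfolding case_prod_beta' by (rule borel_measurable_diff)
  qed
  have hm: "(\<lambda>(s, \<omega>). indicator {0..T} s * H s \<omega>) \<in> borel_measurable (borel \<Otimes>\<^sub>M M)"
    by (rule progressive_joint_measurable[OF prog T]) (use T in auto)
  show "AE \<omega> in M. set_integrable lborel {0..T} (\<lambda>s. (H s \<omega> - g s)\<^sup>2)"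
    using AEsq AE_space
  proof eventually_elim
    case (elim \<omega>)
    have [measurable]: "(\<lambda>s. indicator {0..T} s * H s \<omega>) \<in> borel_measurable borel" "g \<in> borel_measurable borel"
      using measurable_compose[OF measurable_Pair2'[OF elim(2)] hm] gm(1) by auto
    have "(\<lambda>s. (indicator {0..T} s * H s \<omega>)\<^sup>2) = (\<lambda>s. indicator {0..T} s *\<^sub>R (H s \<omega>)\<^sup>2)"
      by (auto simp: indicator_def)
    then have "integrable lborel (\<lambda>s. (indicator {0..T} s * H s \<omega>)\<^sup>2)"
      using elim(1) by (simp add: set_integrable_def)
    then have "integrable lborel (\<lambda>s. (indicator {0..T} s * H s \<omega> - g s)\<^sup>2)"
      by (intro integrable_diff_power2 gm(2)) auto
    moreover have "(\<lambda>s. (indicator {0..T} s * H s \<omega> - g s)\<^sup>2) = (\<lambda>s. indicator {0..T} s *\<^sub>R (H s \<omega> - g s)\<^sup>2)"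
      using gm(3) by (auto simp: indicator_def)
    ultimately show ?case by (simp add: set_integrable_def)
  qed
  obtain n v c where v: "v ` {..n} \<subseteq> {0..T}" "\<And>i. i < n \<Longrightarrow> v i \<le> v (Suc i)"
    "elementary_process n v (\<lambda>i _. c i) = (\<lambda>s (_::'a). g s)" "I = elementary_integral B n v (\<lambda>i (_::'a). c i)"
    using wiener_stepE[OF w] by metis
  have "\<exists>N (p :: nat \<Rightarrow> real). strict_mono_on {..N} p \<and> p ` {..N} = u k ` {..m k} \<union> v ` {..n}" for k
  proof -
    have "finite (u k ` {..m k} \<union> v ` {..n})" "u k ` {..m k} \<union> v ` {..n} \<noteq> {}" by auto
    then show ?thesis by (rule finite_set_enumeration) blast
  qed
  then obtain N :: "nat \<Rightarrow> nat" and p :: "nat \<Rightarrow> nat \<Rightarrow> real" where p: "\<And>k. strict_mono_on {..N k} (p k)"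
    "\<And>k. p k ` {..N k} = u k ` {..m k} \<union> v ` {..n}"
    by metis
  define \<eta> where "\<eta> k j = elementary_process (m k) (u k) (\<xi> k) (p k (Suc j))" for k j
  define \<zeta> where "\<zeta> k j \<omega> = 1 * \<eta> k j \<omega> + (-1) * g (p k (Suc j))" for k j \<omega>
  have sub: "u k ` {..m k} \<subseteq> p k ` {..N k}" "v ` {..n} \<subseteq> p k ` {..N k}" for k unfolding p(2) by auto
  have ends: "0 \<le> p k 0" "p k (N k) \<le> T" for k
  proof -
    have "p k 0 \<in> p k ` {..N k}" "p k (N k) \<in> p k ` {..N k}" by auto
    then show "0 \<le> p k 0" "p k (N k) \<le> T"
      unfolding p(2) using v(1) elementary_nodes(1)[OF el, of k] by auto
  qed
  have el\<eta>: "elementary_integrand M F T (N k) (p k) (\<eta> k)" for k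
    unfolding \<eta>_def by (rule elementary_integrand_refine[OF el p(1) sub(1) ends])
  have el\<zeta>: "elementary_integrand M F T (N k) (p k) (\<zeta> k)" for k
    unfolding elementary_integrand_def
  proof (intro conjI allI impI ends)
    fix i assume i: "i < N k"
    show "p k i \<le> p k (Suc i)" by (rule elementary_nodes(2)[OF el\<eta> i])
    show "\<zeta> k i \<in> borel_measurable (F (p k i))"
      using elementary_integrand_coeff(1)[OF el\<eta> i] unfolding \<zeta>_def[abs_def] by simp
    obtain L where L: "\<And>\<omega>. \<omega> \<in> space M \<Longrightarrow> \<bar>\<eta> k i \<omega>\<bar> \<le> L" using elementary_integrand_coeff(4)[OF el\<eta> i] by blast
    have "\<bar>\<zeta> k i \<omega>\<bar> \<le> L + \<bar>g (p k (Suc i))\<bar>" if "\<omega> \<in> space M" for \<omega>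
      using L[OF that] unfolding \<zeta>_def by linarith
    then show "bounded (\<zeta> k i ` space M)" by (auto simp: bounded_iff)
  qed
  have proc: "elementary_process (N k) (p k) (\<zeta> k) s \<omega> = elementary_process (m k) (u k) (\<xi> k) s \<omega> - g s" for k s \<omega>
    unfolding \<zeta>_def[abs_def] elementary_lincomb
    using elementary_process_refine[OF p(1)[of k] sub(1)[of k] elementary_nodes(2)[OF el[of k]], of "\<xi> k" s \<omega>]
      elementary_process_refine[OF p(1)[of k] sub(2)[of k] v(2), of "\<lambda>i _. c i" s \<omega>]
    unfolding v(3) \<eta>_def by simp
  have int: "elementary_integral B (N k) (p k) (\<zeta> k) \<omega> = elementary_integral B (m k) (u k) (\<xi> k) \<omega> - I \<omega>" for k \<omega>
    unfolding \<zeta>_def[abs_def] elementary_lincomb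
    using elementary_integral_refine[OF p(1)[of k] sub(1)[of k] elementary_nodes(2)[OF el[of k]], of B "\<xi> k" \<omega>]
      elementary_integral_refine[OF p(1)[of k] sub(2)[of k] v(2), of B "\<lambda>i _. c i" \<omega>]
    unfolding v(3) v(4) \<eta>_def by simp
  show "\<exists>m u \<xi>. (\<forall>k. elementary_integrand M F T (m k) (u k) (\<xi> k)) \<and>
        converges_in_probability M
          (\<lambda>k \<omega>. LINT s:{0..T}|lborel. (elementary_process (m k) (u k) (\<xi> k) s \<omega> - (H s \<omega> - g s))\<^sup>2) (\<lambda>_. 0) \<and>
        converges_in_probability M (\<lambda>k. elementary_integral B (m k) (u k) (\<xi> k)) (\<lambda>\<omega>. J \<omega> - I \<omega>)"
    using el\<zeta> conv1 conv2
    by (intro exI[of _ N] exI[of _ p] exI[of _ \<zeta>]) (simp add: proc int converges_in_probability_def)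
qed

lemma past_space: "past M (\<lambda>_. space M) s = space M"
  by (auto simp: past_def)

lemma ito_integral_second_moment:
  assumes "has_ito_integral M F B T H J" "0 \<le> T"
  shows "(\<integral>\<^sup>+\<omega>. ennreal ((J \<omega>)\<^sup>2) \<partial>M) \<le> (\<integral>\<^sup>+s. indicator {0..T} s * (\<integral>\<^sup>+\<omega>. ennreal ((H s \<omega>)\<^sup>2) \<partial>M) \<partial>lborel)"
proof -
  have "(\<integral>\<^sup>+\<omega>. ennreal ((J \<omega>)\<^sup>2) \<partial>M) = (\<integral>\<^sup>+\<omega>. indicator (past M (\<lambda>_. space M) T) \<omega> * ennreal ((J \<omega>)\<^sup>2) \<partial>M)"
    by (intro nn_integral_cong) (simp add: past_space)
  also have "\<dots> \<le> (\<integral>\<^sup>+s. indicator {0..T} s * (\<integral>\<^sup>+\<omega>. indicator (past M (\<lambda>_. space M) s) \<omega> * ennreal ((H s \<omega>)\<^sup>2) \<partial>M) \<partial>lborel)"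
    by (rule ito_integral_localized_bound[OF assms]) (metis space_F sets.top)
  also have "\<dots> = (\<integral>\<^sup>+s. indicator {0..T} s * (\<integral>\<^sup>+\<omega>. ennreal ((H s \<omega>)\<^sup>2) \<partial>M) \<partial>lborel)"
    by (intro nn_integral_cong arg_cong2[of _ _ _ _ "(*)"] refl) (simp add: past_space)
  finally show ?thesis .
qed

text \<open>
  If the integrand is close to a deterministic function \<open>a\<close>, the integral is close to the Wiener
  integral of \<open>a\<close>. This freezes the coefficient of the Volterra equation, and with \<open>\<rho> = 0\<close> it identifies
  the law of the limit process, whose approximating coefficients are allowed to be random.
\<close>

theorem wiener_approx_ito_integral:
  assumes J: "has_ito_integral M F B T H J" and T: "0 \<le> T"
    and a[measurable]: "a \<in> borel_measurable borel" and a2: "integrable lborel (\<lambda>s. (a s)\<^sup>2)" and supp: "\<And>s. s \<notin> {0..T} \<Longrightarrow> a s = 0"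
    and err: "(\<integral>\<^sup>+s. indicator {0..T} s * (\<integral>\<^sup>+\<omega>. ennreal ((H s \<omega> - a s)\<^sup>2) \<partial>M) \<partial>lborel) \<le> ennreal \<rho>" and \<rho>: "0 \<le> \<rho>"
  shows "wiener_approx M B T (2 * \<rho>) J a"
  unfolding wiener_approx_def
proof (intro conjI allI impI a a2)
  have prog: "(\<lambda>(s, \<omega>). H s \<omega>) \<in> borel_measurable (restrict_space borel {0..T} \<Otimes>\<^sub>M F T)"
    using J T unfolding has_ito_integral_def by auto
  show "J \<in> borel_measurable M" using J unfolding has_ito_integral_def by auto
  define h where "h s \<omega> = indicator {0..T} s * H s \<omega>" for s \<omega>
  have hm[measurable]: "(\<lambda>(s, \<omega>). h s \<omega>) \<in> borel_measurable (borel \<Otimes>\<^sub>M M)"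
    unfolding h_def by (rule progressive_joint_measurable[OF prog T])
  have hs: "h s \<in> borel_measurable M" for s
    using measurable_compose[OF measurable_Pair1'[of s borel M] hm] by simp
  fix \<epsilon> :: real assume \<epsilon>: "\<epsilon> > 0"
  then have "\<epsilon> / 2 > 0" by simp
  from step_functions_dense[OF a a2 supp T this, of B]
  obtain g I where g: "wiener_step B T g I" "(\<integral>s. (a s - g s)\<^sup>2 \<partial>lborel) < \<epsilon> / 2" by blast
  have [measurable]: "g \<in> borel_measurable borel" by (rule wiener_step_measurable(1)[OF g(1)])
  have d: "integrable lborel (\<lambda>s. (a s - g s)\<^sup>2)"
    by (rule integrable_diff_power2) (use a2 wiener_step_measurable(2)[OF g(1)] in auto)
  have "(\<integral>\<^sup>+\<omega>. ennreal ((J \<omega> - I \<omega>)\<^sup>2) \<partial>M) \<le> (\<integral>\<^sup>+s. indicator {0..T} s * (\<integral>\<^sup>+\<omega>. ennreal ((H s \<omega> - g s)\<^sup>2) \<partial>M) \<partial>lborel)"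
    by (rule ito_integral_second_moment[OF has_ito_integral_diff_step[OF J T g(1)] T])
  also have "\<dots> \<le> (\<integral>\<^sup>+s. 2 * (indicator {0..T} s * (\<integral>\<^sup>+\<omega>. ennreal ((h s \<omega> - a s)\<^sup>2) \<partial>M)) + 2 * ennreal ((a s - g s)\<^sup>2) \<partial>lborel)"
  proof (rule nn_integral_mono)
    fix s
    show "indicator {0..T} s * (\<integral>\<^sup>+\<omega>. ennreal ((H s \<omega> - g s)\<^sup>2) \<partial>M)
       \<le> 2 * (indicator {0..T} s * (\<integral>\<^sup>+\<omega>. ennreal ((h s \<omega> - a s)\<^sup>2) \<partial>M)) + 2 * ennreal ((a s - g s)\<^sup>2)"
    proof (cases "s \<in> {0..T}")
      case True
      have "(\<integral>\<^sup>+\<omega>. ennreal ((H s \<omega> - g s)\<^sup>2) \<partial>M) \<le> (\<integral>\<^sup>+\<omega>. 2 * ennreal ((h s \<omega> - a s)\<^sup>2) + 2 * ennreal ((a s - g s)\<^sup>2) \<partial>M)"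
      proof (rule nn_integral_mono)
        fix \<omega>
        show "ennreal ((H s \<omega> - g s)\<^sup>2) \<le> 2 * ennreal ((h s \<omega> - a s)\<^sup>2) + 2 * ennreal ((a s - g s)\<^sup>2)"
          using ennreal_square_add_le[of "h s \<omega> - a s" "a s - g s"] True by (simp add: h_def)
      qed
      also have "\<dots> = 2 * (\<integral>\<^sup>+\<omega>. ennreal ((h s \<omega> - a s)\<^sup>2) \<partial>M) + 2 * ennreal ((a s - g s)\<^sup>2)"
        using hs[of s] by (subst nn_integral_add) (auto simp: nn_integral_cmult emeasure_space_1)
      finally show ?thesis using True by simp
    qed simp
  qed
  also have "\<dots> = 2 * (\<integral>\<^sup>+s. indicator {0..T} s * (\<integral>\<^sup>+\<omega>. ennreal ((h s \<omega> - a s)\<^sup>2) \<partial>M) \<partial>lborel) + 2 * (\<integral>\<^sup>+s. ennreal ((a s - g s)\<^sup>2) \<partial>lborel)"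
    by (subst nn_integral_add) (auto simp: nn_integral_cmult)
  also have "(\<integral>\<^sup>+s. indicator {0..T} s * (\<integral>\<^sup>+\<omega>. ennreal ((h s \<omega> - a s)\<^sup>2) \<partial>M) \<partial>lborel)
     = (\<integral>\<^sup>+s. indicator {0..T} s * (\<integral>\<^sup>+\<omega>. ennreal ((H s \<omega> - a s)\<^sup>2) \<partial>M) \<partial>lborel)"
    by (intro nn_integral_cong) (auto simp: h_def indicator_def)
  also have "(\<integral>\<^sup>+s. ennreal ((a s - g s)\<^sup>2) \<partial>lborel) = ennreal (\<integral>s. (a s - g s)\<^sup>2 \<partial>lborel)"
    by (rule nn_integral_eq_integral[OF d]) simp
  also have "2 * (\<integral>\<^sup>+s. indicator {0..T} s * (\<integral>\<^sup>+\<omega>. ennreal ((H s \<omega> - a s)\<^sup>2) \<partial>M) \<partial>lborel) + 2 * ennreal (\<integral>s. (a s - g s)\<^sup>2 \<partial>lborel)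
     \<le> 2 * ennreal \<rho> + 2 * ennreal (\<epsilon> / 2)"
    using g(2) by (intro add_mono mult_left_mono err ennreal_leI) auto
  also have "\<dots> = ennreal (2 * \<rho> + \<epsilon>)"
    using \<rho> \<epsilon> by (simp add: two_ennreal ennreal_plus[symmetric] del: ennreal_plus)
  finally show "\<exists>g I. wiener_step B T g I \<and> (\<integral>s. (a s - g s)\<^sup>2 \<partial>lborel) \<le> \<epsilon> \<and>
       (\<integral>\<^sup>+\<omega>. ennreal ((J \<omega> - I \<omega>)\<^sup>2) \<partial>M) \<le> ennreal (2 * \<rho> + \<epsilon>)"
    using g \<epsilon> by (intro exI[of _ g] exI[of _ I]) auto
qed

end

section \<open>Solutions of the Volterra equation at small times\<close>

text \<open>
  The energy \<open>\<kappa>(t)\<close> of the kernel on \<open>[0, t]\<close>, which governs all error terms.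
\<close>

definition ksq :: "(real \<Rightarrow> real) \<Rightarrow> real \<Rightarrow> real" where
  "ksq K t = (LINT s:{0..t}|lborel. (K s)\<^sup>2)"

text \<open>
  The integrand \<open>s \<mapsto> K (t - s)\<close> of the equation at time \<open>t\<close>, extended by zero to a function on the whole
  line; slices at different times can then be compared in one \<open>L\<^sup>2\<close> space.
\<close>

definition kslice :: "(real \<Rightarrow> real) \<Rightarrow> real \<Rightarrow> real \<Rightarrow> real" where
  "kslice K t s = indicator {0..t} s * K (t - s)"

lemma ksq_nonneg: "0 \<le> ksq K t"
  unfolding ksq_def set_lebesgue_integral_def by (intro Bochner_Integration.integral_nonneg) auto

lemma L2_loc_integrable: "L2_loc K \<Longrightarrow> integrable lborel (\<lambda>r. indicator {0..t} r * (K r)\<^sup>2)"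
  by (cases "0 \<le> t") (auto simp: L2_loc_def set_integrable_def)

lemma ksq_mono: "L2_loc K \<Longrightarrow> s \<le> t \<Longrightarrow> ksq K s \<le> ksq K t"
  unfolding ksq_def set_lebesgue_integral_def real_scaleR_def
  by (intro integral_mono L2_loc_integrable) (auto simp: indicator_def)

lemma kslice_measurable:
  assumes "L2_loc K" shows "kslice K t \<in> borel_measurable borel"
proof -
  have [measurable]: "(\<lambda>s. indicator {0..} s * K s) \<in> borel_measurable borel"
    using assms by (simp add: L2_loc_def set_borel_measurable_def)
  have "(\<lambda>s. indicator {0..t} s * (indicator {0..} (t - s) * K (t - s))) \<in> borel_measurable borel"
  proof (rule borel_measurable_times)
    have "(\<lambda>s. t - s) \<in> borel_measurable borel" by measurable
    from measurable_compose[OF this, of "\<lambda>s. indicator {0..} s * K s" borel]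
    show "(\<lambda>s. indicator {0..} (t - s) * K (t - s)) \<in> borel_measurable borel" by simp
  qed measurable
  also have "(\<lambda>s. indicator {0..t} s * (indicator {0..} (t - s) * K (t - s))) = kslice K t"
    by (auto simp: kslice_def indicator_def)
  finally show ?thesis .
qed

lemma kslice_outside: "s \<notin> {0..t} \<Longrightarrow> kslice K t s = 0"
  by (auto simp: kslice_def)

lemma kslice_sq_reflect: "(kslice K t s)\<^sup>2 = (\<lambda>r. indicator {0..t} r * (K r)\<^sup>2) (t + (-1) * s)"
  by (auto simp: kslice_def indicator_def)

lemma kslice_sq:
  assumes "L2_loc K"
  shows "integrable lborel (\<lambda>s. (kslice K t s)\<^sup>2)" and "(\<integral>s. (kslice K t s)\<^sup>2 \<partial>lborel) = ksq K t"
proof -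
  show "integrable lborel (\<lambda>s. (kslice K t s)\<^sup>2)"
    unfolding kslice_sq_reflect by (rule lborel_integrable_real_affine[OF L2_loc_integrable[OF assms]]) simp
  show "(\<integral>s. (kslice K t s)\<^sup>2 \<partial>lborel) = ksq K t"
    unfolding kslice_sq_reflect ksq_def set_lebesgue_integral_def real_scaleR_def
    using lborel_integral_real_affine[of "-1" "\<lambda>r. indicator {0..t} r * (K r)\<^sup>2" t] by simp
qed

text \<open>
  The inner products of the slices are the covariances occurring in the hypothesis on \<open>K\<close>.
\<close>

lemma kslice_prod:
  assumes "0 \<le> p" "p \<le> q"
  shows "(\<integral>s. kslice K p s * kslice K q s \<partial>lborel) = (LINT r:{0..p}|lborel. K (q - p + r) * K r)"
proof -
  have "kslice K p s * kslice K q s = (\<lambda>r. indicator {0..p} r * (K (q - p + r) * K r)) (p + (-1) * s)" for s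
    using assms by (auto simp: kslice_def indicator_def)
  then show ?thesis
    unfolding set_lebesgue_integral_def real_scaleR_def
    using lborel_integral_real_affine[of "-1" "\<lambda>r. indicator {0..p} r * (K (q - p + r) * K r)" p] by simp
qed

text \<open>
  Cauchy--Schwarz on \<open>[0, t]\<close>. It also holds when \<open>f\<close> is not integrable, since then the integral is zero
  by convention.
\<close>

lemma set_integral_square_le:
  fixes f :: "real \<Rightarrow> real"
  assumes f: "(\<lambda>s. indicator {0..t} s * f s) \<in> borel_measurable borel" and t: "0 \<le> t"
  shows "ennreal ((LINT s:{0..t}|lborel. f s)\<^sup>2) \<le> ennreal t * (\<integral>\<^sup>+s. indicator {0..t} s * ennreal ((f s)\<^sup>2) \<partial>lborel)"
proof -
  define h where "h s = indicator {0..t} s * f s" for s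
  have [measurable]: "h \<in> borel_measurable borel" using f by (simp add: h_def[abs_def])
  have L: "(LINT s:{0..t}|lborel. f s) = (\<integral>s. h s \<partial>lborel)" by (simp add: set_lebesgue_integral_def h_def)
  have N: "(\<integral>\<^sup>+s. indicator {0..t} s * ennreal ((f s)\<^sup>2) \<partial>lborel) = (\<integral>\<^sup>+s. ennreal ((h s)\<^sup>2) \<partial>lborel)"
    by (intro nn_integral_cong) (auto simp: h_def indicator_def)
  show ?thesis
  proof (cases "t = 0")
    case True
    have "AE s in lborel. h s = 0" using AE_lborel_singleton[of 0]
      by eventually_elim (auto simp: h_def True)
    then have "(\<integral>s. h s \<partial>lborel) = 0" by (subst integral_cong_AE[where g="\<lambda>_. 0"]) auto
    then show ?thesis by (simp add: L)
  next
    case False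
    then have t: "t > 0" using t by simp
    show ?thesis
    proof (cases "(\<integral>\<^sup>+s. ennreal ((h s)\<^sup>2) \<partial>lborel) = \<top>")
      case True
      then show ?thesis unfolding N True using t by (simp add: ennreal_mult_top)
    next
      case False
      have h2: "integrable lborel (\<lambda>s. (h s)\<^sup>2)"
        by (rule integrableI_bounded) (use False in \<open>auto simp: less_top\<close>)
      have i1: "integrable lborel (indicator {0..t} :: real \<Rightarrow> real)" using t by auto
      have h1: "integrable lborel h"
      proof (rule Bochner_Integration.integrable_bound[OF Bochner_Integration.integrable_add[OF i1 h2]])
        have "\<bar>h s\<bar> \<le> indicator {0..t} s + (h s)\<^sup>2" for s
        proof (cases "s \<in> {0..t}")
          case True
          have "0 \<le> (\<bar>h s\<bar> - 1)\<^sup>2" by simp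
          then have "2 * \<bar>h s\<bar> \<le> 1 + (h s)\<^sup>2" by (simp add: power2_diff)
          then show ?thesis using True by simp
        qed (simp add: h_def)
        then show "AE s in lborel. norm (h s) \<le> norm (indicator {0..t} s + (h s)\<^sup>2)" by simp
      qed simp
      let ?m = "\<integral>s. h s \<partial>lborel"
      have "0 \<le> (\<integral>s. (t * h s - ?m * indicator {0..t} s)\<^sup>2 \<partial>lborel)" by simp
      also have "\<dots> = (\<integral>s. t\<^sup>2 * (h s)\<^sup>2 - 2 * t * ?m * h s + ?m\<^sup>2 * indicator {0..t} s \<partial>lborel)"
        by (intro Bochner_Integration.integral_cong refl)
          (auto simp: h_def indicator_def power2_diff power_mult_distrib)
      also have "\<dots> = t\<^sup>2 * (\<integral>s. (h s)\<^sup>2 \<partial>lborel) - 2 * t * ?m * ?m + ?m\<^sup>2 * t"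
        using h1 h2 i1 t by simp
      also have "\<dots> = t * (t * (\<integral>s. (h s)\<^sup>2 \<partial>lborel) - ?m\<^sup>2)"
        by (simp add: power2_eq_square algebra_simps)
      finally have "?m\<^sup>2 \<le> t * (\<integral>s. (h s)\<^sup>2 \<partial>lborel)" using t by (simp add: zero_le_mult_iff)
      then have "ennreal (?m\<^sup>2) \<le> ennreal (t * (\<integral>s. (h s)\<^sup>2 \<partial>lborel))" by (rule ennreal_leI)
      also have "\<dots> = ennreal t * (\<integral>\<^sup>+s. ennreal ((h s)\<^sup>2) \<partial>lborel)"
        using t by (simp add: ennreal_mult nn_integral_eq_integral[OF h2])
      finally show ?thesis by (simp only: L N)
    qed
  qed
qed

text \<open>
  A pointwise substitute for Jensen's inequality: if \<open>E z\<^sup>2 \<le> a\<close>, taking expectations bounds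
  \<open>E |z|\<^bsup>2\<alpha>\<^esup>\<close> by \<open>2 a\<^bsup>\<alpha>\<^esup>\<close>.
\<close>

lemma powr_interpolation:
  fixes z a \<alpha> :: real
  assumes "a > 0" "0 < \<alpha>" "\<alpha> \<le> 1"
  shows "(\<bar>z\<bar> powr \<alpha>)\<^sup>2 \<le> a powr \<alpha> * (1 + (1 / a) * z\<^sup>2)"
proof -
  have e: "(\<bar>z\<bar> powr \<alpha>)\<^sup>2 = z\<^sup>2 powr \<alpha>"
    by (cases "z = 0") (simp_all add: power2_eq_square powr_mult[symmetric] abs_mult[symmetric])
  show ?thesis
  proof (cases "z\<^sup>2 \<le> a")
    case True
    then have "z\<^sup>2 powr \<alpha> \<le> a powr \<alpha> * 1" using assms by (simp add: powr_mono2)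
    also have "\<dots> \<le> a powr \<alpha> * (1 + (1 / a) * z\<^sup>2)" using assms by (intro mult_left_mono) auto
    finally show ?thesis by (simp only: e)
  next
    case False
    then have "z\<^sup>2 powr \<alpha> = a powr \<alpha> * (z\<^sup>2 / a) powr \<alpha>" using assms by (simp add: powr_divide)
    also have "\<dots> \<le> a powr \<alpha> * (z\<^sup>2 / a) powr 1"
      using False assms by (intro mult_left_mono powr_mono) (auto simp: field_simps)
    also have "\<dots> \<le> a powr \<alpha> * (1 + (1 / a) * z\<^sup>2)" using assms by (intro mult_left_mono) auto
    finally show ?thesis by (simp only: e)
  qed
qed

locale volterra_solution = brownian M F B
  for M :: "'a measure" and F B +
  fixes K b \<sigma> :: "real \<Rightarrow> real" and x :: real and X :: "real \<Rightarrow> 'a \<Rightarrow> real"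
  assumes sol: "continuous_weak_solution K b \<sigma> x M F B X" and K: "L2_loc K"
    and b_meas[measurable]: "b \<in> borel_measurable borel" and \<sigma>_meas[measurable]: "\<sigma> \<in> borel_measurable borel"
begin

definition drift :: "real \<Rightarrow> 'a \<Rightarrow> real" where
  "drift t \<omega> = (LINT s:{0..t}|lborel. K (t - s) * b (X s \<omega>))"

lemma ito: "0 \<le> t \<Longrightarrow> has_ito_integral M F B t (\<lambda>s \<omega>. K (t - s) * \<sigma> (X s \<omega>)) (\<lambda>\<omega>. X t \<omega> - x - drift t \<omega>)"
  using sol by (simp add: continuous_weak_solution_def drift_def)

lemma X_cont: "\<omega> \<in> space M \<Longrightarrow> continuous_on {0..} (\<lambda>t. X t \<omega>)"
  using sol by (simp add: continuous_weak_solution_def continuous_paths_def)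

lemma X_F: "0 \<le> t \<Longrightarrow> X t \<in> borel_measurable (F t)"
  using sol by (simp add: continuous_weak_solution_def adapted_def)

lemma X_meas: "0 \<le> t \<Longrightarrow> X t \<in> borel_measurable M"
  using X_F measurable_F_M by blast

text \<open>
  Paths are limits of their values on the grids of mesh \<open>1/(k+1)\<close>, on which joint measurability is a
  countable matter.
\<close>

lemma X_joint[measurable]: "(\<lambda>(s, \<omega>). X (max 0 s) \<omega>) \<in> borel_measurable (borel \<Otimes>\<^sub>M M)"
proof -
  define g where "g k s = nat \<lfloor>real (Suc k) * max 0 s\<rfloor>" for k and s :: real
  have "(\<lambda>z :: real \<times> 'a. X (max 0 (fst z)) (snd z)) \<in> borel_measurable (borel \<Otimes>\<^sub>M M)"
  proof (rule borel_measurable_LIMSEQ_real)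
    fix k
    have "(\<lambda>z :: real \<times> 'a. g k (fst z)) \<in> (borel \<Otimes>\<^sub>M M) \<rightarrow>\<^sub>M count_space UNIV"
      unfolding g_def by measurable
    moreover have "(\<lambda>z :: real \<times> 'a. X (real i / real (Suc k)) (snd z)) \<in> borel_measurable (borel \<Otimes>\<^sub>M M)" for i
      by (rule measurable_compose[OF measurable_snd X_meas]) simp
    ultimately show "(\<lambda>z :: real \<times> 'a. X (real (g k (fst z)) / real (Suc k)) (snd z)) \<in> borel_measurable (borel \<Otimes>\<^sub>M M)"
      by (rule measurable_compose_countable[rotated])
  next
    fix z :: "real \<times> 'a" assume "z \<in> space (borel \<Otimes>\<^sub>M M)"
    then have \<omega>: "snd z \<in> space M" by (simp add: space_pair_measure mem_Times_iff)
    let ?s = "max 0 (fst z)"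
    have "(\<lambda>k. real (g k (fst z)) / real (Suc k)) \<longlonglongrightarrow> ?s"
    proof (rule LIMSEQ_I)
      fix r :: real assume r: "r > 0"
      then obtain k0 where k0: "inverse (real (Suc k0)) < r" using reals_Archimedean by blast
      have "norm (real (g k (fst z)) / real (Suc k) - ?s) < r" if "k \<ge> k0" for k
      proof -
        have 1: "real (g k (fst z)) \<le> real (Suc k) * ?s" "real (Suc k) * ?s < real (g k (fst z)) + 1"
          unfolding g_def by (auto simp: of_nat_nat)
        have "inverse (real (Suc k)) \<le> inverse (real (Suc k0))" using that by (intro le_imp_inverse_le) auto
        then have "1 / real (Suc k) < r" using k0 by (simp add: inverse_eq_divide)
        moreover have "real (g k (fst z)) / real (Suc k) \<le> ?s"
          using 1(1) by (subst pos_divide_le_eq) (simp_all only: mult.commute of_nat_0_less_iff zero_less_Suc)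
        moreover have "?s < (real (g k (fst z)) + 1) / real (Suc k)"
          using 1(2) by (subst pos_less_divide_eq) (simp_all only: mult.commute of_nat_0_less_iff zero_less_Suc)
        then have "?s < real (g k (fst z)) / real (Suc k) + 1 / real (Suc k)" by (simp only: add_divide_distrib)
        ultimately show ?thesis unfolding real_norm_def by linarith
      qed
      then show "\<exists>k0. \<forall>k\<ge>k0. norm (real (g k (fst z)) / real (Suc k) - ?s) < r" by blast
    qed
    then show "(\<lambda>k. X (real (g k (fst z)) / real (Suc k)) (snd z)) \<longlonglongrightarrow> X ?s (snd z)"
      by (intro continuous_on_tendsto_compose[OF X_cont[OF \<omega>]]) auto
  qed
  then show ?thesis by (simp add: case_prod_beta')
qed

lemma X_path[measurable]: "\<omega> \<in> space M \<Longrightarrow> (\<lambda>s. X (max 0 s) \<omega>) \<in> borel_measurable borel"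
  using measurable_compose[OF measurable_Pair2' X_joint] by simp

text \<open>
  By Tonelli, a uniform second moment bound on \<open>X - x\<close> before time \<open>t\<close> bounds the square integral of
  \<open>K (t - s) f (X s)\<close> by a multiple of \<open>\<kappa>(t)\<close>.
\<close>

lemma slice_second_moment:
  assumes f[measurable]: "f \<in> borel_measurable borel" and c: "0 \<le> c" and d: "0 \<le> d"
    and growth: "\<And>y. (f y)\<^sup>2 \<le> c * (1 + d * (y - x)\<^sup>2)"
    and A: "\<And>s. 0 < s \<Longrightarrow> s \<le> t \<Longrightarrow> A s \<in> sets M"
    and G: "\<And>s. 0 < s \<Longrightarrow> s \<le> t \<Longrightarrow> (\<integral>\<^sup>+\<omega>. indicator (A s) \<omega> * ennreal ((X s \<omega> - x)\<^sup>2) \<partial>M) \<le> ennreal G" and "0 \<le> G"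
  shows "(\<integral>\<^sup>+s. indicator {0..t} s * (\<integral>\<^sup>+\<omega>. indicator (A s) \<omega> * ennreal ((K (t - s) * f (X s \<omega>))\<^sup>2) \<partial>M) \<partial>lborel)
    \<le> ennreal (c * (1 + d * G) * ksq K t)"
proof -
  have "(\<integral>\<^sup>+s. indicator {0..t} s * (\<integral>\<^sup>+\<omega>. indicator (A s) \<omega> * ennreal ((K (t - s) * f (X s \<omega>))\<^sup>2) \<partial>M) \<partial>lborel)
     \<le> (\<integral>\<^sup>+s. ennreal (c * (1 + d * G) * (kslice K t s)\<^sup>2) \<partial>lborel)"
  proof (rule nn_integral_mono_AE)
    show "AE s in lborel. indicator {0..t} s * (\<integral>\<^sup>+\<omega>. indicator (A s) \<omega> * ennreal ((K (t - s) * f (X s \<omega>))\<^sup>2) \<partial>M)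
       \<le> ennreal (c * (1 + d * G) * (kslice K t s)\<^sup>2)"
      using AE_lborel_singleton[of 0]
    proof eventually_elim
      case (elim s)
      show ?case
      proof (cases "s \<in> {0..t}")
        case True
        then have s: "0 < s" "s \<le> t" using elim by auto
        have [measurable]: "X s \<in> borel_measurable M" "A s \<in> sets M" using X_meas A s by auto
        let ?k = "(K (t - s))\<^sup>2 * c"
        have k: "0 \<le> ?k" using c by simp
        have "(\<integral>\<^sup>+\<omega>. indicator (A s) \<omega> * ennreal ((K (t - s) * f (X s \<omega>))\<^sup>2) \<partial>M)
           \<le> (\<integral>\<^sup>+\<omega>. ennreal ?k * (1 + ennreal d * (indicator (A s) \<omega> * ennreal ((X s \<omega> - x)\<^sup>2))) \<partial>M)"
        proof (rule nn_integral_mono)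
          fix \<omega>
          have "(K (t - s) * f (X s \<omega>))\<^sup>2 \<le> ?k * (1 + d * (X s \<omega> - x)\<^sup>2)"
            using mult_left_mono[OF growth[of "X s \<omega>"], of "(K (t - s))\<^sup>2"] by (simp add: power_mult_distrib mult.assoc)
          then have "ennreal ((K (t - s) * f (X s \<omega>))\<^sup>2) \<le> ennreal (?k * (1 + d * (X s \<omega> - x)\<^sup>2))" by (rule ennreal_leI)
          also have "\<dots> = ennreal ?k * (1 + ennreal d * ennreal ((X s \<omega> - x)\<^sup>2))"
            using k d by (simp add: ennreal_mult ennreal_plus)
          finally show "indicator (A s) \<omega> * ennreal ((K (t - s) * f (X s \<omega>))\<^sup>2)
             \<le> ennreal ?k * (1 + ennreal d * (indicator (A s) \<omega> * ennreal ((X s \<omega> - x)\<^sup>2)))"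
            by (auto simp: indicator_def)
        qed
        also have "\<dots> = ennreal ?k * (1 + ennreal d * (\<integral>\<^sup>+\<omega>. indicator (A s) \<omega> * ennreal ((X s \<omega> - x)\<^sup>2) \<partial>M))"
          by (simp add: nn_integral_cmult nn_integral_add emeasure_space_1)
        also have "\<dots> \<le> ennreal ?k * (1 + ennreal d * ennreal G)"
          by (intro mult_left_mono add_left_mono G s) auto
        also have "\<dots> = ennreal (?k * (1 + d * G))"
          using k d \<open>0 \<le> G\<close> by (simp add: ennreal_mult ennreal_plus)
        also have "?k * (1 + d * G) = c * (1 + d * G) * (kslice K t s)\<^sup>2" using True by (simp add: kslice_def mult_ac)
        finally show ?thesis using True by simp
      qed simp
    qed
  qed
  also have "\<dots> = ennreal (\<integral>s. c * (1 + d * G) * (kslice K t s)\<^sup>2 \<partial>lborel)"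
    using kslice_sq(1)[OF K] c d \<open>0 \<le> G\<close> by (intro nn_integral_eq_integral) auto
  also have "\<dots> = ennreal (c * (1 + d * G) * ksq K t)" by (simp add: kslice_sq(2)[OF K])
  finally show ?thesis .
qed

lemma drift_second_moment:
  assumes t: "0 \<le> t" and A: "\<And>s. s \<le> t \<Longrightarrow> A t \<subseteq> A s"
    and Am[measurable]: "(\<lambda>(s, \<omega>). indicator (A s) \<omega> :: real) \<in> borel_measurable (borel \<Otimes>\<^sub>M M)"
  shows "(\<integral>\<^sup>+\<omega>. indicator (A t) \<omega> * ennreal ((drift t \<omega>)\<^sup>2) \<partial>M)
    \<le> ennreal t * (\<integral>\<^sup>+s. indicator {0..t} s * (\<integral>\<^sup>+\<omega>. indicator (A s) \<omega> * ennreal ((K (t - s) * b (X s \<omega>))\<^sup>2) \<partial>M) \<partial>lborel)"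
proof -
  have [measurable]: "kslice K t \<in> borel_measurable borel" by (rule kslice_measurable[OF K])
  define q where "q s \<omega> = (kslice K t s * b (X (max 0 s) \<omega>) * indicator (A s) \<omega>)\<^sup>2" for s \<omega>
  have qm[measurable]: "(\<lambda>(s, \<omega>). q s \<omega>) \<in> borel_measurable (borel \<Otimes>\<^sub>M M)" unfolding q_def by measurable
  have "(\<integral>\<^sup>+\<omega>. indicator (A t) \<omega> * ennreal ((drift t \<omega>)\<^sup>2) \<partial>M) \<le> (\<integral>\<^sup>+\<omega>. ennreal t * (\<integral>\<^sup>+s. ennreal (q s \<omega>) \<partial>lborel) \<partial>M)"
  proof (rule nn_integral_mono)
    fix \<omega> assume \<omega>: "\<omega> \<in> space M"
    note X_path[OF \<omega>, measurable]
    have e: "(\<lambda>s. indicator {0..t} s * (K (t - s) * b (X s \<omega>))) = (\<lambda>s. kslice K t s * b (X (max 0 s) \<omega>))"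
      by (auto simp: kslice_def indicator_def fun_eq_iff max_def)
    have dr: "ennreal ((drift t \<omega>)\<^sup>2) \<le> ennreal t * (\<integral>\<^sup>+s. indicator {0..t} s * ennreal ((K (t - s) * b (X s \<omega>))\<^sup>2) \<partial>lborel)"
      unfolding drift_def by (rule set_integral_square_le[OF _ t], unfold e) measurable
    have qb: "(\<integral>\<^sup>+s. indicator {0..t} s * ennreal ((K (t - s) * b (X s \<omega>))\<^sup>2) \<partial>lborel) \<le> (\<integral>\<^sup>+s. ennreal (q s \<omega>) \<partial>lborel)"
      if "\<omega> \<in> A t"
    proof (rule nn_integral_mono)
      fix s
      show "indicator {0..t} s * ennreal ((K (t - s) * b (X s \<omega>))\<^sup>2) \<le> ennreal (q s \<omega>)"
        using A[of s] that by (auto simp: q_def kslice_def indicator_def max_def)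
    qed
    show "indicator (A t) \<omega> * ennreal ((drift t \<omega>)\<^sup>2) \<le> ennreal t * (\<integral>\<^sup>+s. ennreal (q s \<omega>) \<partial>lborel)"
    proof (cases "\<omega> \<in> A t")
      case True
      have "ennreal ((drift t \<omega>)\<^sup>2) \<le> ennreal t * (\<integral>\<^sup>+s. ennreal (q s \<omega>) \<partial>lborel)"
        by (rule order_trans[OF dr mult_left_mono[OF qb[OF True]]]) simp
      then show ?thesis using True by simp
    qed simp
  qed
  also have "\<dots> = ennreal t * (\<integral>\<^sup>+\<omega>. \<integral>\<^sup>+s. ennreal (q s \<omega>) \<partial>lborel \<partial>M)"
    by (rule nn_integral_cmult) measurable
  also have "(\<integral>\<^sup>+\<omega>. \<integral>\<^sup>+s. ennreal (q s \<omega>) \<partial>lborel \<partial>M) = (\<integral>\<^sup>+s. \<integral>\<^sup>+\<omega>. ennreal (q s \<omega>) \<partial>M \<partial>lborel)"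
  proof -
    interpret pair_sigma_finite lborel M ..
    show ?thesis by (rule Fubini') measurable
  qed
  also have "\<dots> = (\<integral>\<^sup>+s. indicator {0..t} s * (\<integral>\<^sup>+\<omega>. indicator (A s) \<omega> * ennreal ((K (t - s) * b (X s \<omega>))\<^sup>2) \<partial>M) \<partial>lborel)"
  proof (rule nn_integral_cong)
    fix s
    show "(\<integral>\<^sup>+\<omega>. ennreal (q s \<omega>) \<partial>M) = indicator {0..t} s * (\<integral>\<^sup>+\<omega>. indicator (A s) \<omega> * ennreal ((K (t - s) * b (X s \<omega>))\<^sup>2) \<partial>M)"
    proof (cases "s \<in> {0..t}")
      case True
      then have "ennreal (q s \<omega>) = indicator (A s) \<omega> * ennreal ((K (t - s) * b (X s \<omega>))\<^sup>2)" for \<omega>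
        by (auto simp: q_def kslice_def indicator_def max_def)
      then show ?thesis using True by simp
    qed (simp add: q_def kslice_def)
  qed
  finally show ?thesis .
qed

text \<open>
  On the event that the path has stayed in \<open>[-L, L]\<close>, the supremum \<open>G\<close> of the second moments over \<open>(0, T]\<close>
  is finite. Estimating drift and stochastic integral gives \<open>G \<le> 4 c \<kappa>(T) (1 + G)\<close>, and \<open>G\<close> on the right is
  absorbed because \<open>4 c \<kappa>(T) \<le> 1/2\<close>. The outcome does not depend on \<open>L\<close>.
\<close>

lemma localized_second_moment:
  assumes c: "0 \<le> c" and gb: "\<And>y. (b y)\<^sup>2 \<le> c * (1 + (y - x)\<^sup>2)" and g\<sigma>: "\<And>y. (\<sigma> y)\<^sup>2 \<le> c * (1 + (y - x)\<^sup>2)"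
    and T: "0 < T" "T \<le> 1" "4 * c * ksq K T \<le> 1 / 2" and L: "0 \<le> L"
  shows "(\<integral>\<^sup>+\<omega>. indicator (past M (\<lambda>r. {\<omega>\<in>space M. \<bar>X r \<omega>\<bar> \<le> L}) T) \<omega> * ennreal ((X T \<omega> - x)\<^sup>2) \<partial>M) \<le> ennreal (8 * c * ksq K T)"
proof -
  define E where "E r = {\<omega>\<in>space M. \<bar>X r \<omega>\<bar> \<le> L}" for r
  let ?A = "past M E"
  define g where "g t = (\<integral>\<^sup>+\<omega>. indicator (?A t) \<omega> * ennreal ((X t \<omega> - x)\<^sup>2) \<partial>M)" for t
  have E: "E r \<in> sets (F r)" if "0 \<le> r" for r
  proof -
    have "{\<omega>\<in>space (F r). \<bar>X r \<omega>\<bar> \<le> L} \<in> sets (F r)" using X_F[OF that] by measurable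
    then show ?thesis by (simp add: E_def space_F[OF that])
  qed
  have AM: "?A t \<in> sets M" if "0 \<le> t" for t
    using past_sets[OF E that] bm that unfolding brownian_motion_def filtered_prob_space_def subalgebra_def by blast
  have XL: "\<bar>X t \<omega>\<bar> \<le> L" if t: "0 < t" and \<omega>: "\<omega> \<in> ?A t" for t \<omega>
  proof (rule ccontr)
    assume "\<not> \<bar>X t \<omega>\<bar> \<le> L"
    then have pos: "\<bar>X t \<omega>\<bar> - L > 0" by simp
    have sp: "\<omega> \<in> space M" using \<omega> by (simp add: past_def)
    obtain \<delta> where \<delta>: "\<delta> > 0" "\<And>r. r \<in> {0..} \<Longrightarrow> dist r t < \<delta> \<Longrightarrow> dist (X r \<omega>) (X t \<omega>) < \<bar>X t \<omega>\<bar> - L"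
      using X_cont[OF sp] t pos unfolding continuous_on_iff by (metis atLeast_iff less_imp_le)
    have "max 0 (t - \<delta>) < t" using t \<delta> by simp
    then obtain r where r: "r \<in> \<rat>" "max 0 (t - \<delta>) < r" "r < t" using Rats_dense_in_real by blast
    then have "dist (X r \<omega>) (X t \<omega>) < \<bar>X t \<omega>\<bar> - L" by (intro \<delta>(2)) (auto simp: dist_real_def)
    then have "\<bar>X r \<omega>\<bar> > L" by (simp add: dist_real_def)
    moreover have "\<omega> \<in> E r" using \<omega> r unfolding past_def by auto
    ultimately show False by (simp add: E_def)
  qed
  have gfin: "g t \<le> ennreal ((L + \<bar>x\<bar>)\<^sup>2)" if "0 < t" for t
  proof -
    have "g t \<le> (\<integral>\<^sup>+\<omega>. ennreal ((L + \<bar>x\<bar>)\<^sup>2) \<partial>M)"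
      unfolding g_def
    proof (rule nn_integral_mono)
      fix \<omega>
      have "(X t \<omega> - x)\<^sup>2 \<le> (L + \<bar>x\<bar>)\<^sup>2" if "\<omega> \<in> ?A t"
        using XL[OF \<open>0 < t\<close> that] L by (intro abs_le_square_iff[THEN iffD1]) linarith
      then show "indicator (?A t) \<omega> * ennreal ((X t \<omega> - x)\<^sup>2) \<le> ennreal ((L + \<bar>x\<bar>)\<^sup>2)"
        by (auto simp: indicator_def intro: ennreal_leI)
    qed
    then show ?thesis by (simp add: emeasure_space_1)
  qed
  \<comment> \<open>time zero is left out because \<open>past M E 0\<close> imposes no condition on the path\<close>
  define S where "S = (SUP t\<in>{0<..T}. g t)"
  have S: "S \<le> ennreal ((L + \<bar>x\<bar>)\<^sup>2)" unfolding S_def by (intro SUP_least gfin) auto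
  define G where "G = enn2real S"
  have SG: "S = ennreal G" unfolding G_def using S by (auto simp: ennreal_enn2real_if top_unique)
  have G0: "0 \<le> G" unfolding G_def by simp
  have gG: "g t \<le> ennreal G" if "0 < t" "t \<le> T" for t
    unfolding SG[symmetric] S_def by (rule SUP_upper) (use that in auto)
  have step: "g t \<le> ennreal (4 * c * (1 + G) * ksq K T)" if t: "0 < t" "t \<le> T" for t
  proof -
    have [measurable]: "?A t \<in> sets M" "X t \<in> borel_measurable M" using AM X_meas t by auto
    have [measurable]: "(\<lambda>\<omega>. X t \<omega> - x - drift t \<omega>) \<in> borel_measurable M"
      using ito[of t] t unfolding has_ito_integral_def by auto
    have [measurable]: "drift t \<in> borel_measurable M"
    proof -
      have "(\<lambda>\<omega>. (X t \<omega> - x) - (X t \<omega> - x - drift t \<omega>)) \<in> borel_measurable M" by measurable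
      then show ?thesis by simp
    qed
    have kt: "ksq K t \<le> ksq K T" by (rule ksq_mono[OF K t(2)])
    have GA: "(\<integral>\<^sup>+\<omega>. indicator (?A s) \<omega> * ennreal ((X s \<omega> - x)\<^sup>2) \<partial>M) \<le> ennreal G" if "0 < s" "s \<le> t" for s
      using gG[of s] that t by (simp add: g_def)
    have sb: "(\<integral>\<^sup>+s. indicator {0..t} s * (\<integral>\<^sup>+\<omega>. indicator (?A s) \<omega> * ennreal ((K (t - s) * f (X s \<omega>))\<^sup>2) \<partial>M) \<partial>lborel)
       \<le> ennreal (c * (1 + G) * ksq K T)" if f: "f \<in> borel_measurable borel" "\<And>y. (f y)\<^sup>2 \<le> c * (1 + (y - x)\<^sup>2)" for f
    proof -
      have "(\<integral>\<^sup>+s. indicator {0..t} s * (\<integral>\<^sup>+\<omega>. indicator (?A s) \<omega> * ennreal ((K (t - s) * f (X s \<omega>))\<^sup>2) \<partial>M) \<partial>lborel)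
         \<le> ennreal (c * (1 + 1 * G) * ksq K t)"
        by (rule slice_second_moment[OF f(1) c _ _ AM GA G0]) (use f in auto)
      also have "\<dots> \<le> ennreal (c * (1 + G) * ksq K T)" using c G0 kt by (intro ennreal_leI) (simp add: mult_left_mono)
      finally show ?thesis .
    qed
    have 1: "(\<integral>\<^sup>+\<omega>. indicator (?A t) \<omega> * ennreal ((drift t \<omega>)\<^sup>2) \<partial>M) \<le> ennreal (c * (1 + G) * ksq K T)"
    proof -
      have "(\<integral>\<^sup>+\<omega>. indicator (?A t) \<omega> * ennreal ((drift t \<omega>)\<^sup>2) \<partial>M)
        \<le> ennreal t * (\<integral>\<^sup>+s. indicator {0..t} s * (\<integral>\<^sup>+\<omega>. indicator (?A s) \<omega> * ennreal ((K (t - s) * b (X s \<omega>))\<^sup>2) \<partial>M) \<partial>lborel)"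
        by (rule drift_second_moment[OF _ past_antimono past_joint_measurable[OF E]]) (use t in auto)
      also have "\<dots> \<le> ennreal 1 * ennreal (c * (1 + G) * ksq K T)"
        using t T by (intro mult_mono sb b_meas gb ennreal_leI) auto
      finally show ?thesis by simp
    qed
    have 2: "(\<integral>\<^sup>+\<omega>. indicator (?A t) \<omega> * ennreal ((X t \<omega> - x - drift t \<omega>)\<^sup>2) \<partial>M) \<le> ennreal (c * (1 + G) * ksq K T)"
      by (rule order_trans[OF ito_integral_localized_bound[where E=E, OF ito _ E] sb]) (use t g\<sigma> in auto)
    have "g t \<le> (\<integral>\<^sup>+\<omega>. 2 * (indicator (?A t) \<omega> * ennreal ((drift t \<omega>)\<^sup>2))
        + 2 * (indicator (?A t) \<omega> * ennreal ((X t \<omega> - x - drift t \<omega>)\<^sup>2)) \<partial>M)"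
      unfolding g_def
    proof (rule nn_integral_mono)
      fix \<omega>
      show "indicator (?A t) \<omega> * ennreal ((X t \<omega> - x)\<^sup>2) \<le> 2 * (indicator (?A t) \<omega> * ennreal ((drift t \<omega>)\<^sup>2))
        + 2 * (indicator (?A t) \<omega> * ennreal ((X t \<omega> - x - drift t \<omega>)\<^sup>2))"
        using ennreal_square_add_le[of "drift t \<omega>" "X t \<omega> - x - drift t \<omega>"] by (auto simp: indicator_def)
    qed
    also have "\<dots> = 2 * (\<integral>\<^sup>+\<omega>. indicator (?A t) \<omega> * ennreal ((drift t \<omega>)\<^sup>2) \<partial>M)
        + 2 * (\<integral>\<^sup>+\<omega>. indicator (?A t) \<omega> * ennreal ((X t \<omega> - x - drift t \<omega>)\<^sup>2) \<partial>M)"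
      by (subst nn_integral_add) (auto simp: nn_integral_cmult)
    also have "\<dots> \<le> 2 * ennreal (c * (1 + G) * ksq K T) + 2 * ennreal (c * (1 + G) * ksq K T)"
      by (intro add_mono mult_left_mono 1 2) auto
    also have "\<dots> = ennreal (4 * c * (1 + G) * ksq K T)"
    proof -
      have "0 \<le> c * (1 + G) * ksq K T" using c G0 ksq_nonneg[of K T] by simp
      then show ?thesis by (simp add: two_ennreal ennreal_plus[symmetric] del: ennreal_plus)
    qed
    finally show ?thesis .
  qed
  have "ennreal G \<le> ennreal (4 * c * (1 + G) * ksq K T)"
    unfolding SG[symmetric] S_def by (rule SUP_least) (use step in auto)
  then have "G \<le> 4 * c * (1 + G) * ksq K T" using c G0 ksq_nonneg[of K T] by simp
  also have "\<dots> = 4 * c * ksq K T + (4 * c * ksq K T) * G" by (simp add: algebra_simps)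
  also have "\<dots> \<le> 4 * c * ksq K T + (1 / 2) * G" by (intro add_left_mono mult_right_mono T G0)
  finally have "G \<le> 8 * c * ksq K T" by simp
  then have "g T \<le> ennreal (8 * c * ksq K T)" using gG[of T] T by (meson ennreal_leI order_trans order_refl)
  then show ?thesis unfolding g_def E_def .
qed

text \<open>
  Every continuous path is bounded on \<open>[0, T]\<close>, so the localization can be removed by letting \<open>L \<rightarrow> \<infinity>\<close>.
\<close>

lemma second_moment:
  assumes c: "0 \<le> c" and gb: "\<And>y. (b y)\<^sup>2 \<le> c * (1 + (y - x)\<^sup>2)" and g\<sigma>: "\<And>y. (\<sigma> y)\<^sup>2 \<le> c * (1 + (y - x)\<^sup>2)"
    and T: "0 < T" "T \<le> 1" "4 * c * ksq K T \<le> 1 / 2"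
  shows "(\<integral>\<^sup>+\<omega>. ennreal ((X T \<omega> - x)\<^sup>2) \<partial>M) \<le> ennreal (8 * c * ksq K T)"
proof (rule nn_integral_le_limit)
  let ?A = "\<lambda>k::nat. past M (\<lambda>r. {\<omega>\<in>space M. \<bar>X r \<omega>\<bar> \<le> real k}) T"
  have E: "{\<omega>\<in>space M. \<bar>X r \<omega>\<bar> \<le> real k} \<in> sets (F r)" if "0 \<le> r" for r k
  proof -
    have "{\<omega>\<in>space (F r). \<bar>X r \<omega>\<bar> \<le> real k} \<in> sets (F r)" using X_F[OF that] by measurable
    then show ?thesis by (simp add: space_F[OF that])
  qed
  have [measurable]: "?A k \<in> sets M" for k
    using past_sets[where E="\<lambda>r. {\<omega>\<in>space M. \<bar>X r \<omega>\<bar> \<le> real k}" and s=T, OF E] bm T unfolding brownian_motion_def filtered_prob_space_def subalgebra_def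
    by (meson less_imp_le subsetD)
  have [measurable]: "X T \<in> borel_measurable M" using X_meas T by auto
  show "(\<lambda>\<omega>. indicator (?A k) \<omega> * ennreal ((X T \<omega> - x)\<^sup>2)) \<in> borel_measurable M" for k by measurable
  show "(\<integral>\<^sup>+\<omega>. indicator (?A k) \<omega> * ennreal ((X T \<omega> - x)\<^sup>2) \<partial>M) \<le> ennreal (8 * c * ksq K T)" for k
    by (rule localized_second_moment[OF c gb g\<sigma> T]) simp
  show "AE \<omega> in M. ennreal ((X T \<omega> - x)\<^sup>2) \<le> liminf (\<lambda>k. indicator (?A k) \<omega> * ennreal ((X T \<omega> - x)\<^sup>2))"
  proof (intro AE_I2 Liminf_bounded)
    fix \<omega> assume \<omega>: "\<omega> \<in> space M"
    have "continuous_on {0..T} (\<lambda>t. X t \<omega>)" by (rule continuous_on_subset[OF X_cont[OF \<omega>]]) auto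
    then have "bounded ((\<lambda>t. X t \<omega>) ` {0..T})" using compact_continuous_image compact_imp_bounded by blast
    then obtain L where "\<forall>y\<in>(\<lambda>t. X t \<omega>) ` {0..T}. norm y \<le> L" unfolding bounded_iff by blast
    then have L: "\<And>t. t \<in> {0..T} \<Longrightarrow> \<bar>X t \<omega>\<bar> \<le> L" by simp
    obtain k0 where "L \<le> real k0" using real_arch_simple by blast
    then have "\<omega> \<in> ?A k" if "k \<ge> k0" for k
    proof -
      have "\<bar>X r \<omega>\<bar> \<le> real k" if "0 \<le> r" "r < T" for r
        using L[of r] \<open>L \<le> real k0\<close> \<open>k \<ge> k0\<close> that by simp
      then show ?thesis using \<omega> by (auto simp: past_def)
    qed
    then show "\<forall>\<^sub>F k in sequentially. ennreal ((X T \<omega> - x)\<^sup>2) \<le> indicator (?A k) \<omega> * ennreal ((X T \<omega> - x)\<^sup>2)"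
      unfolding eventually_sequentially by (intro exI[of _ k0]) auto
  qed
qed simp

text \<open>
  For small \<open>T\<close> the increment \<open>X T - x\<close> is nearly the Wiener integral of \<open>\<sigma> x * K (T - s)\<close>. Of the two
  error terms, \<open>4 c T \<kappa>(T)\<close> comes from the drift, through Cauchy--Schwarz in time, and
  \<open>8 C\<^sup>2 a\<^bsup>\<alpha>\<^esup> \<kappa>(T)\<close> from replacing \<open>\<sigma> (X s)\<close> by \<open>\<sigma> x\<close>. The parameter \<open>a\<close> is any positive upper bound of the
  second moments.
\<close>

theorem solution_wiener_approx:
  assumes c: "0 \<le> c" and gb: "\<And>y. (b y)\<^sup>2 \<le> c * (1 + (y - x)\<^sup>2)" and g\<sigma>: "\<And>y. (\<sigma> y)\<^sup>2 \<le> c * (1 + (y - x)\<^sup>2)"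
    and T: "0 < T" "T \<le> 1" "4 * c * ksq K T \<le> 1 / 2"
    and holder: "\<And>y. \<bar>\<sigma> y - \<sigma> x\<bar> \<le> C * \<bar>y - x\<bar> powr \<alpha>" and \<alpha>: "0 < \<alpha>" "\<alpha> \<le> 1"
    and a: "0 < a" "8 * c * ksq K T \<le> a"
  shows "wiener_approx M B T (ksq K T * (4 * c * T + 8 * C\<^sup>2 * a powr \<alpha>)) (\<lambda>\<omega>. X T \<omega> - x) (\<lambda>s. \<sigma> x * kslice K T s)"
proof -
  let ?k = "ksq K T"
  have k0: "0 \<le> ?k" by (rule ksq_nonneg)
  have T0: "0 \<le> T" using T by simp
  have [measurable]: "kslice K T \<in> borel_measurable borel" by (rule kslice_measurable[OF K])
  have [measurable]: "X T \<in> borel_measurable M" using X_meas T by auto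
  have mom: "(\<integral>\<^sup>+\<omega>. indicator (space M) \<omega> * ennreal ((X s \<omega> - x)\<^sup>2) \<partial>M) \<le> ennreal (8 * c * ?k)" if s: "0 < s" "s \<le> T" for s
  proof -
    have ks: "4 * c * ksq K s \<le> 4 * c * ?k" using ksq_mono[OF K s(2)] c by (intro mult_left_mono) auto
    have "(\<integral>\<^sup>+\<omega>. indicator (space M) \<omega> * ennreal ((X s \<omega> - x)\<^sup>2) \<partial>M) = (\<integral>\<^sup>+\<omega>. ennreal ((X s \<omega> - x)\<^sup>2) \<partial>M)"
      by (intro nn_integral_cong) simp
    also have "\<dots> \<le> ennreal (8 * c * ksq K s)" by (rule second_moment[OF c gb g\<sigma>]) (use s T ks in auto)
    also have "\<dots> \<le> ennreal (8 * c * ?k)" using ks by (intro ennreal_leI) simp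
    finally show ?thesis .
  qed
  have G0: "0 \<le> 8 * c * ?k" using c k0 by simp
  let ?v = "2 * C\<^sup>2 * a powr \<alpha> * ?k"
  have v0: "0 \<le> ?v" using k0 by simp
  have growth: "(\<sigma> y - \<sigma> x)\<^sup>2 \<le> C\<^sup>2 * a powr \<alpha> * (1 + (1 / a) * (y - x)\<^sup>2)" for y
  proof -
    have "(\<sigma> y - \<sigma> x)\<^sup>2 \<le> (C * \<bar>y - x\<bar> powr \<alpha>)\<^sup>2"
      using holder[of y] by (intro abs_le_square_iff[THEN iffD1]) (use abs_ge_self order_trans in blast)
    also have "\<dots> = C\<^sup>2 * (\<bar>y - x\<bar> powr \<alpha>)\<^sup>2" by (simp add: power_mult_distrib)
    also have "\<dots> \<le> C\<^sup>2 * (a powr \<alpha> * (1 + (1 / a) * (y - x)\<^sup>2))"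
      by (intro mult_left_mono powr_interpolation a \<alpha>) simp
    finally show ?thesis by (simp add: mult.assoc)
  qed
  have err: "(\<integral>\<^sup>+s. indicator {0..T} s * (\<integral>\<^sup>+\<omega>. ennreal ((K (T - s) * \<sigma> (X s \<omega>) - \<sigma> x * kslice K T s)\<^sup>2) \<partial>M) \<partial>lborel) \<le> ennreal ?v"
  proof -
    have "(\<integral>\<^sup>+s. indicator {0..T} s * (\<integral>\<^sup>+\<omega>. ennreal ((K (T - s) * \<sigma> (X s \<omega>) - \<sigma> x * kslice K T s)\<^sup>2) \<partial>M) \<partial>lborel)
       = (\<integral>\<^sup>+s. indicator {0..T} s * (\<integral>\<^sup>+\<omega>. indicator (space M) \<omega> * ennreal ((K (T - s) * (\<lambda>y. \<sigma> y - \<sigma> x) (X s \<omega>))\<^sup>2) \<partial>M) \<partial>lborel)"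
    proof (rule nn_integral_cong)
      fix s
      have "(\<integral>\<^sup>+\<omega>. ennreal ((K (T - s) * \<sigma> (X s \<omega>) - \<sigma> x * kslice K T s)\<^sup>2) \<partial>M)
        = (\<integral>\<^sup>+\<omega>. indicator (space M) \<omega> * ennreal ((K (T - s) * (\<sigma> (X s \<omega>) - \<sigma> x))\<^sup>2) \<partial>M)" if "s \<in> {0..T}"
        by (rule nn_integral_cong) (use that in \<open>simp add: kslice_def algebra_simps\<close>)
      then show "indicator {0..T} s * (\<integral>\<^sup>+\<omega>. ennreal ((K (T - s) * \<sigma> (X s \<omega>) - \<sigma> x * kslice K T s)\<^sup>2) \<partial>M)
        = indicator {0..T} s * (\<integral>\<^sup>+\<omega>. indicator (space M) \<omega> * ennreal ((K (T - s) * (\<lambda>y. \<sigma> y - \<sigma> x) (X s \<omega>))\<^sup>2) \<partial>M)"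
        by (cases "s \<in> {0..T}") simp_all
    qed
    also have "\<dots> \<le> ennreal (C\<^sup>2 * a powr \<alpha> * (1 + (1 / a) * (8 * c * ?k)) * ?k)"
      by (rule slice_second_moment[OF _ _ _ growth _ mom G0]) (use a in auto)
    also have "\<dots> \<le> ennreal ?v"
    proof (rule ennreal_leI)
      have "(1 / a) * (8 * c * ?k) \<le> 1" using a by simp
      then have "C\<^sup>2 * a powr \<alpha> * (1 + (1 / a) * (8 * c * ?k)) * ?k \<le> C\<^sup>2 * a powr \<alpha> * 2 * ?k"
        using k0 by (intro mult_right_mono mult_left_mono) auto
      then show "C\<^sup>2 * a powr \<alpha> * (1 + (1 / a) * (8 * c * ?k)) * ?k \<le> ?v" by (simp add: mult_ac)
    qed
    finally show ?thesis .
  qed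
  have ap: "wiener_approx M B T (2 * ?v) (\<lambda>\<omega>. X T \<omega> - x - drift T \<omega>) (\<lambda>s. \<sigma> x * kslice K T s)"
    by (rule wiener_approx_ito_integral[OF ito[OF T0] T0 _ _ _ err v0])
      (use kslice_sq(1)[OF K] kslice_outside in \<open>auto simp: power_mult_distrib\<close>)
  have dr: "(\<integral>\<^sup>+\<omega>. ennreal (((X T \<omega> - x) - (X T \<omega> - x - drift T \<omega>))\<^sup>2) \<partial>M) \<le> ennreal (T * (2 * c * ?k))"
  proof -
    have "(\<integral>\<^sup>+\<omega>. ennreal (((X T \<omega> - x) - (X T \<omega> - x - drift T \<omega>))\<^sup>2) \<partial>M) = (\<integral>\<^sup>+\<omega>. indicator (space M) \<omega> * ennreal ((drift T \<omega>)\<^sup>2) \<partial>M)"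
      by (intro nn_integral_cong) simp
    also have "\<dots> \<le> ennreal T * (\<integral>\<^sup>+s. indicator {0..T} s * (\<integral>\<^sup>+\<omega>. indicator (space M) \<omega> * ennreal ((K (T - s) * b (X s \<omega>))\<^sup>2) \<partial>M) \<partial>lborel)"
    proof (rule drift_second_moment[OF T0])
      have "(\<lambda>z. indicator (space M) (snd z) :: real) \<in> borel_measurable (borel \<Otimes>\<^sub>M M)"
        by (rule measurable_compose[OF measurable_snd]) simp
      then show "(\<lambda>(s, \<omega>). indicator (space M) \<omega> :: real) \<in> borel_measurable (borel \<Otimes>\<^sub>M M)"
        by (simp add: case_prod_beta')
    qed simp
    also have "\<dots> \<le> ennreal T * ennreal (c * (1 + 1 * (8 * c * ?k)) * ?k)"
      by (intro mult_left_mono slice_second_moment[OF b_meas c _ _ _ mom G0]) (use gb in auto)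
    also have "\<dots> = ennreal (T * (c * (1 + 8 * c * ?k) * ?k))" using T c k0 by (simp add: ennreal_mult)
    also have "\<dots> \<le> ennreal (T * (2 * c * ?k))"
    proof (rule ennreal_leI, rule mult_left_mono)
      have "c * (1 + 8 * c * ?k) * ?k \<le> c * 2 * ?k" using T c k0 by (intro mult_right_mono mult_left_mono) auto
      then show "c * (1 + 8 * c * ?k) * ?k \<le> 2 * c * ?k" by (simp add: mult_ac)
    qed (rule T0)
    finally show ?thesis .
  qed
  have "wiener_approx M B T (2 * (T * (2 * c * ?k)) + 2 * (2 * ?v)) (\<lambda>\<omega>. X T \<omega> - x) (\<lambda>s. \<sigma> x * kslice K T s)"
    by (rule wiener_approx_perturb[OF ap _ dr]) (use T c k0 v0 in auto)
  then show ?thesis by (simp add: algebra_simps)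
qed

end

section \<open>Convergence of the rescaled solution\<close>

lemma holder_continuous:
  fixes f :: "real \<Rightarrow> real"
  assumes h: "\<And>y z. \<bar>f z - f y\<bar> \<le> C * \<bar>z - y\<bar> powr \<alpha>" and \<alpha>: "0 < \<alpha>"
  shows "continuous_on UNIV f"
  unfolding continuous_on_def
proof
  fix y :: real
  have "((\<lambda>z. f z - f y) \<longlongrightarrow> 0) (at y)"
  proof (rule Lim_null_comparison)
    show "\<forall>\<^sub>F z in at y. norm (f z - f y) \<le> C * \<bar>z - y\<bar> powr \<alpha>" using h by simp
    have "((\<lambda>z. \<bar>z - y\<bar>) \<longlongrightarrow> \<bar>y - y\<bar>) (at y)" by (intro tendsto_intros)
    then have "((\<lambda>z. \<bar>z - y\<bar> powr \<alpha>) \<longlongrightarrow> 0) (at y)" by (intro tendsto_zero_powrI[OF _ tendsto_const]) (use \<alpha> in auto)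
    then show "((\<lambda>z. C * \<bar>z - y\<bar> powr \<alpha>) \<longlongrightarrow> 0) (at y)" by (rule tendsto_mult_right_zero)
  qed
  then show "(f \<longlongrightarrow> f y) (at y within UNIV)" by (simp add: LIM_zero_iff)
qed

text \<open>
  Linear growth around a base point \<open>z\<close>, with a constant that is uniform for \<open>z\<close> near \<open>z\<^sub>0\<close>; this
  uniformity is needed because the initial values vary with \<open>n\<close>.
\<close>

lemma holder_growth:
  fixes f :: "real \<Rightarrow> real"
  assumes h: "\<And>y z. \<bar>f z - f y\<bar> \<le> C * \<bar>z - y\<bar> powr \<alpha>" and \<alpha>: "0 < \<alpha>" "\<alpha> \<le> 1" and C: "0 \<le> C" and z: "\<bar>z - z\<^sub>0\<bar> \<le> 1"
  shows "(f y)\<^sup>2 \<le> (2 * (\<bar>f z\<^sub>0\<bar> + C)\<^sup>2 + 2 * C\<^sup>2) * (1 + (y - z)\<^sup>2)"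
proof -
  have "\<bar>z - z\<^sub>0\<bar> powr \<alpha> \<le> 1" using z \<alpha> by (intro powr_le1) auto
  then have "C * \<bar>z - z\<^sub>0\<bar> powr \<alpha> \<le> C" using C by (simp add: mult_left_le)
  then have "\<bar>f z\<bar> \<le> \<bar>f z\<^sub>0\<bar> + C" using h[of z z\<^sub>0] by linarith
  then have "\<bar>f z\<bar> \<le> \<bar>\<bar>f z\<^sub>0\<bar> + C\<bar>" using C by simp
  then have 1: "(f z)\<^sup>2 \<le> (\<bar>f z\<^sub>0\<bar> + C)\<^sup>2" by (simp only: abs_le_square_iff)
  have "(\<bar>y - z\<bar> powr \<alpha>)\<^sup>2 \<le> 1 + (y - z)\<^sup>2" using powr_interpolation[of 1 \<alpha> "y - z"] \<alpha> by simp
  then have "(C * \<bar>y - z\<bar> powr \<alpha>)\<^sup>2 \<le> C\<^sup>2 * (1 + (y - z)\<^sup>2)" by (simp add: power_mult_distrib mult_left_mono)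
  moreover have "(f y - f z)\<^sup>2 \<le> (C * \<bar>y - z\<bar> powr \<alpha>)\<^sup>2"
    using h[of y z] C by (intro abs_le_square_iff[THEN iffD1]) simp
  ultimately have 2: "(f y - f z)\<^sup>2 \<le> C\<^sup>2 * (1 + (y - z)\<^sup>2)" by simp
  have "(f y)\<^sup>2 \<le> 2 * (f z)\<^sup>2 + 2 * (f y - f z)\<^sup>2"
    using sum_squares_bound[of "f z" "f y - f z"] power2_sum[of "f z" "f y - f z"] by simp
  also have "\<dots> \<le> 2 * ((\<bar>f z\<^sub>0\<bar> + C)\<^sup>2 * (1 + (y - z)\<^sup>2)) + 2 * (C\<^sup>2 * (1 + (y - z)\<^sup>2))"
  proof -
    have "(\<bar>f z\<^sub>0\<bar> + C)\<^sup>2 * 1 \<le> (\<bar>f z\<^sub>0\<bar> + C)\<^sup>2 * (1 + (y - z)\<^sup>2)" by (intro mult_left_mono) auto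
    then show ?thesis using 1 2 by linarith
  qed
  finally show ?thesis by (simp add: algebra_simps)
qed

lemma integral_weighted_sum_sq:
  fixes f :: "'i \<Rightarrow> 'a \<Rightarrow> real"
  assumes f[measurable]: "\<And>i. i \<in> S \<Longrightarrow> f i \<in> borel_measurable N" and f2: "\<And>i. i \<in> S \<Longrightarrow> integrable N (\<lambda>x. (f i x)\<^sup>2)"
  shows "(\<integral>x. (\<Sum>i\<in>S. w i * f i x)\<^sup>2 \<partial>N) = (\<Sum>i\<in>S. \<Sum>j\<in>S. w i * w j * (\<integral>x. f i x * f j x \<partial>N))"
proof -
  have ij: "integrable N (\<lambda>x. f i x * f j x)" if "i \<in> S" "j \<in> S" for i j
  proof (rule Bochner_Integration.integrable_bound[OF Bochner_Integration.integrable_add[OF f2[OF that(1)] f2[OF that(2)]]])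
    have "\<bar>y * z\<bar> \<le> y\<^sup>2 + z\<^sup>2" for y z :: real
    proof -
      have "2 * \<bar>y * z\<bar> \<le> y\<^sup>2 + z\<^sup>2" using sum_squares_bound[of "\<bar>y\<bar>" "\<bar>z\<bar>"] by (simp add: abs_mult)
      then show ?thesis using abs_ge_zero[of "y * z"] by linarith
    qed
    then show "AE x in N. norm (f i x * f j x) \<le> norm ((f i x)\<^sup>2 + (f j x)\<^sup>2)" by simp
  qed (use that in measurable)
  have "(\<Sum>i\<in>S. w i * f i x)\<^sup>2 = (\<Sum>i\<in>S. \<Sum>j\<in>S. w i * w j * (f i x * f j x))" for x
    unfolding power2_eq_square sum_product by (intro sum.cong refl) (simp add: mult_ac)
  then have "(\<integral>x. (\<Sum>i\<in>S. w i * f i x)\<^sup>2 \<partial>N) = (\<integral>x. (\<Sum>i\<in>S. \<Sum>j\<in>S. w i * w j * (f i x * f j x)) \<partial>N)" by simp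
  also have "\<dots> = (\<Sum>i\<in>S. \<integral>x. (\<Sum>j\<in>S. w i * w j * (f i x * f j x)) \<partial>N)"
    by (intro Bochner_Integration.integral_sum Bochner_Integration.integrable_sum integrable_mult_right ij)
  also have "\<dots> = (\<Sum>i\<in>S. \<Sum>j\<in>S. \<integral>x. w i * w j * (f i x * f j x) \<partial>N)"
    by (intro sum.cong refl Bochner_Integration.integral_sum integrable_mult_right ij)
  also have "\<dots> = (\<Sum>i\<in>S. \<Sum>j\<in>S. w i * w j * (\<integral>x. f i x * f j x \<partial>N))" by simp
  finally show ?thesis .
qed

lemma vec_lambda_borel_measurable:
  assumes "\<And>j. f j \<in> borel_measurable M"
  shows "(\<lambda>\<omega>. (\<chi> j. f j \<omega>) :: real ^ 'n::finite) \<in> borel_measurable M"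
proof (subst borel_measurable_euclidean_space, intro ballI)
  fix i :: "real ^ 'n" assume "i \<in> Basis"
  then obtain k where "i = axis k 1" by (auto simp: Basis_vec_def)
  then show "(\<lambda>\<omega>. (\<chi> j. f j \<omega>) \<bullet> i) \<in> borel_measurable M" using assms by (simp add: inner_axis)
qed

lemma nn_integral_norm_vec_sq:
  fixes f :: "'n::finite \<Rightarrow> 'a \<Rightarrow> real"
  assumes "\<And>j. f j \<in> borel_measurable M"
  shows "(\<integral>\<^sup>+\<omega>. ennreal ((norm (\<chi> j. f j \<omega>))\<^sup>2) \<partial>M) = (\<Sum>j\<in>UNIV. \<integral>\<^sup>+\<omega>. ennreal ((f j \<omega>)\<^sup>2) \<partial>M)"
proof -
  have "ennreal ((norm (\<chi> j. f j \<omega>))\<^sup>2) = (\<Sum>j\<in>UNIV. ennreal ((f j \<omega>)\<^sup>2))" for \<omega>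
  proof -
    have "(norm (\<chi> j. f j \<omega>))\<^sup>2 = (\<Sum>j\<in>UNIV. (f j \<omega>)\<^sup>2)"
      unfolding power2_norm_eq_inner inner_vec_def by (simp add: power2_eq_square)
    then show ?thesis by (simp add: sum_ennreal)
  qed
  then have "(\<integral>\<^sup>+\<omega>. ennreal ((norm (\<chi> j. f j \<omega>))\<^sup>2) \<partial>M) = (\<integral>\<^sup>+\<omega>. (\<Sum>j\<in>UNIV. ennreal ((f j \<omega>)\<^sup>2)) \<partial>M)"
    by (simp only:)
  also have "\<dots> = (\<Sum>j\<in>UNIV. \<integral>\<^sup>+\<omega>. ennreal ((f j \<omega>)\<^sup>2) \<partial>M)"
    using assms by (intro nn_integral_sum) measurable
  finally show ?thesis .
qed

lemma scaling_ksq: "scaling K n = inverse (ksq K (1 / real n))"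
  by (simp add: scaling_def ksq_def)

lemma (in brownian) wiener_integral_second_moment:
  assumes J: "has_ito_integral M F B t (\<lambda>s \<omega>. K (t - s)) R" and t: "0 \<le> t" and K: "L2_loc K"
  shows "(\<integral>\<^sup>+\<omega>. ennreal ((R \<omega>)\<^sup>2) \<partial>M) \<le> ennreal (ksq K t)"
proof -
  have "(\<integral>\<^sup>+\<omega>. ennreal ((R \<omega>)\<^sup>2) \<partial>M) \<le> (\<integral>\<^sup>+s. indicator {0..t} s * (\<integral>\<^sup>+\<omega>. ennreal ((K (t - s))\<^sup>2) \<partial>M) \<partial>lborel)"
    by (rule ito_integral_second_moment[OF J t])
  also have "\<dots> = (\<integral>\<^sup>+s. ennreal ((kslice K t s)\<^sup>2) \<partial>lborel)"
    by (intro nn_integral_cong) (auto simp: kslice_def indicator_def emeasure_space_1)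
  also have "\<dots> = ennreal (ksq K t)"
    using nn_integral_eq_integral[OF kslice_sq(1)[OF K, of t]] kslice_sq(2)[OF K, of t] by simp
  finally show ?thesis .
qed

lemma (in brownian) wiener_approx_wiener_integral:
  assumes J: "has_ito_integral M F B t (\<lambda>s \<omega>. K (t - s)) R" and t: "0 \<le> t" and K: "L2_loc K"
  shows "wiener_approx M B t 0 R (kslice K t)"
proof -
  have "wiener_approx M B t (2 * 0) R (kslice K t)"
  proof (rule wiener_approx_ito_integral[OF J t kslice_measurable[OF K] kslice_sq(1)[OF K] kslice_outside])
    have "(\<integral>\<^sup>+s. indicator {0..t} s * (\<integral>\<^sup>+\<omega>. ennreal ((K (t - s) - kslice K t s)\<^sup>2) \<partial>M) \<partial>lborel) = (\<integral>\<^sup>+s. 0 \<partial>(lborel :: real measure))"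
      by (intro nn_integral_cong) (auto simp: kslice_def indicator_def)
    then show "(\<integral>\<^sup>+s. indicator {0..t} s * (\<integral>\<^sup>+\<omega>. ennreal ((K (t - s) - kslice K t s)\<^sup>2) \<partial>M) \<partial>lborel) \<le> ennreal 0" by simp
  qed auto
  then show ?thesis by simp
qed

theorem theorem2p2:
  fixes b \<sigma> K Kbar :: "real \<Rightarrow> real"
    and C Cstar \<chi>\<^sub>b \<chi>\<^sub>\<sigma> \<gamma> \<gamma>\<^sub>s xbar :: real
    and x :: "nat \<Rightarrow> real"
    and M :: "nat \<Rightarrow> 'a measure" and F :: "nat \<Rightarrow> real \<Rightarrow> 'a measure"
    and B X :: "nat \<Rightarrow> real \<Rightarrow> 'a \<Rightarrow> real"
    and \<tau> :: "'N::{finite,linorder} \<Rightarrow> real"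
    and W :: "'b measure" and G :: "real \<Rightarrow> 'b measure"
    and \<beta> J Y :: "real \<Rightarrow> 'b \<Rightarrow> real"
  assumes K: "L2_loc K"
    and pos: "C > 0" "Cstar > 0" "\<gamma> > 0" "\<gamma>\<^sub>s > 0"
    and chi: "\<chi>\<^sub>b \<in> {0<..1}" "\<chi>\<^sub>\<sigma> \<in> {0<..1}"
    and b_Holder: "\<And>y z. \<bar>b z - b y\<bar> \<le> C * \<bar>z - y\<bar> powr \<chi>\<^sub>b"
    and \<sigma>_Holder: "\<And>y z. \<bar>\<sigma> z - \<sigma> y\<bar> \<le> C * \<bar>z - y\<bar> powr \<chi>\<^sub>\<sigma>"
    and K_lower: "\<And>t. t \<in> {0<..1} \<Longrightarrow> Cstar * t powr (2 * \<gamma>\<^sub>s) \<le> (LINT s:{0..t}|lborel. (K s)\<^sup>2)"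
    and K_upper: "\<And>t. t \<in> {0<..1} \<Longrightarrow> (LINT s:{0..t}|lborel. (K s)\<^sup>2) \<le> C * t powr (2 * \<gamma>)"
    and X: "\<And>n. n \<ge> 1 \<Longrightarrow> continuous_weak_solution K b \<sigma> (x n) (M n) (F n) (B n) (X n)"
    and x_lim: "x \<longlonglongrightarrow> xbar"
    and nondeg: "\<sigma> xbar \<noteq> 0"
    and times: "strict_mono \<tau>" "\<And>j. 0 < \<tau> j"
    and i: "\<gamma>\<^sub>s \<ge> \<gamma>" "\<gamma>\<^sub>s < min (\<gamma> + 1 / 2) (\<gamma> * (1 + \<chi>\<^sub>\<sigma>))"
    and ii: "L2_loc Kbar"
      "\<And>s t. 0 \<le> s \<Longrightarrow> s \<le> t \<Longrightarrow> t \<le> max 1 (Max (range \<tau>)) \<Longrightarrow>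
        (\<lambda>n. scaling K n *
             (LINT r:{0..s / real n}|lborel. K ((t - s) / real n + r) * K r))
        \<longlonglongrightarrow> (LINT r:{0..s}|lborel. Kbar (t - s + r) * Kbar r)"
    and \<beta>: "brownian_motion W G \<beta>"
    and J: "\<And>t. t \<ge> 0 \<Longrightarrow> has_ito_integral W G \<beta> t (\<lambda>s \<omega>. Kbar (t - s)) (J t)"
    and Y: "\<And>t \<omega>. t \<ge> 0 \<Longrightarrow> Y t \<omega> = \<sigma> xbar * J t \<omega>"
  shows "converges_in_distribution M
           (\<lambda>n \<omega>. \<chi> j. sqrt (scaling K n) * (X n (\<tau> j / real n) \<omega> - x n))
           W (\<lambda>\<omega>. \<chi> j. Y (\<tau> j) \<omega>)"
proof -
  define \<theta> where "\<theta> = Max (range \<tau>)"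
  have \<theta>: "\<tau> j \<le> \<theta>" for j unfolding \<theta>_def by (intro Max_ge) auto
  define \<Lambda> where "\<Lambda> n = scaling K n" for n
  have \<Lambda>0: "0 \<le> \<Lambda> n" for n unfolding \<Lambda>_def scaling_ksq using ksq_nonneg[of K] by simp
  have cov_le: "(\<lambda>n. \<Lambda> n * (\<integral>s. kslice K (\<tau> i / real n) s * kslice K (\<tau> j / real n) s \<partial>lborel))
      \<longlonglongrightarrow> (\<integral>s. kslice Kbar (\<tau> i) s * kslice Kbar (\<tau> j) s \<partial>lborel)" if "\<tau> i \<le> \<tau> j" for i j
  proof -
    have "(\<integral>s. kslice K (\<tau> i / real n) s * kslice K (\<tau> j / real n) s \<partial>lborel)
       = (LINT r:{0..\<tau> i / real n}|lborel. K ((\<tau> j - \<tau> i) / real n + r) * K r)" for n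
      using that times(2)[of i] by (subst kslice_prod) (auto simp: diff_divide_distrib divide_right_mono)
    moreover have "(\<integral>s. kslice Kbar (\<tau> i) s * kslice Kbar (\<tau> j) s \<partial>lborel)
       = (LINT r:{0..\<tau> i}|lborel. Kbar (\<tau> j - \<tau> i + r) * Kbar r)"
      using that times(2)[of i] by (intro kslice_prod) auto
    moreover have "\<tau> j \<le> max 1 (Max (range \<tau>))" using \<theta>[of j] by (simp add: \<theta>_def le_max_iff_disj)
    ultimately show ?thesis
      using ii(2)[of "\<tau> i" "\<tau> j"] that times(2)[of i] by (simp add: \<Lambda>_def)
  qed
  have cov: "(\<lambda>n. \<Lambda> n * (\<integral>s. kslice K (\<tau> i / real n) s * kslice K (\<tau> j / real n) s \<partial>lborel))
      \<longlonglongrightarrow> (\<integral>s. kslice Kbar (\<tau> i) s * kslice Kbar (\<tau> j) s \<partial>lborel)" for i j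
    using cov_le[of i j] cov_le[of j i] by (cases "\<tau> i \<le> \<tau> j") (simp_all add: mult.commute)
  have var: "(\<lambda>n. \<Lambda> n * ksq K (\<tau> j / real n)) \<longlonglongrightarrow> ksq Kbar (\<tau> j)" for j
    using cov[of j j] kslice_sq(2)[OF K] kslice_sq(2)[OF ii(1)] by (simp add: power2_eq_square[symmetric])
  have T0: "(\<lambda>n. \<tau> j / real n) \<longlonglongrightarrow> 0" for j
    by (rule tendsto_divide_0[OF tendsto_const]) (rule filterlim_at_top_imp_at_infinity[OF filterlim_real_sequentially])
  have small: "\<forall>\<^sub>F n in sequentially. 0 < \<tau> j / real n \<and> \<tau> j / real n \<le> 1" for j
  proof -
    have "\<forall>\<^sub>F n in sequentially. \<tau> j / real n < 1" by (rule order_tendstoD(2)[OF T0]) simp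
    then show ?thesis using eventually_gt_at_top[of 0] by eventually_elim (use times(2)[of j] in auto)
  qed
  have ksq0: "(\<lambda>n. ksq K (\<tau> j / real n)) \<longlonglongrightarrow> 0" for j
  proof (rule tendsto_sandwich[OF _ _ tendsto_const])
    show "\<forall>\<^sub>F n in sequentially. ksq K (\<tau> j / real n) \<le> C * (\<tau> j / real n) powr (2 * \<gamma>)"
      using small[of j] by eventually_elim (use K_upper in \<open>simp add: ksq_def\<close>)
    have "(\<lambda>n. (\<tau> j / real n) powr (2 * \<gamma>)) \<longlonglongrightarrow> 0"
      by (rule tendsto_zero_powrI[OF T0 tendsto_const]) (use times(2)[of j] pos in \<open>auto intro!: always_eventually divide_nonneg_nonneg less_imp_le\<close>)
    then show "(\<lambda>n. C * (\<tau> j / real n) powr (2 * \<gamma>)) \<longlonglongrightarrow> 0" by (rule tendsto_mult_right_zero)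
  qed (simp add: ksq_nonneg)
  \<comment> \<open>one constant for both coefficients and all base points within distance one of the limit\<close>
  define c where "c = (2 * (\<bar>b xbar\<bar> + C)\<^sup>2 + 2 * C\<^sup>2) + (2 * (\<bar>\<sigma> xbar\<bar> + C)\<^sup>2 + 2 * C\<^sup>2)"
  have c0: "0 \<le> c" unfolding c_def by simp
  have growth: "(b y)\<^sup>2 \<le> c * (1 + (y - z)\<^sup>2)" "(\<sigma> y)\<^sup>2 \<le> c * (1 + (y - z)\<^sup>2)" if "\<bar>z - xbar\<bar> \<le> 1" for y z
  proof -
    have "(b y)\<^sup>2 \<le> (2 * (\<bar>b xbar\<bar> + C)\<^sup>2 + 2 * C\<^sup>2) * (1 + (y - z)\<^sup>2)"
      by (rule holder_growth[OF b_Holder]) (use chi pos that in auto)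
    also have "\<dots> \<le> c * (1 + (y - z)\<^sup>2)" unfolding c_def by (intro mult_right_mono) auto
    finally show "(b y)\<^sup>2 \<le> c * (1 + (y - z)\<^sup>2)" .
    have "(\<sigma> y)\<^sup>2 \<le> (2 * (\<bar>\<sigma> xbar\<bar> + C)\<^sup>2 + 2 * C\<^sup>2) * (1 + (y - z)\<^sup>2)"
      by (rule holder_growth[OF \<sigma>_Holder]) (use chi pos that in auto)
    also have "\<dots> \<le> c * (1 + (y - z)\<^sup>2)" unfolding c_def by (intro mult_right_mono) auto
    finally show "(\<sigma> y)\<^sup>2 \<le> c * (1 + (y - z)\<^sup>2)" .
  qed
  have [measurable]: "b \<in> borel_measurable borel" "\<sigma> \<in> borel_measurable borel"
    using holder_continuous[OF b_Holder] holder_continuous[OF \<sigma>_Holder] chi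
    by (auto intro: borel_measurable_continuous_onI)
  have VS: "volterra_solution (M n) (F n) (B n) K b \<sigma> (x n) (X n)" if "n \<ge> 1" for n
    using X[OF that] K by unfold_locales (auto simp: continuous_weak_solution_def)
  interpret W: brownian W G \<beta> by unfold_locales (rule \<beta>)
  \<comment> \<open>the summand \<open>1 / n\<close> makes \<open>a\<close> visibly positive\<close>
  define a where "a j n = 8 * c * ksq K (\<tau> j / real n) + 1 / real n" for j n
  define e where "e j n = ksq K (\<tau> j / real n) * (4 * c * (\<tau> j / real n) + 8 * C\<^sup>2 * a j n powr \<chi>\<^sub>\<sigma>)" for j n
  define \<rho> where "\<rho> n = (\<Sum>j\<in>UNIV. \<Lambda> n * e j n)" for n
  have e0: "0 \<le> e j n" for j n
    unfolding e_def
    by (intro mult_nonneg_nonneg add_nonneg_nonneg ksq_nonneg c0 divide_nonneg_nonneg less_imp_le[OF times(2)]) simp_all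
  have ev: "\<forall>\<^sub>F n in sequentially. n \<ge> 1 \<and> \<bar>x n - xbar\<bar> \<le> 1 \<and> (\<forall>j. 0 < \<tau> j / real n \<and> \<tau> j / real n \<le> 1 \<and> 4 * c * ksq K (\<tau> j / real n) \<le> 1 / 2)"
  proof -
    have "\<forall>\<^sub>F n in sequentially. dist (x n) xbar < 1" using x_lim by (rule tendstoD) simp
    moreover have "\<forall>\<^sub>F n in sequentially. \<forall>j. 0 < \<tau> j / real n \<and> \<tau> j / real n \<le> 1 \<and> 4 * c * ksq K (\<tau> j / real n) \<le> 1 / 2"
    proof (intro eventually_all_finite)
      fix j
      have "\<forall>\<^sub>F n in sequentially. 4 * c * ksq K (\<tau> j / real n) < 1 / 2"
        by (rule order_tendstoD(2)[OF tendsto_mult_right_zero[OF ksq0]]) simp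
      with small[of j] show "\<forall>\<^sub>F n in sequentially. 0 < \<tau> j / real n \<and> \<tau> j / real n \<le> 1 \<and> 4 * c * ksq K (\<tau> j / real n) \<le> 1 / 2"
        by eventually_elim (simp only: less_imp_le simp_thms)
    qed
    ultimately show ?thesis using eventually_ge_at_top[of 1]
      by eventually_elim (auto simp: dist_real_def)
  qed
  have a_lim: "a j \<longlonglongrightarrow> 0" for j
  proof -
    have "(\<lambda>n. 8 * c * ksq K (\<tau> j / real n) + 1 / real n) \<longlonglongrightarrow> 8 * c * 0 + 0"
      by (intro tendsto_intros ksq0 lim_1_over_n)
    then show ?thesis by (simp add: a_def[abs_def])
  qed
  have a_nonneg: "0 \<le> a j n" for j n unfolding a_def using c0 ksq_nonneg[of K "\<tau> j / real n"] by simp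
  have \<rho>0: "0 \<le> \<rho> n" for n
    unfolding \<rho>_def by (intro sum_nonneg mult_nonneg_nonneg \<Lambda>0 e0)
  have \<rho>_lim: "\<rho> \<longlonglongrightarrow> 0"
  proof -
    have "(\<lambda>n. \<Sum>j\<in>UNIV. (\<Lambda> n * ksq K (\<tau> j / real n)) * (4 * c * (\<tau> j / real n) + 8 * C\<^sup>2 * a j n powr \<chi>\<^sub>\<sigma>))
       \<longlonglongrightarrow> (\<Sum>j\<in>UNIV. ksq Kbar (\<tau> j) * (4 * c * 0 + 8 * C\<^sup>2 * 0))"
      by (intro tendsto_intros var T0 tendsto_zero_powrI[OF a_lim tendsto_const]) (use a_nonneg chi in auto)
    then show ?thesis by (simp add: \<rho>_def[abs_def] e_def mult.assoc)
  qed
  let ?Z = "\<lambda>n j \<omega>. sqrt (\<Lambda> n) * (X n (\<tau> j / real n) \<omega> - x n)"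
  have approxX: "wiener_approx (M n) (B n) \<theta> (\<rho> n) (?Z n j) (\<lambda>s. sqrt (\<Lambda> n) * (\<sigma> (x n) * kslice K (\<tau> j / real n) s))"
    if n: "n \<ge> 1 \<and> \<bar>x n - xbar\<bar> \<le> 1 \<and> (\<forall>j. 0 < \<tau> j / real n \<and> \<tau> j / real n \<le> 1 \<and> 4 * c * ksq K (\<tau> j / real n) \<le> 1 / 2)" for n j
  proof -
    interpret volterra_solution "M n" "F n" "B n" K b \<sigma> "x n" "X n" by (rule VS) (use n in auto)
    let ?T = "\<tau> j / real n"
    have T: "0 < ?T" "?T \<le> 1" "4 * c * ksq K ?T \<le> 1 / 2" using n by auto
    have "wiener_approx (M n) (B n) ?T (e j n) (\<lambda>\<omega>. X n ?T \<omega> - x n) (\<lambda>s. \<sigma> (x n) * kslice K ?T s)"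
      unfolding e_def by (rule solution_wiener_approx[OF c0 growth(1) growth(2) T \<sigma>_Holder]) (use n chi in \<open>auto simp: a_def intro!: add_nonneg_pos mult_nonneg_nonneg c0 ksq_nonneg\<close>)
    then have "wiener_approx (M n) (B n) ?T ((sqrt (\<Lambda> n))\<^sup>2 * e j n) (?Z n j) (\<lambda>s. sqrt (\<Lambda> n) * (\<sigma> (x n) * kslice K ?T s))"
      by (rule wiener_approx_scale) (use T e0 in auto)
    moreover have "?T \<le> \<theta>"
    proof -
      have "?T \<le> \<tau> j / 1" using times(2)[of j] n by (intro divide_left_mono) auto
      then show ?thesis using \<theta>[of j] by simp
    qed
    moreover have "(sqrt (\<Lambda> n))\<^sup>2 * e j n \<le> \<rho> n"
    proof -
      have "\<Lambda> n * e j n \<le> \<rho> n"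
        unfolding \<rho>_def by (rule member_le_sum) (auto intro: mult_nonneg_nonneg \<Lambda>0 e0)
      then show ?thesis using \<Lambda>0[of n] by simp
    qed
    ultimately show ?thesis by (rule wiener_approx_mono)
  qed
  have \<theta>0: "0 \<le> \<theta>" using \<theta>[of undefined] times(2)[of undefined] by simp
  have approxY: "wiener_approx W \<beta> \<theta> 0 (Y (\<tau> j)) (\<lambda>s. \<sigma> xbar * kslice Kbar (\<tau> j) s)" for j
  proof -
    have t: "0 \<le> \<tau> j" using times(2)[of j] by simp
    have "wiener_approx W \<beta> (\<tau> j) ((\<sigma> xbar)\<^sup>2 * 0) (\<lambda>\<omega>. \<sigma> xbar * J (\<tau> j) \<omega>) (\<lambda>s. \<sigma> xbar * kslice Kbar (\<tau> j) s)"
      by (intro W.wiener_approx_scale W.wiener_approx_wiener_integral[OF J[OF t] t ii(1)] t) auto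
    moreover have "(\<lambda>\<omega>. \<sigma> xbar * J (\<tau> j) \<omega>) = Y (\<tau> j)" using Y[OF t] by auto
    ultimately show ?thesis using W.wiener_approx_mono[OF _ \<theta>[of j], of 0 "Y (\<tau> j)" _ 0] by simp
  qed
  let ?V = "\<lambda>n \<omega>. (\<chi> j. ?Z n j \<omega>)" and ?Y = "\<lambda>\<omega>. (\<chi> j. Y (\<tau> j) \<omega>)"
  have Ym: "Y (\<tau> j) \<in> borel_measurable W" for j using approxY[of j] by (simp add: wiener_approx_def)
  have Zm: "?Z n j \<in> borel_measurable (M n)" if "n \<ge> 1" for n j
  proof -
    interpret volterra_solution "M n" "F n" "B n" K b \<sigma> "x n" "X n" by (rule VS[OF that])
    have "0 \<le> \<tau> j / real n" using times(2)[of j] by simp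
    from X_meas[OF this] show ?thesis by simp
  qed
  \<comment> \<open>a common bound for the second moments of the rescaled vectors and of the limit\<close>
  define S where "S = (\<Sum>j\<in>UNIV. 8 * c * (ksq Kbar (\<tau> j) + 1) + (\<sigma> xbar)\<^sup>2 * ksq Kbar (\<tau> j))"
  have "converges_in_distribution M ?V W ?Y"
  proof (rule levy_continuity_cos)
    show "prob_space (M n)" if "n \<ge> 1" for n
      using X[OF that] by (simp add: continuous_weak_solution_def brownian_motion_def filtered_prob_space_def)
    show "prob_space W" by (rule W.prob_space_axioms)
    show "?V n \<in> borel_measurable (M n)" if "n \<ge> 1" for n by (rule vec_lambda_borel_measurable[OF Zm[OF that]])
    show "?Y \<in> borel_measurable W" by (rule vec_lambda_borel_measurable[OF Ym])
    show "(\<integral>\<^sup>+\<omega>. ennreal ((norm (?Y \<omega>))\<^sup>2) \<partial>W) \<le> ennreal S"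
    proof -
      have "(\<integral>\<^sup>+\<omega>. ennreal ((Y (\<tau> j) \<omega>)\<^sup>2) \<partial>W) \<le> ennreal (8 * c * (ksq Kbar (\<tau> j) + 1) + (\<sigma> xbar)\<^sup>2 * ksq Kbar (\<tau> j))" for j
      proof -
        have t: "0 \<le> \<tau> j" using times(2)[of j] by simp
        have [measurable]: "J (\<tau> j) \<in> borel_measurable W" using J[OF t] by (simp add: has_ito_integral_def)
        have "(\<integral>\<^sup>+\<omega>. ennreal ((Y (\<tau> j) \<omega>)\<^sup>2) \<partial>W) = (\<integral>\<^sup>+\<omega>. ennreal ((\<sigma> xbar)\<^sup>2) * ennreal ((J (\<tau> j) \<omega>)\<^sup>2) \<partial>W)"
          by (intro nn_integral_cong) (simp add: Y[OF t] power_mult_distrib ennreal_mult)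
        also have "\<dots> = ennreal ((\<sigma> xbar)\<^sup>2) * (\<integral>\<^sup>+\<omega>. ennreal ((J (\<tau> j) \<omega>)\<^sup>2) \<partial>W)" by (rule nn_integral_cmult) simp
        also have "\<dots> \<le> ennreal ((\<sigma> xbar)\<^sup>2) * ennreal (ksq Kbar (\<tau> j))"
          by (intro mult_left_mono W.wiener_integral_second_moment[OF J[OF t] t ii(1)]) simp
        also have "\<dots> = ennreal ((\<sigma> xbar)\<^sup>2 * ksq Kbar (\<tau> j))" using ksq_nonneg[of Kbar] by (simp add: ennreal_mult)
        also have "\<dots> \<le> ennreal (8 * c * (ksq Kbar (\<tau> j) + 1) + (\<sigma> xbar)\<^sup>2 * ksq Kbar (\<tau> j))"
          using c0 ksq_nonneg[of Kbar "\<tau> j"] by (intro ennreal_leI) simp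
        finally show ?thesis .
      qed
      then have "(\<Sum>j\<in>UNIV. \<integral>\<^sup>+\<omega>. ennreal ((Y (\<tau> j) \<omega>)\<^sup>2) \<partial>W)
          \<le> (\<Sum>j\<in>UNIV. ennreal (8 * c * (ksq Kbar (\<tau> j) + 1) + (\<sigma> xbar)\<^sup>2 * ksq Kbar (\<tau> j)))" by (rule sum_mono)
      also have "\<dots> = ennreal S" unfolding S_def using c0 ksq_nonneg[of Kbar] by (intro sum_ennreal) simp
      finally show ?thesis using Ym by (simp add: nn_integral_norm_vec_sq)
    qed
    have "\<forall>\<^sub>F n in sequentially. \<forall>j. \<Lambda> n * ksq K (\<tau> j / real n) \<le> ksq Kbar (\<tau> j) + 1"
    proof (intro eventually_all_finite)
      fix j
      have "\<forall>\<^sub>F n in sequentially. \<Lambda> n * ksq K (\<tau> j / real n) < ksq Kbar (\<tau> j) + 1"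
        by (rule order_tendstoD(2)[OF var]) simp
      then show "\<forall>\<^sub>F n in sequentially. \<Lambda> n * ksq K (\<tau> j / real n) \<le> ksq Kbar (\<tau> j) + 1"
        by eventually_elim simp
    qed
    with ev show "\<forall>\<^sub>F n in sequentially. (\<integral>\<^sup>+\<omega>. ennreal ((norm (?V n \<omega>))\<^sup>2) \<partial>M n) \<le> ennreal S"
    proof eventually_elim
      case (elim n)
      interpret volterra_solution "M n" "F n" "B n" K b \<sigma> "x n" "X n" by (rule VS) (use elim in auto)
      have "(\<integral>\<^sup>+\<omega>. ennreal ((?Z n j \<omega>)\<^sup>2) \<partial>M n) \<le> ennreal (8 * c * (ksq Kbar (\<tau> j) + 1) + (\<sigma> xbar)\<^sup>2 * ksq Kbar (\<tau> j))" for j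
      proof -
        let ?T = "\<tau> j / real n"
        have T: "0 < ?T" "?T \<le> 1" "4 * c * ksq K ?T \<le> 1 / 2" using elim by auto
        have [measurable]: "X n ?T \<in> borel_measurable (M n)" using X_meas T by auto
        have "(\<integral>\<^sup>+\<omega>. ennreal ((?Z n j \<omega>)\<^sup>2) \<partial>M n) = (\<integral>\<^sup>+\<omega>. ennreal (\<Lambda> n) * ennreal ((X n ?T \<omega> - x n)\<^sup>2) \<partial>M n)"
          using \<Lambda>0[of n] by (intro nn_integral_cong) (simp add: power_mult_distrib ennreal_mult)
        also have "\<dots> = ennreal (\<Lambda> n) * (\<integral>\<^sup>+\<omega>. ennreal ((X n ?T \<omega> - x n)\<^sup>2) \<partial>M n)" by (rule nn_integral_cmult) simp
        also have "\<dots> \<le> ennreal (\<Lambda> n) * ennreal (8 * c * ksq K ?T)"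
          by (intro mult_left_mono second_moment[OF c0 growth(1) growth(2) T]) (use elim in auto)
        also have "\<dots> = ennreal (8 * c * (\<Lambda> n * ksq K ?T))"
          using \<Lambda>0[of n] c0 ksq_nonneg[of K ?T] by (simp add: ennreal_mult[symmetric] mult_ac)
        also have "\<dots> \<le> ennreal (8 * c * (ksq Kbar (\<tau> j) + 1) + (\<sigma> xbar)\<^sup>2 * ksq Kbar (\<tau> j))"
        proof (rule ennreal_leI)
          have "8 * c * (\<Lambda> n * ksq K ?T) \<le> 8 * c * (ksq Kbar (\<tau> j) + 1)" using elim c0 by (intro mult_left_mono) auto
          moreover have "0 \<le> (\<sigma> xbar)\<^sup>2 * ksq Kbar (\<tau> j)" using ksq_nonneg[of Kbar] by simp
          ultimately show "8 * c * (\<Lambda> n * ksq K ?T) \<le> 8 * c * (ksq Kbar (\<tau> j) + 1) + (\<sigma> xbar)\<^sup>2 * ksq Kbar (\<tau> j)" by linarith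
        qed
        finally show ?thesis .
      qed
      then have "(\<Sum>j\<in>UNIV. \<integral>\<^sup>+\<omega>. ennreal ((?Z n j \<omega>)\<^sup>2) \<partial>M n)
          \<le> (\<Sum>j\<in>UNIV. ennreal (8 * c * (ksq Kbar (\<tau> j) + 1) + (\<sigma> xbar)\<^sup>2 * ksq Kbar (\<tau> j)))" by (rule sum_mono)
      also have "\<dots> = ennreal S" unfolding S_def using c0 ksq_nonneg[of Kbar] by (intro sum_ennreal) simp
      finally show ?case using Zm[of n] elim by (simp only: nn_integral_norm_vec_sq)
    qed
    fix u :: "(real, 'N) vec" and d :: real
    define w where "w j = u $ j" for j
    have inner: "u \<bullet> (\<chi> j. f j) = (\<Sum>j\<in>UNIV. w j * f j)" for f
      by (simp add: inner_vec_def w_def)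
    define q where "q = (\<integral>s. (\<Sum>j\<in>UNIV. w j * (\<sigma> xbar * kslice Kbar (\<tau> j) s))\<^sup>2 \<partial>lborel)"
    define q' where "q' n = (\<integral>s. (\<Sum>j\<in>UNIV. w j * (sqrt (\<Lambda> n) * (\<sigma> (x n) * kslice K (\<tau> j / real n) s)))\<^sup>2 \<partial>lborel)" for n
    define \<kappa> where "\<kappa> = (\<Sum>j\<in>UNIV. (w j)\<^sup>2) * card (UNIV :: 'N set)"
    have \<kappa>0: "0 \<le> \<kappa>" unfolding \<kappa>_def by (intro mult_nonneg_nonneg sum_nonneg) auto
    have km: "kslice K t \<in> borel_measurable lborel" "kslice Kbar t \<in> borel_measurable lborel" for t
      using kslice_measurable[OF K] kslice_measurable[OF ii(1)] by auto
    have q_eq: "q = (\<Sum>i\<in>UNIV. \<Sum>j\<in>UNIV. w i * \<sigma> xbar * (w j * \<sigma> xbar) * (\<integral>s. kslice Kbar (\<tau> i) s * kslice Kbar (\<tau> j) s \<partial>lborel))"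
      unfolding q_def mult.assoc[symmetric]
      by (subst integral_weighted_sum_sq) (use km kslice_sq(1)[OF ii(1)] in \<open>auto simp: mult.assoc\<close>)
    have q'_eq: "q' n = (\<Sum>i\<in>UNIV. \<Sum>j\<in>UNIV. w i * \<sigma> (x n) * (w j * \<sigma> (x n)) * (\<Lambda> n * (\<integral>s. kslice K (\<tau> i / real n) s * kslice K (\<tau> j / real n) s \<partial>lborel)))" for n
    proof -
      have "q' n = (\<integral>s. (\<Sum>j\<in>UNIV. (w j * sqrt (\<Lambda> n) * \<sigma> (x n)) * kslice K (\<tau> j / real n) s)\<^sup>2 \<partial>lborel)"
        unfolding q'_def by (simp add: mult.assoc)
      also have "\<dots> = (\<Sum>i\<in>UNIV. \<Sum>j\<in>UNIV. (w i * sqrt (\<Lambda> n) * \<sigma> (x n)) * (w j * sqrt (\<Lambda> n) * \<sigma> (x n)) * (\<integral>s. kslice K (\<tau> i / real n) s * kslice K (\<tau> j / real n) s \<partial>lborel))"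
        by (rule integral_weighted_sum_sq) (use km kslice_sq(1)[OF K] in auto)
      also have "\<dots> = (\<Sum>i\<in>UNIV. \<Sum>j\<in>UNIV. w i * \<sigma> (x n) * (w j * \<sigma> (x n)) * ((sqrt (\<Lambda> n) * sqrt (\<Lambda> n)) * (\<integral>s. kslice K (\<tau> i / real n) s * kslice K (\<tau> j / real n) s \<partial>lborel)))"
        by (intro sum.cong refl) (simp only: mult_ac)
      finally show ?thesis using \<Lambda>0[of n] by simp
    qed
    have \<sigma>_lim: "(\<lambda>n. \<sigma> (x n)) \<longlonglongrightarrow> \<sigma> xbar"
      by (rule continuous_on_tendsto_compose[OF holder_continuous[OF \<sigma>_Holder] x_lim]) (use chi in auto)
    have q_lim: "q' \<longlonglongrightarrow> q"
      unfolding q_eq q'_eq by (intro tendsto_intros \<sigma>_lim cov)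
    have limY: "(\<integral>\<omega>. cos (u \<bullet> ?Y \<omega> + d) \<partial>W) = cos d * exp (- q / 2)"
    proof -
      have "wiener_approx W \<beta> \<theta> (\<kappa> * 0) (\<lambda>\<omega>. \<Sum>j\<in>UNIV. w j * Y (\<tau> j) \<omega>) (\<lambda>s. \<Sum>j\<in>UNIV. w j * (\<sigma> xbar * kslice Kbar (\<tau> j) s))"
        unfolding \<kappa>_def by (rule W.wiener_approx_sum[OF _ \<theta>0 _ approxY]) auto
      from W.wiener_approx_expectation_cos[OF this, of d] show ?thesis by (simp add: inner q_def)
    qed
    have bound: "\<forall>\<^sub>F n in sequentially. norm ((\<integral>\<omega>. cos (u \<bullet> ?V n \<omega> + d) \<partial>M n) - cos d * exp (- q' n / 2)) \<le> sqrt (\<kappa> * \<rho> n)"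
      using ev
    proof eventually_elim
      case (elim n)
      interpret volterra_solution "M n" "F n" "B n" K b \<sigma> "x n" "X n" by (rule VS) (use elim in auto)
      have "wiener_approx (M n) (B n) \<theta> (\<kappa> * \<rho> n) (\<lambda>\<omega>. \<Sum>j\<in>UNIV. w j * ?Z n j \<omega>)
          (\<lambda>s. \<Sum>j\<in>UNIV. w j * (sqrt (\<Lambda> n) * (\<sigma> (x n) * kslice K (\<tau> j / real n) s)))"
        unfolding \<kappa>_def by (rule wiener_approx_sum[OF _ \<theta>0 \<rho>0 approxX[OF elim]]) auto
      from wiener_approx_expectation_cos[OF this, of d] \<kappa>0 \<rho>0[of n] show ?case by (simp add: inner q'_def)
    qed
    have "(\<lambda>n. sqrt (\<kappa> * \<rho> n)) \<longlonglongrightarrow> sqrt (\<kappa> * 0)" by (intro tendsto_intros \<rho>_lim)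
    then have "(\<lambda>n. sqrt (\<kappa> * \<rho> n)) \<longlonglongrightarrow> 0" by simp
    from Lim_null_comparison[OF bound this]
    have "(\<lambda>n. ((\<integral>\<omega>. cos (u \<bullet> ?V n \<omega> + d) \<partial>M n) - cos d * exp (- q' n / 2)) + cos d * exp (- q' n / 2)) \<longlonglongrightarrow> 0 + cos d * exp (- q / 2)"
      by (intro tendsto_intros q_lim) auto
    then show "(\<lambda>n. \<integral>\<omega>. cos (u \<bullet> ?V n \<omega> + d) \<partial>M n) \<longlonglongrightarrow> (\<integral>\<omega>. cos (u \<bullet> ?Y \<omega> + d) \<partial>W)"
      by (simp add: limY)
  qed
  then show ?thesis by (simp add: \<Lambda>_def)
qed

end
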